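(* Let $s\neq\pm1$ be an odd integer such that $E_1(s,1)=s^4-2s^3+4s^2-3s+1$ and $E_2(s,1)=s^4+3s^3+4s^2+2s+1$ are both cube-free. Then the Lecacheux quintic field $K_s$ is not monogenic. Moreover, the field index satisfies $I(K_s)=1$ whenever $s\neq\pm1$ is an odd integer such that $3\nmid s$.
   Context: For $s\in\mathbb{Q}$ the Lecacheux quintic polynomial is $f_s(X)=X^5+a_4(s)X^4+a_3(s)X^3+a_2(s)X^2+a_1(s)X+a_0(s)\in\mathbb{Q}[X]$, where $a_4(s)=s^5-3$, $a_3(s)=-s^9-2s^8-3s^7-5s^6-6s^5-2s^4+s^3-s^2+3$, $a_2(s)=s^{10}+2s^9+4s^8+6s^7+10s^6+9s^5+4s^4-2s^3+2s^2-1$, $a_1(s)=-s^2(s^7+2s^6+3s^5+5s^4+5s^3+2s^2-s+1)$, $a_0(s)=s^5$. If $f_s$ is irreducible over $\mathbb{Q}$ (known to hold for every odd integer $s$), then $K_s=\mathbb{Q}(\theta_s)$, with $\theta_s$ a root of $f_s$, is a cyclic quintic field, called a Lecacheux quintic field. A number field $K$ with ring of integers $\mathcal{O}_K$ is monogenic if $\mathcal{O}_K=\mathbb{Z}[\theta]$ for some $\theta\in K$. For $\theta\in\mathcal{O}_K$ with $K=\mathbb{Q}(\theta)$, the index of $\theta$ is $I(\theta)=[\mathcal{O}_K:\mathbb{Z}[\theta]]$; the index of the field is $I(K)=\gcd\{I(\theta) : \theta\in\mathcal{O}_K,\ K=\mathbb{Q}(\theta)\}$. An integer is cube-free if it is not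 divisible by the cube of any prime. *)

theory Defs
  imports
    "HOL-Algebra.Algebraic_Closure_Type"
    "HOL-Algebra.Generated_Fields"
    "HOL-Algebra.AbelCoset"
    "HOL-Analysis.Analysis"
begin

text \<open>
  Number fields are taken to be subfields of \<open>\<complex>\<close>, which is viewed as an object of
  \<open>HOL-Algebra\<close> through \<open>ring_of_type_algebra\<close>.
\<close>

abbreviation complex_ring :: "complex ring"
  where "complex_ring \<equiv> ring_of_type_algebra"

text \<open>As \<open>\<complex>\<close> has characteristic 0, the subfield generated by \<open>\<theta>\<close> is \<open>\<rat>(\<theta>)\<close> and
  the subring generated by \<open>\<theta>\<close> is \<open>\<int>[\<theta>]\<close>.\<close>

definition rat_adjoin :: "complex \<Rightarrow> complex set"
  where "rat_adjoin \<theta> = generate_field complex_ring {\<theta>}"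

definition int_adjoin :: "complex \<Rightarrow> complex set"
  where "int_adjoin \<theta> = generate_ring complex_ring {\<theta>}"

definition ring_of_integers :: "complex set \<Rightarrow> complex set"
  where "ring_of_integers K = {x \<in> K. algebraic_int x}"

definition monogenic :: "complex set \<Rightarrow> bool"
  where "monogenic K \<longleftrightarrow> (\<exists>\<theta>\<in>K. ring_of_integers K = int_adjoin \<theta>)"

text \<open>The index is that of additive groups: the number of additive cosets of \<open>\<int>[\<theta>]\<close> in the
  ring of integers. It is only used for \<open>\<theta>\<close> an algebraic integer generating the number
  field \<open>K\<close>, in which case it is finite.\<close>

definition element_index :: "complex set \<Rightarrow> complex \<Rightarrow> nat"
  where "element_index K \<theta> =
    card (a_rcosets\<^bsub>complex_ring\<lparr>carrier := ring_of_integers K\<rparr>\<^esub> (int_adjoin \<theta>))"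

definition field_index :: "complex set \<Rightarrow> nat"
  where "field_index K =
    Gcd {element_index K \<theta> | \<theta>. \<theta> \<in> ring_of_integers K \<and> K = rat_adjoin \<theta>}"

definition cube_free :: "int \<Rightarrow> bool"
  where "cube_free n \<longleftrightarrow> (\<forall>p. prime p \<longrightarrow> \<not> p ^ 3 dvd n)"

definition lecacheux_poly :: "rat \<Rightarrow> rat poly"
  where "lecacheux_poly s =
    [: s^5,
       - (s^2 * (s^7 + 2 * s^6 + 3 * s^5 + 5 * s^4 + 5 * s^3 + 2 * s^2 - s + 1)),
       s^10 + 2 * s^9 + 4 * s^8 + 6 * s^7 + 10 * s^6 + 9 * s^5 + 4 * s^4 - 2 * s^3 + 2 * s^2 - 1,
       - (s^9) - 2 * s^8 - 3 * s^7 - 5 * s^6 - 6 * s^5 - 2 * s^4 + s^3 - s^2 + 3,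
       s^5 - 3,
       1 :]"

text \<open>The values \<open>E\<^sub>1(s,1)\<close> and \<open>E\<^sub>2(s,1)\<close>.\<close>

definition lecacheux_E1 :: "int \<Rightarrow> int"
  where "lecacheux_E1 s = s^4 - 2 * s^3 + 4 * s^2 - 3 * s + 1"

definition lecacheux_E2 :: "int \<Rightarrow> int"
  where "lecacheux_E2 s = s^4 + 3 * s^3 + 4 * s^2 + 2 * s + 1"

end

theory Submission
  imports Defs "HOL-Algebra.Sylow" "Jordan_Normal_Form.Char_Poly"
begin

text \<open>Write \<open>\<O>\<close> for the ring of integers of a cyclic quintic field \<open>K\<close>, with a generator \<open>\<sigma>\<close> of its Galois
  group.

  \<^emph>\<open>Non-monogenicity.\<close> The argument is essentially that of M.-N. Gras. Let \<open>\<O> = \<int>[\<alpha>]\<close> and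
  \<open>\<delta> = \<sigma>\<alpha> - \<alpha>\<close>. Then \<open>\<delta>\<close> divides \<open>\<sigma>x - x\<close> for all \<open>x \<in> \<O>\<close>, so \<open>\<epsilon> = \<sigma>\<delta>/\<delta>\<close> is a unit, and
  so is \<open>1 + \<epsilon> = (\<sigma>\<^sup>2\<alpha> - \<alpha>)/\<delta>\<close>, by the same argument for the generator \<open>\<sigma>\<^sup>2\<close>. Modulo \<open>\<delta>\<close> the Galois
  group acts trivially, so the norm of \<open>x\<close> is \<open>x\<^sup>5\<close>; this gives \<open>(1 + \<epsilon>)\<^bsup>10\<^esup> = 1\<close>, while the sum of
  the conjugates of \<open>\<delta>\<close> being 0 gives \<open>1 + \<epsilon> + \<epsilon>\<^sup>2 + \<epsilon>\<^sup>3 + \<epsilon>\<^sup>4 = 0\<close>. The ideal of \<open>\<int>[X]\<close> generated by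
  the two polynomials contains 11 (\<open>eleven_bezout\<close>), so \<open>\<delta>\<close> divides 11 and \<open>\<O>/q\<O>\<close> is reduced for
  every prime \<open>q \<noteq> 11\<close> (\<open>monogenic_unramified_outside_11\<close>). For the Lecacheux field the element
  \<open>\<beta> = 5\<theta> + s\<^sup>5 - 3\<close> of trace 0 has a characteristic polynomial whose lower coefficients are divisible
  by \<open>E\<^sub>1E\<^sub>2\<close>, and it has norm \<open>-E\<^sub>1E\<^sub>2\<^sup>2C\<close> with \<open>E\<^sub>1\<close> coprime to \<open>E\<^sub>2C\<close> up to powers of 5. If \<open>E\<^sub>1\<close> is cube-free
  and \<open>\<bar>s\<bar> > 1\<close>, there is a prime \<open>q \<noteq> 11\<close> dividing \<open>E\<^sub>1E\<^sub>2\<close> whose fifth power does not divide this norm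
  (\<open>exists_ramified_prime\<close>); so \<open>\<beta>\<^sup>5 \<in> q\<O>\<close> but \<open>\<beta> \<notin> q\<O>\<close>, a contradiction.

  \<^emph>\<open>The index.\<close> For each prime \<open>p\<close> an element of index prime to \<open>p\<close> is needed. If \<open>p \<ge> 5\<close>, one
  exists in every cyclic quintic field (\<open>exists_index_not_dvd\<close>): \<open>\<O>/p\<O>\<close> either has a nontrivial
  idempotent, and then it is a product of five copies of the field with \<open>p\<close> elements, so that an element
  with five distinct coordinates can be chosen; or it is local with \<open>\<sigma>\<close> acting nontrivially on its residue
  field; or \<open>p\<close> is ramified, and a uniformizer does. For \<open>p = 2\<close>, and for \<open>p = 3\<close> if 3 does not
  divide \<open>s\<close>, the root \<open>\<theta>\<close> itself will do, since its different is a unit modulo \<open>p\<close>.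

  The identity \<open>dual_basis\<close>, which expands every element in the basis of powers of a generator by means
  of traces, replaces the theory of discriminants and the finite generation of \<open>\<O>\<close>. The
  automorphism \<open>\<sigma>\<close> of the Lecacheux field comes from an explicit cycle of rational functions permuting
  the roots.\<close>

section \<open>Sums and products of algebraic integers\<close>

lemma algebraic_int_eigenvalue:
  fixes A :: "nat \<Rightarrow> nat \<Rightarrow> int" and v :: "nat \<Rightarrow> complex"
  assumes eq: "\<And>i. i < n \<Longrightarrow> z * v i = (\<Sum>j<n. of_int (A i j) * v j)"
    and nz: "k < n" "v k \<noteq> 0"
  shows "algebraic_int z"
proof -
  define M :: "int mat" where "M = mat n n (\<lambda>(i,j). A i j)"
  have M: "M \<in> carrier_mat n n" by (simp add: M_def)
  define MC :: "complex mat" where "MC = map_mat of_int M"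
  have MC: "MC \<in> carrier_mat n n" using M by (simp add: MC_def)
  have cp: "char_poly MC = map_poly of_int (char_poly M)"
    unfolding MC_def by (rule of_int_hom.char_poly_hom[OF M])
  have "MC *\<^sub>v vec n v = z \<cdot>\<^sub>v vec n v"
  proof (rule eq_vecI)
    fix i assume "i < dim_vec (z \<cdot>\<^sub>v vec n v)"
    then have i: "i < n" by simp
    have "vec_index (MC *\<^sub>v vec n v) i = (\<Sum>j<n. of_int (A i j) * v j)"
      using i by (simp add: MC_def M_def mult_mat_vec_def scalar_prod_def atLeast0LessThan)
    then show "vec_index (MC *\<^sub>v vec n v) i = vec_index (z \<cdot>\<^sub>v vec n v) i" using i eq by simp
  qed (simp add: MC_def M_def)
  moreover have "vec n v \<noteq> 0\<^sub>v n"
    using nz by (metis index_vec index_zero_vec(1))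
  ultimately have "eigenvalue MC z"
    unfolding eigenvalue_def eigenvector_def using MC by (intro exI[of _ "vec n v"]) auto
  then have "poly (map_poly of_int (char_poly M)) z = 0"
    using eigenvalue_root_char_poly[OF MC] cp by simp
  moreover have "lead_coeff (char_poly M) = 1"
    using degree_monic_char_poly[OF M] by simp
  ultimately show ?thesis
    unfolding algebraic_int_altdef_ipoly by blast
qed

lemma algebraic_int_power_reduce:
  fixes x :: complex
  assumes "algebraic_int x"
  obtains n c where "n > 0" "x ^ n = (\<Sum>i<n. of_int (c i) * x ^ i)"
proof -
  obtain p :: "int poly" where p: "poly (map_poly of_int p) x = 0" "lead_coeff p = 1"
    using assms unfolding algebraic_int_altdef_ipoly by auto
  define n where "n = degree p"
  have "poly (map_poly of_int p) x = (\<Sum>i\<le>n. of_int (coeff p i) * x ^ i)"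
    by (simp add: poly_altdef degree_map_poly coeff_map_poly n_def)
  also have "\<dots> = (\<Sum>i<n. of_int (coeff p i) * x ^ i) + x ^ n"
    using p(2) by (simp add: n_def flip: lessThan_Suc_atMost)
  finally have eq: "x ^ n = (\<Sum>i<n. of_int (- coeff p i) * x ^ i)"
    using p(1) by (simp add: sum_negf add_eq_0_iff2)
  moreover have "n > 0"
  proof (rule ccontr)
    assume "\<not> n > 0"
    then show False using eq by simp
  qed
  ultimately show ?thesis using that[of n "\<lambda>i. - coeff p i"] by simp
qed

lemma algebraic_int_of_int_span:
  fixes z :: complex and v :: "nat \<Rightarrow> complex"
  assumes nz: "k < n" "v k \<noteq> 0"
    and sp: "\<And>i. i < n \<Longrightarrow> \<exists>a. z * v i = (\<Sum>j<n. of_int (a j) * v j)"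
  shows "algebraic_int z"
proof -
  have "\<forall>i. \<exists>a. i < n \<longrightarrow> z * v i = (\<Sum>j<n. of_int (a j) * v j)" using sp by blast
  then obtain A where "\<forall>i. i < n \<longrightarrow> z * v i = (\<Sum>j<n. of_int (A i j) * v j)"
    by (metis (no_types))
  then show ?thesis using algebraic_int_eigenvalue[of n z v A k] nz by blast
qed

text \<open>The ring \<open>\<int>[x,y]\<close> is spanned by finitely many monomials \<open>x\<^sup>iy\<^sup>j\<close>, here enumerated as \<open>v\<close> with
  \<open>k = i * n + j\<close>. An element of this ring acts on it by an integer matrix, of which it is an eigenvalue.\<close>

lemma algebraic_int_add_mult:
  fixes x y :: complex
  assumes "algebraic_int x" "algebraic_int y"
  shows "algebraic_int (x + y)" "algebraic_int (x * y)"
proof -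
  obtain m c where m: "m > 0" "x ^ m = (\<Sum>i<m. of_int (c i) * x ^ i)"
    using algebraic_int_power_reduce[OF assms(1)] .
  obtain n d where n: "n > 0" "y ^ n = (\<Sum>i<n. of_int (d i) * y ^ i)"
    using algebraic_int_power_reduce[OF assms(2)] .
  define v where "v k = x ^ (k div n) * y ^ (k mod n)" for k
  define S where "S = {w. \<exists>a. w = (\<Sum>k<m*n. of_int (a k) * v k)}"
  have S_sum: "(\<Sum>i\<in>I. of_int (e i) * w i) \<in> S"
    if "\<And>i. i \<in> I \<Longrightarrow> w i \<in> S" for I :: "nat set" and e w
  proof -
    have "\<forall>i. \<exists>a. i \<in> I \<longrightarrow> w i = (\<Sum>k<m*n. of_int (a k) * v k)" using that unfolding S_def by blast
    then obtain a where a: "\<And>i. i \<in> I \<Longrightarrow> w i = (\<Sum>k<m*n. of_int (a i k) * v k)" by metis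
    have "(\<Sum>i\<in>I. of_int (e i) * w i) = (\<Sum>i\<in>I. \<Sum>k<m*n. of_int (e i * a i k) * v k)"
      by (intro sum.cong refl) (simp add: a sum_distrib_left mult.assoc)
    also have "\<dots> = (\<Sum>k<m*n. \<Sum>i\<in>I. of_int (e i * a i k) * v k)" by (rule sum.swap)
    also have "\<dots> = (\<Sum>k<m*n. of_int (\<Sum>i\<in>I. e i * a i k) * v k)"
      by (simp add: sum_distrib_right)
    finally show ?thesis unfolding S_def by (intro CollectI exI)
  qed
  have S_v: "v k \<in> S" if "k < m * n" for k
  proof -
    have "v k = (\<Sum>j<m*n. of_int (if j = k then 1 else 0) * v j)"
      using that by (simp add: if_distrib[of of_int] if_distrib[of "\<lambda>t. t * _"] cong: if_cong)
    then show ?thesis unfolding S_def by (intro CollectI exI)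
  qed
  have S_xy: "x ^ i * y ^ j \<in> S" if "i < m" "j < n" for i j
  proof -
    have "(i * n + j) div n = i" "(i * n + j) mod n = j" using that by simp_all
    moreover have "i * n + j < m * n"
    proof -
      have "i * n + j < Suc i * n" using that by simp
      also have "\<dots> \<le> m * n" using that by (intro mult_right_mono) auto
      finally show ?thesis .
    qed
    ultimately show ?thesis using S_v[of "i*n+j"] by (simp add: v_def)
  qed
  have S_xy': "x ^ i * y ^ j \<in> S" if ij: "i \<le> m" "j \<le> n" "i < m \<or> j < n" for i j
  proof -
    consider "i < m" "j < n" | "i = m" "j < n" | "i < m" "j = n"
      using ij by (auto simp: le_less)
    then show ?thesis
    proof cases
      case 2
      have "x ^ i * y ^ j = (\<Sum>l<m. of_int (c l) * (x ^ l * y ^ j))"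
        using 2 m(2) by (simp add: sum_distrib_right mult.assoc)
      then show ?thesis using S_sum[of "{..<m}" "\<lambda>l. x ^ l * y ^ j" c] S_xy 2 by simp
    next
      case 3
      have "x ^ i * y ^ j = (\<Sum>l<n. of_int (d l) * (x ^ i * y ^ l))"
        using 3 n(2) by (simp add: sum_distrib_left mult_ac)
      then show ?thesis using S_sum[of "{..<n}" "\<lambda>l. x ^ i * y ^ l" d] S_xy 3 by simp
    qed (use S_xy in auto)
  qed
  have S_add: "u + w \<in> S" if "u \<in> S" "w \<in> S" for u w
  proof -
    have "(\<Sum>i\<in>{0,1::nat}. of_int 1 * (if i = 0 then u else w)) \<in> S"
      by (rule S_sum) (use that in auto)
    then show ?thesis by simp
  qed
  have bnd: "k div n < m" "k mod n < n" if "k < m * n" for k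
    using that n(1) less_mult_imp_div_less[of k m n] by simp_all
  have Sx: "x * v k \<in> S" if "k < m * n" for k
    using S_xy'[of "Suc (k div n)" "k mod n"] bnd[OF that] by (simp add: v_def mult.assoc)
  have Sy: "y * v k \<in> S" if "k < m * n" for k
    using S_xy'[of "k div n" "Suc (k mod n)"] bnd[OF that] by (simp add: v_def mult_ac)
  have Sy': "y * w \<in> S" if w: "w \<in> S" for w
  proof -
    obtain a where "w = (\<Sum>k<m*n. of_int (a k) * v k)" using w unfolding S_def by blast
    then have "y * w = (\<Sum>k<m*n. of_int (a k) * (y * v k))" by (simp add: sum_distrib_left mult_ac)
    then show ?thesis using S_sum[of "{..<m*n}" "\<lambda>k. y * v k" a] Sy by simp
  qed
  have nz: "0 < m * n" "v 0 \<noteq> 0" using m n by (auto simp: v_def)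
  show "algebraic_int (x + y)"
  proof (rule algebraic_int_of_int_span[of 0 "m * n" v, OF nz])
    fix i assume "i < m * n"
    then have "(x + y) * v i \<in> S" using S_add[OF Sx Sy] by (simp add: distrib_right)
    then show "\<exists>a. (x + y) * v i = (\<Sum>j<m*n. of_int (a j) * v j)" unfolding S_def by blast
  qed
  show "algebraic_int (x * y)"
  proof (rule algebraic_int_of_int_span[of 0 "m * n" v, OF nz])
    fix i assume "i < m * n"
    then have "x * y * v i \<in> S" using Sy'[OF Sx] by (simp add: mult_ac)
    then show "\<exists>a. x * y * v i = (\<Sum>j<m*n. of_int (a j) * v j)" unfolding S_def by blast
  qed
qed

section \<open>The ring and the field generated by a complex number\<close>

lemma complex_ring_simps [simp]:
  "carrier complex_ring = UNIV" "x \<oplus>\<^bsub>complex_ring\<^esub> y = x + y" "x \<otimes>\<^bsub>complex_ring\<^esub> y = x * y"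
  "\<one>\<^bsub>complex_ring\<^esub> = 1" "\<zero>\<^bsub>complex_ring\<^esub> = 0"
  by (simp_all add: ring_of_type_algebra_def)

lemma complex_ring_a_inv [simp]: "\<ominus>\<^bsub>complex_ring\<^esub> x = - x"
proof -
  interpret ring complex_ring by (rule ring_from_type_algebra)
  show ?thesis by (rule minus_equality) auto
qed

lemma complex_ring_m_inv [simp]: "x \<noteq> 0 \<Longrightarrow> inv\<^bsub>complex_ring\<^esub> x = inverse x"
proof -
  assume x: "x \<noteq> 0"
  interpret field complex_ring by (rule field_from_type_algebra)
  show ?thesis by (rule comm_inv_char) (use x in auto)
qed

lemma int_adjoin_self: "a \<in> int_adjoin a"
  unfolding int_adjoin_def by (rule generate_ring.incl) simp

lemma int_adjoin_one: "1 \<in> int_adjoin a"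
  unfolding int_adjoin_def using generate_ring.one[of complex_ring] by simp

lemma int_adjoin_uminus: "x \<in> int_adjoin a \<Longrightarrow> - x \<in> int_adjoin a"
  unfolding int_adjoin_def using generate_ring.a_inv[of x complex_ring] by simp

lemma int_adjoin_add: "x \<in> int_adjoin a \<Longrightarrow> y \<in> int_adjoin a \<Longrightarrow> x + y \<in> int_adjoin a"
  unfolding int_adjoin_def using generate_ring.eng_add[of x complex_ring] by simp

lemma int_adjoin_mult: "x \<in> int_adjoin a \<Longrightarrow> y \<in> int_adjoin a \<Longrightarrow> x * y \<in> int_adjoin a"
  unfolding int_adjoin_def using generate_ring.eng_mult[of x complex_ring] by simp

lemma int_adjoin_induct [consumes 1, case_names one self uminus add mult]:
  assumes "x \<in> int_adjoin a" "P 1" "P a"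
    and "\<And>x. x \<in> int_adjoin a \<Longrightarrow> P x \<Longrightarrow> P (- x)"
    and "\<And>x y. x \<in> int_adjoin a \<Longrightarrow> y \<in> int_adjoin a \<Longrightarrow> P x \<Longrightarrow> P y \<Longrightarrow> P (x + y)"
    and "\<And>x y. x \<in> int_adjoin a \<Longrightarrow> y \<in> int_adjoin a \<Longrightarrow> P x \<Longrightarrow> P y \<Longrightarrow> P (x * y)"
  shows "P x"
  using assms(1) unfolding int_adjoin_def
  by (induction rule: generate_ring.induct) (use assms(2-) in \<open>auto simp: int_adjoin_def\<close>)

lemma int_adjoin_diff: "x \<in> int_adjoin a \<Longrightarrow> y \<in> int_adjoin a \<Longrightarrow> x - y \<in> int_adjoin a"
  using int_adjoin_add[of x a "- y"] int_adjoin_uminus[of y a] by simp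

lemma int_adjoin_zero: "0 \<in> int_adjoin a"
  using int_adjoin_diff[OF int_adjoin_one int_adjoin_one] by simp

lemma int_adjoin_of_int: "of_int n \<in> int_adjoin a"
proof -
  have nat: "of_nat k \<in> int_adjoin a" for k
    by (induction k) (auto intro: int_adjoin_add int_adjoin_one int_adjoin_zero)
  show ?thesis
    using nat int_adjoin_uminus[OF nat[of "nat (-n)"]] nat[of "nat n"] by (cases "n \<ge> 0") auto
qed

lemma int_adjoin_power: "x \<in> int_adjoin a \<Longrightarrow> x ^ k \<in> int_adjoin a"
  by (induction k) (auto intro: int_adjoin_mult int_adjoin_one)

lemma rat_adjoin_self: "a \<in> rat_adjoin a"
  unfolding rat_adjoin_def by (rule generate_field.incl) simp

lemma rat_adjoin_one: "1 \<in> rat_adjoin a"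
  unfolding rat_adjoin_def using generate_field.one[of complex_ring] by simp

lemma rat_adjoin_uminus: "x \<in> rat_adjoin a \<Longrightarrow> - x \<in> rat_adjoin a"
  unfolding rat_adjoin_def using generate_field.a_inv[of x complex_ring] by simp

lemma rat_adjoin_add: "x \<in> rat_adjoin a \<Longrightarrow> y \<in> rat_adjoin a \<Longrightarrow> x + y \<in> rat_adjoin a"
  unfolding rat_adjoin_def using generate_field.eng_add[of x complex_ring] by simp

lemma rat_adjoin_mult: "x \<in> rat_adjoin a \<Longrightarrow> y \<in> rat_adjoin a \<Longrightarrow> x * y \<in> rat_adjoin a"
  unfolding rat_adjoin_def using generate_field.eng_mult[of x complex_ring] by simp

lemma rat_adjoin_zero: "0 \<in> rat_adjoin a"
  using rat_adjoin_add[OF rat_adjoin_one rat_adjoin_uminus[OF rat_adjoin_one]] by simp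

lemma rat_adjoin_inverse: "x \<in> rat_adjoin a \<Longrightarrow> inverse x \<in> rat_adjoin a"
  using generate_field.m_inv[of x complex_ring] rat_adjoin_zero[of a]
  unfolding rat_adjoin_def by (cases "x = 0") auto

lemma rat_adjoin_power: "x \<in> rat_adjoin a \<Longrightarrow> x ^ k \<in> rat_adjoin a"
  by (induction k) (auto intro: rat_adjoin_mult rat_adjoin_one)

lemma rat_adjoin_subset:
  assumes a: "a \<in> E" and one: "1 \<in> E" and un: "\<And>x. x \<in> E \<Longrightarrow> - x \<in> E"
    and ad: "\<And>x y. x \<in> E \<Longrightarrow> y \<in> E \<Longrightarrow> x + y \<in> E"
    and mu: "\<And>x y. x \<in> E \<Longrightarrow> y \<in> E \<Longrightarrow> x * y \<in> E"
    and iv: "\<And>x. x \<in> E \<Longrightarrow> inverse x \<in> E"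
  shows "rat_adjoin a \<subseteq> E"
proof
  fix x assume "x \<in> rat_adjoin a"
  then show "x \<in> E" unfolding rat_adjoin_def
    by (induction rule: generate_field.induct) (use assms in auto)
qed

lemma rat_adjoin_of_rat: "of_rat q \<in> rat_adjoin a"
proof -
  have nat: "of_nat k \<in> rat_adjoin a" for k
    by (induction k) (auto intro: rat_adjoin_add rat_adjoin_one rat_adjoin_zero)
  have int: "of_int n \<in> rat_adjoin a" for n
    using nat rat_adjoin_uminus[OF nat[of "nat (-n)"]] nat[of "nat n"] by (cases "n \<ge> 0") auto
  obtain m n where "quotient_of q = (m, n)" by fastforce
  then have "q = of_int m / of_int n" by (rule quotient_of_div)
  then have "of_rat q = (of_int m * inverse (of_int n) :: complex)"
    by (simp add: of_rat_divide flip: divide_inverse)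
  then show ?thesis using rat_adjoin_mult[OF int rat_adjoin_inverse[OF int]] by simp
qed

section \<open>Cyclic quintic fields\<close>

text \<open>A cyclic quintic field with a generator \<open>\<sigma>\<close> of its Galois group. Only the values of \<open>\<sigma>\<close> on \<open>K\<close>
  matter. The last two assumptions say that the fixed field is \<open>\<rat>\<close> and that \<open>\<sigma>\<close> is not the
  identity, the latter in a form that provides an integral generator.\<close>

locale cyclic_quintic =
  fixes K :: "complex set" and \<sigma> :: "complex \<Rightarrow> complex"
  assumes one_K: "1 \<in> K"
    and uminus_K: "x \<in> K \<Longrightarrow> - x \<in> K"
    and add_K: "x \<in> K \<Longrightarrow> y \<in> K \<Longrightarrow> x + y \<in> K"
    and mult_K: "x \<in> K \<Longrightarrow> y \<in> K \<Longrightarrow> x * y \<in> K"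
    and inverse_K: "x \<in> K \<Longrightarrow> inverse x \<in> K"
    and \<sigma>_K: "x \<in> K \<Longrightarrow> \<sigma> x \<in> K"
    and \<sigma>_one: "\<sigma> 1 = 1"
    and \<sigma>_add: "x \<in> K \<Longrightarrow> y \<in> K \<Longrightarrow> \<sigma> (x + y) = \<sigma> x + \<sigma> y"
    and \<sigma>_mult: "x \<in> K \<Longrightarrow> y \<in> K \<Longrightarrow> \<sigma> (x * y) = \<sigma> x * \<sigma> y"
    and \<sigma>_5: "x \<in> K \<Longrightarrow> \<sigma> (\<sigma> (\<sigma> (\<sigma> (\<sigma> x)))) = x"
    and fixed_rat: "x \<in> K \<Longrightarrow> \<sigma> x = x \<Longrightarrow> x \<in> \<rat>"
    and nontriv: "\<exists>a\<in>ring_of_integers K. \<sigma> a \<noteq> a"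
begin

abbreviation \<sigma>2 :: "complex \<Rightarrow> complex" where "\<sigma>2 x \<equiv> \<sigma> (\<sigma> x)"
abbreviation \<sigma>3 :: "complex \<Rightarrow> complex" where "\<sigma>3 x \<equiv> \<sigma> (\<sigma>2 x)"
abbreviation \<sigma>4 :: "complex \<Rightarrow> complex" where "\<sigma>4 x \<equiv> \<sigma> (\<sigma>3 x)"

lemma zero_K: "0 \<in> K" using add_K[OF one_K uminus_K[OF one_K]] by simp

lemma diff_K: "x \<in> K \<Longrightarrow> y \<in> K \<Longrightarrow> x - y \<in> K"
  using add_K[of x "- y"] uminus_K[of y] by simp

lemma divide_K: "x \<in> K \<Longrightarrow> y \<in> K \<Longrightarrow> x / y \<in> K"
  using mult_K[of x "inverse y"] inverse_K[of y] by (simp add: divide_inverse)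

lemma rat_K: assumes "x \<in> \<rat>" shows "x \<in> K"
proof -
  have "rat_adjoin 1 \<subseteq> K"
    by (rule rat_adjoin_subset) (auto intro: one_K uminus_K add_K mult_K inverse_K)
  then show ?thesis using rat_adjoin_of_rat[of _ 1] assms by (auto elim!: Rats_cases)
qed

lemma of_int_K [simp]: "of_int n \<in> K" by (rule rat_K) simp
lemma of_nat_K [simp]: "of_nat n \<in> K" by (rule rat_K) simp
lemma numeral_K [simp]: "numeral n \<in> K" by (rule rat_K) simp

lemma power_K: "x \<in> K \<Longrightarrow> x ^ n \<in> K"
  by (induction n) (auto intro: mult_K one_K)

lemma sum_K: "(\<And>i. i \<in> I \<Longrightarrow> f i \<in> K) \<Longrightarrow> sum f I \<in> K"
  by (induction I rule: infinite_finite_induct) (auto intro: add_K zero_K)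

lemma \<sigma>_zero [simp]: "\<sigma> 0 = 0"
  using \<sigma>_add[OF zero_K zero_K] by simp

lemma \<sigma>_uminus: "x \<in> K \<Longrightarrow> \<sigma> (- x) = - \<sigma> x"
  using \<sigma>_add[of x "- x"] uminus_K[of x] by (simp add: add_eq_0_iff)

lemma \<sigma>_diff: "x \<in> K \<Longrightarrow> y \<in> K \<Longrightarrow> \<sigma> (x - y) = \<sigma> x - \<sigma> y"
  using \<sigma>_add[of x "- y"] uminus_K[of y] \<sigma>_uminus[of y] by simp

lemma \<sigma>_of_nat [simp]: "\<sigma> (of_nat n) = of_nat n"
proof (induction n)
  case (Suc n)
  then show ?case using \<sigma>_add[OF one_K of_nat_K[of n]] \<sigma>_one by simp
qed simp

lemma \<sigma>_of_int [simp]: "\<sigma> (of_int n) = of_int n"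
proof (cases n rule: int_cases2)
  case (nonpos m)
  then show ?thesis using \<sigma>_uminus[OF of_nat_K[of m]] by simp
qed simp

lemma \<sigma>_one' [simp]: "\<sigma> 1 = 1" by (rule \<sigma>_one)

lemma \<sigma>_numeral [simp]: "\<sigma> (numeral n) = numeral n"
  using \<sigma>_of_nat[of "numeral n"] by simp

lemma \<sigma>_power: "x \<in> K \<Longrightarrow> \<sigma> (x ^ n) = \<sigma> x ^ n"
  by (induction n) (auto simp: \<sigma>_mult power_K)

lemma \<sigma>_sum: "(\<And>i. i \<in> I \<Longrightarrow> f i \<in> K) \<Longrightarrow> \<sigma> (sum f I) = (\<Sum>i\<in>I. \<sigma> (f i))"
  by (induction I rule: infinite_finite_induct) (auto simp: \<sigma>_add sum_K)

lemma \<sigma>_inj: "x \<in> K \<Longrightarrow> y \<in> K \<Longrightarrow> \<sigma> x = \<sigma> y \<Longrightarrow> x = y"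
  by (metis \<sigma>_5)

lemma \<sigma>_eq_0 [simp]: "x \<in> K \<Longrightarrow> \<sigma> x = 0 \<longleftrightarrow> x = 0"
  using \<sigma>_inj[of x 0] zero_K by auto

lemmas \<sigma>_simps = \<sigma>_add \<sigma>_mult \<sigma>_uminus \<sigma>_diff \<sigma>_power \<sigma>_5
lemmas K_intros = one_K zero_K uminus_K add_K mult_K diff_K \<sigma>_K power_K

abbreviation \<O> :: "complex set" where "\<O> \<equiv> ring_of_integers K"

lemma O_K: "x \<in> \<O> \<Longrightarrow> x \<in> K" by (simp add: ring_of_integers_def)

lemma O_of_int [simp]: "of_int n \<in> \<O>"
  by (simp add: ring_of_integers_def int_imp_algebraic_int)

lemma O_one [simp]: "1 \<in> \<O>" using O_of_int[of 1] by simp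
lemma O_zero [simp]: "0 \<in> \<O>" using O_of_int[of 0] by simp
lemma O_numeral [simp]: "numeral n \<in> \<O>" using O_of_int[of "numeral n"] by simp

lemma O_of_nat [simp]: "of_nat n \<in> \<O>" using O_of_int[of "int n"] by simp

lemma O_add: "x \<in> \<O> \<Longrightarrow> y \<in> \<O> \<Longrightarrow> x + y \<in> \<O>"
  by (simp add: ring_of_integers_def add_K algebraic_int_add_mult)

lemma O_mult: "x \<in> \<O> \<Longrightarrow> y \<in> \<O> \<Longrightarrow> x * y \<in> \<O>"
  by (simp add: ring_of_integers_def mult_K algebraic_int_add_mult)

lemma O_uminus: "x \<in> \<O> \<Longrightarrow> - x \<in> \<O>"
  by (simp add: ring_of_integers_def uminus_K algebraic_int_minus)

lemma O_diff: "x \<in> \<O> \<Longrightarrow> y \<in> \<O> \<Longrightarrow> x - y \<in> \<O>"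
  using O_add[of x "- y"] O_uminus[of y] by simp

lemma O_power: "x \<in> \<O> \<Longrightarrow> x ^ n \<in> \<O>"
  by (induction n) (auto intro: O_mult)

lemma O_sum: "(\<And>i. i \<in> I \<Longrightarrow> f i \<in> \<O>) \<Longrightarrow> sum f I \<in> \<O>"
  by (induction I rule: infinite_finite_induct) (auto intro: O_add)

lemma O_\<sigma>: assumes "x \<in> \<O>" shows "\<sigma> x \<in> \<O>"
proof -
  obtain p :: "int poly" where p: "poly (map_poly of_int p) x = 0" "lead_coeff p = 1"
    using assms unfolding ring_of_integers_def algebraic_int_altdef_ipoly by auto
  have ev: "poly (map_poly of_int p) y = (\<Sum>i\<le>degree p. of_int (coeff p i) * y ^ i)" for y :: complex
    by (simp add: poly_altdef degree_map_poly coeff_map_poly)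
  have "\<sigma> (poly (map_poly of_int p) x) = poly (map_poly of_int p) (\<sigma> x)"
    unfolding ev using O_K[OF assms] by (simp add: \<sigma>_sum \<sigma>_mult \<sigma>_power mult_K power_K)
  then have "poly (map_poly of_int p) (\<sigma> x) = 0" using p by simp
  then show ?thesis using p \<sigma>_K[OF O_K[OF assms]]
    unfolding ring_of_integers_def algebraic_int_altdef_ipoly by auto
qed

lemmas O_intros = O_one O_zero O_of_int O_numeral O_uminus O_add O_mult O_diff O_\<sigma> O_power

lemma O_rat_int: "x \<in> \<O> \<Longrightarrow> x \<in> \<rat> \<Longrightarrow> x \<in> \<int>"
  by (simp add: ring_of_integers_def rational_algebraic_int_is_int)

lemma O_fixed_int: "x \<in> \<O> \<Longrightarrow> \<sigma> x = x \<Longrightarrow> x \<in> \<int>"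
  using O_rat_int fixed_rat O_K by blast

lemma int_adjoin_O: assumes a: "a \<in> \<O>" shows "int_adjoin a \<subseteq> \<O>"
proof
  fix x assume "x \<in> int_adjoin a"
  then show "x \<in> \<O>" by (induction rule: int_adjoin_induct) (use a in \<open>auto intro: O_intros\<close>)
qed

text \<open>Trace and norm as complex numbers, and the cofactor \<open>cof x\<close> with \<open>nm x = x * cof x\<close>.\<close>

definition tr :: "complex \<Rightarrow> complex"
  where "tr x = x + \<sigma> x + \<sigma>2 x + \<sigma>3 x + \<sigma>4 x"

definition nm :: "complex \<Rightarrow> complex"
  where "nm x = x * \<sigma> x * \<sigma>2 x * \<sigma>3 x * \<sigma>4 x"

definition cof :: "complex \<Rightarrow> complex"
  where "cof x = \<sigma> x * \<sigma>2 x * \<sigma>3 x * \<sigma>4 x"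

lemma nm_cof: "nm x = x * cof x" by (simp add: nm_def cof_def mult_ac)

lemma cof_O: "x \<in> \<O> \<Longrightarrow> cof x \<in> \<O>" unfolding cof_def by (intro O_intros)

lemma tr_int: "x \<in> \<O> \<Longrightarrow> tr x \<in> \<int>"
  by (rule O_fixed_int) (auto simp: tr_def \<sigma>_simps O_K K_intros intro!: O_intros)

lemma nm_int: "x \<in> \<O> \<Longrightarrow> nm x \<in> \<int>"
  by (rule O_fixed_int) (auto simp: nm_def \<sigma>_simps O_K K_intros intro!: O_intros)

text \<open>The norm as an integer. The choice of \<open>\<lfloor>Re _\<rfloor>\<close> is immaterial: on \<open>\<O>\<close> the norm is an integer.\<close>

definition N :: "complex \<Rightarrow> int" where "N x = \<lfloor>Re (nm x)\<rfloor>"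

lemma of_int_N: "x \<in> \<O> \<Longrightarrow> of_int (N x) = nm x"
  using nm_int[of x] by (auto simp: N_def elim!: Ints_cases)

lemma nm_mult: "x \<in> K \<Longrightarrow> y \<in> K \<Longrightarrow> nm (x * y) = nm x * nm y"
  by (simp add: nm_def \<sigma>_simps K_intros mult_ac)

lemma N_mult: "x \<in> \<O> \<Longrightarrow> y \<in> \<O> \<Longrightarrow> N (x * y) = N x * N y"
  using of_int_N[of x] of_int_N[of y] of_int_N[of "x*y"] nm_mult[of x y]
  by (metis O_K O_mult of_int_eq_iff of_int_mult)

lemma N_of_int [simp]: "N (of_int n) = n ^ 5"
proof -
  have "nm (of_int n) = of_int (n ^ 5)" by (simp add: nm_def eval_nat_numeral mult.assoc)
  then have "of_int (N (of_int n)) = (of_int (n ^ 5) :: complex)" using of_int_N[OF O_of_int] by simp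
  then show ?thesis by (simp only: of_int_eq_iff)
qed

lemma N_one [simp]: "N 1 = 1" using N_of_int[of 1] by simp

lemma N_power: "x \<in> \<O> \<Longrightarrow> N (x ^ k) = N x ^ k"
  by (induction k) (auto simp: N_mult O_power)

lemma N_\<sigma>: "x \<in> \<O> \<Longrightarrow> N (\<sigma> x) = N x"
  by (simp add: N_def nm_def \<sigma>_5 O_K mult_ac)

lemma N_uminus: "x \<in> \<O> \<Longrightarrow> N (- x) = - N x"
  using N_mult[of "-1" x] N_of_int[of "-1"] O_of_int[of "-1"] by simp

lemma N_eq_0: assumes "x \<in> \<O>" shows "N x = 0 \<longleftrightarrow> x = 0"
proof -
  have "of_int (N x) = (0::complex) \<longleftrightarrow> x = 0"
    unfolding of_int_N[OF assms] nm_def using O_K[OF assms] by (simp add: K_intros)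
  then show ?thesis by simp
qed

end

section \<open>Divisibility in the ring of integers\<close>

lemma quartic_expand:
  fixes y b c d e :: complex
  shows "b * c * d * e + y * - (b * c * d + b * c * e + b * d * e + c * d * e)
    + y\<^sup>2 * (b * c + b * d + b * e + c * d + c * e + d * e) + y ^ 3 * - (b + c + d + e) + y ^ 4
    = (y - b) * (y - c) * (y - d) * (y - e)"
  by (simp add: algebra_simps eval_nat_numeral)

lemma quintic_char_eqs:
  fixes x b c d e :: complex
  defines "t \<equiv> x + b + c + d + e"
    and "u \<equiv> x * - (- (b + c + d + e)) + (b * c + b * d + b * e + c * d + c * e + d * e)"
    and "v \<equiv> x * (b * c + b * d + b * e + c * d + c * e + d * e)
      - (- (b * c * d + b * c * e + b * d * e + c * d * e))"
    and "w \<equiv> b * c * d * e - x * - (b * c * d + b * c * e + b * d * e + c * d * e)"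
  shows "x ^ 5 = t * x ^ 4 - u * x ^ 3 + v * x\<^sup>2 - w * x + x * b * c * d * e"
    and "b * c * d * e = x ^ 4 - t * x ^ 3 + u * x\<^sup>2 - v * x + w"
    and "(x - b) * (x - c) * (x - d) * (x - e) = 5 * x ^ 4 - 4 * t * x ^ 3 + 3 * u * x\<^sup>2 - 2 * v * x + w"
  unfolding t_def u_def v_def w_def by (simp_all add: algebra_simps eval_nat_numeral)

context cyclic_quintic
begin

text \<open>Divisibility in \<open>\<O>\<close>, also used for congruences: \<open>odvd a (x - y)\<close> is \<open>x \<equiv> y\<close> modulo \<open>a\<O>\<close>.\<close>

definition odvd :: "complex \<Rightarrow> complex \<Rightarrow> bool"
  where "odvd a x \<longleftrightarrow> (\<exists>y\<in>\<O>. x = a * y)"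

text \<open>Divisibility by a rational integer.\<close>

abbreviation idvd :: "int \<Rightarrow> complex \<Rightarrow> bool"
  where "idvd p \<equiv> odvd (of_int p)"

lemma odvdI: "y \<in> \<O> \<Longrightarrow> x = a * y \<Longrightarrow> odvd a x" by (auto simp: odvd_def)

lemma odvd_zero [simp]: "odvd a 0" by (rule odvdI[of 0]) auto

lemma odvd_refl [simp]: "odvd a a" by (rule odvdI[of 1]) auto

lemma odvd_add: assumes "odvd a x" "odvd a y" shows "odvd a (x + y)"
proof -
  obtain u v where "u \<in> \<O>" "v \<in> \<O>" "x = a * u" "y = a * v" using assms by (auto simp: odvd_def)
  then show ?thesis by (intro odvdI[of "u + v"]) (auto intro: O_intros simp: algebra_simps)
qed

lemma odvd_uminus: assumes "odvd a x" shows "odvd a (- x)"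
proof -
  obtain u where "u \<in> \<O>" "x = a * u" using assms by (auto simp: odvd_def)
  then show ?thesis by (intro odvdI[of "- u"]) (auto intro: O_intros)
qed

lemma odvd_diff: "odvd a x \<Longrightarrow> odvd a y \<Longrightarrow> odvd a (x - y)"
  using odvd_add[of a x "- y"] odvd_uminus by simp

lemma odvd_mult: assumes "odvd a x" "y \<in> \<O>" shows "odvd a (x * y)" "odvd a (y * x)"
proof -
  obtain u where "u \<in> \<O>" "x = a * u" using assms by (auto simp: odvd_def)
  then show "odvd a (x * y)" using assms by (intro odvdI[of "u * y"]) (auto intro: O_intros)
  then show "odvd a (y * x)" by (simp add: mult.commute)
qed

lemma odvd_trans: assumes "odvd a b" "odvd b c" shows "odvd a c"
  using assms odvd_mult(1)[of a b] by (auto simp: odvd_def[of b])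

lemma odvd_sum: "(\<And>i. i \<in> I \<Longrightarrow> odvd a (f i)) \<Longrightarrow> odvd a (sum f I)"
  by (induction I rule: infinite_finite_induct) (auto intro: odvd_add)

lemma odvd_\<sigma>: assumes "odvd a x" "a \<in> K" shows "odvd (\<sigma> a) (\<sigma> x)"
proof -
  obtain u where "u \<in> \<O>" "x = a * u" using assms by (auto simp: odvd_def)
  then show ?thesis using assms
    by (intro odvdI[of "\<sigma> u"]) (auto intro: O_intros simp: \<sigma>_mult O_K)
qed

lemma odvd_int_\<sigma>: "idvd p x \<Longrightarrow> idvd p (\<sigma> x)"
  using odvd_\<sigma>[of "of_int p" x] by simp

lemma odvd_of_int_iff:
  assumes "p \<noteq> 0" shows "idvd p (of_int n) \<longleftrightarrow> p dvd n"
proof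
  assume "idvd p (of_int n)"
  then obtain y where y: "y \<in> \<O>" "of_int n = of_int p * y" by (auto simp: odvd_def)
  then have "y = of_int n / of_int p" using assms by (simp add: field_simps)
  then have "y \<in> \<rat>" by simp
  then obtain m where "y = of_int m" using O_rat_int y by (auto elim: Ints_cases)
  then have "of_int n = (of_int (p * m) :: complex)" using y by simp
  then show "p dvd n" by (metis dvd_triv_left of_int_eq_iff)
next
  assume "p dvd n"
  then obtain m where "n = p * m" ..
  then show "idvd p (of_int n)" by (intro odvdI[of "of_int m"]) auto
qed

lemma N_dvd: assumes "x \<in> \<O>" "odvd x y" shows "N x dvd N y"
  using assms N_mult[of x] by (auto simp: odvd_def)

lemma odvd_cong_mult:
  assumes "odvd a (x - y)" "odvd a (x' - y')" "x' \<in> \<O>" "y \<in> \<O>"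
  shows "odvd a (x * x' - y * y')"
proof -
  have "x * x' - y * y' = (x - y) * x' + y * (x' - y')" by (simp add: algebra_simps)
  then show ?thesis using odvd_add[OF odvd_mult(1)[OF assms(1,3)] odvd_mult(2)[OF assms(2,4)]] by simp
qed

lemma odvd_cong_power:
  assumes "odvd a (x - y)" "x \<in> \<O>" "y \<in> \<O>" shows "odvd a (x ^ n - y ^ n)"
  by (induction n) (use assms in \<open>auto intro!: odvd_cong_mult O_power\<close>)

lemma odvd_int_nm_cong:
  assumes "idvd p (x - y)" "x \<in> \<O>" "y \<in> \<O>"
  shows "idvd p (nm x - nm y)"
proof -
  have s: "idvd p (\<sigma> u - \<sigma> v)" if "idvd p (u - v)" "u \<in> \<O>" "v \<in> \<O>" for u v
    using odvd_int_\<sigma>[OF that(1)] that by (simp add: \<sigma>_diff O_K)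
  show ?thesis unfolding nm_def by (intro odvd_cong_mult s assms O_intros)
qed

lemma N_cong:
  assumes "p \<noteq> 0" "idvd p (x - y)" "x \<in> \<O>" "y \<in> \<O>"
  shows "p dvd N x - N y"
  using odvd_int_nm_cong[OF assms(2-4)] odvd_of_int_iff[OF assms(1), of "N x - N y"]
  by (simp add: of_int_N assms)

text \<open>An element that is invertible modulo \<open>p\<close> has norm prime to \<open>p\<close>. It suffices that \<open>x * w\<close> is
  congruent to an integer \<open>m\<close> prime to \<open>p\<close>.\<close>

lemma not_dvd_N:
  assumes p: "prime p" and "x \<in> \<O>" "w \<in> \<O>"
    and eq: "idvd p (x * w - of_int m)" "\<not> p dvd m"
  shows "\<not> p dvd N x"
proof
  assume "p dvd N x"
  then have "p dvd N (x * w)" using assms by (simp add: N_mult)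
  moreover have "p dvd N (x * w) - m ^ 5"
    using N_cong[OF _ eq(1)] assms by (auto intro: O_intros)
  ultimately have "p dvd m ^ 5" by (metis dvd_diff_commute dvd_diffD1 dvd_diff diff_diff_eq2 add_diff_cancel_left')
  then show False using p eq(2) prime_dvd_power by blast
qed

lemma unit_mod:
  assumes p: "prime p" and x: "x \<in> \<O>" and n: "\<not> p dvd N x"
  obtains w where "w \<in> \<O>" "idvd p (x * w - 1)"
proof -
  have "coprime (N x) p" using p n by (metis coprime_commute prime_imp_coprime)
  then obtain u v where uv: "u * N x + v * p = 1"
    by (metis bezout_int coprime_imp_gcd_eq_1)
  have "x * (cof x * of_int u) - 1 = of_int (u * N x) - of_int 1"
    using of_int_N[OF x] by (simp add: nm_cof)
  also have "\<dots> = of_int p * of_int (- v)"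
  proof -
    have "u * N x - 1 = p * - v" using uv by (simp add: algebra_simps)
    then show ?thesis by (simp only: flip: of_int_mult of_int_diff)
  qed
  finally show ?thesis
    by (intro that[of "cof x * of_int u"] odvdI[of "of_int (-v)"]) (auto intro: O_intros cof_O x)
qed

lemma coprime_odvd:
  assumes c: "coprime m p" and x: "x \<in> \<O>" and d: "idvd p (of_int m * x)"
  shows "idvd p x"
proof -
  obtain u v where "u * m + v * p = 1"
    using c by (metis bezout_int coprime_imp_gcd_eq_1)
  then have "x = of_int (u * m + v * p) * x" by simp
  also have "\<dots> = of_int u * (of_int m * x) + of_int p * (of_int v * x)" by (simp add: algebra_simps)
  finally show ?thesis
    using odvd_add[OF odvd_mult(2)[OF d O_of_int[of u]] odvdI[of "of_int v * x"]] x
    by (simp add: O_mult)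
qed

text \<open>Nilpotency modulo \<open>p\<close>.\<close>

definition nilp :: "int \<Rightarrow> complex \<Rightarrow> bool"
  where "nilp p x \<longleftrightarrow> (\<exists>k. idvd p (x ^ k))"

lemma nilp_add: assumes "nilp p x" "nilp p y" "x \<in> \<O>" "y \<in> \<O>" shows "nilp p (x + y)"
proof -
  obtain k l where kl: "idvd p (x ^ k)" "idvd p (y ^ l)"
    using assms by (auto simp: nilp_def)
  have "idvd p ((x + y) ^ (k + l))"
    unfolding binomial_ring
  proof (rule odvd_sum)
    fix i assume i: "i \<in> {..k + l}"
    show "idvd p (of_nat (k + l choose i) * x ^ i * y ^ (k + l - i))"
    proof (cases "i \<ge> k")
      case True
      then have "x ^ i = x ^ k * x ^ (i - k)" by (simp flip: power_add)
      then have "idvd p (x ^ i)" using odvd_mult(1)[OF kl(1)] assms by (simp add: O_power)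
      then show ?thesis using assms by (intro odvd_mult O_intros) auto
    next
      case False
      then have "y ^ (k + l - i) = y ^ l * y ^ (k - i)"
        by (simp add: add.commute flip: power_add)
      then have "idvd p (y ^ (k + l - i))" using odvd_mult(1)[OF kl(2)] assms by (simp add: O_power)
      then show ?thesis using assms by (intro odvd_mult O_intros) auto
    qed
  qed
  then show ?thesis by (auto simp: nilp_def)
qed

lemma nilp_mult: assumes "nilp p x" "y \<in> \<O>" shows "nilp p (x * y)" "nilp p (y * x)"
proof -
  obtain k where "idvd p (x ^ k)" using assms by (auto simp: nilp_def)
  from odvd_mult(1)[OF this O_power[OF assms(2), of k]] show "nilp p (x * y)"
    unfolding nilp_def by (intro exI[of _ k]) (simp add: power_mult_distrib)
  then show "nilp p (y * x)" by (simp add: mult.commute)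
qed

lemma nilp_\<sigma>: assumes "nilp p x" "x \<in> \<O>" shows "nilp p (\<sigma> x)"
proof -
  obtain k where "idvd p (x ^ k)" using assms by (auto simp: nilp_def)
  from odvd_int_\<sigma>[OF this] show ?thesis
    unfolding nilp_def using assms by (intro exI[of _ k]) (simp add: \<sigma>_power O_K)
qed

lemma odvd_nilp: "idvd p x \<Longrightarrow> nilp p x"
  by (auto simp: nilp_def intro: exI[of _ 1])

lemma nilp_dvd_N: assumes p: "prime p" and "nilp p x" "x \<in> \<O>" shows "p dvd N x"
proof -
  obtain k where "idvd p (x ^ k)" using assms by (auto simp: nilp_def)
  from N_dvd[OF O_of_int this] have "p ^ 5 dvd N x ^ k" using assms by (simp add: N_power)
  then have "p dvd N x ^ k" by (meson dvd_trans dvd_power zero_less_numeral)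
  then show ?thesis using p prime_dvd_power by blast
qed

lemma nilp_tr: assumes p: "prime p" and "nilp p x" "x \<in> \<O>" shows "idvd p (tr x)"
proof -
  have "nilp p (tr x)" unfolding tr_def by (intro nilp_add nilp_\<sigma> assms O_intros)
  moreover obtain n where n: "tr x = of_int n" using tr_int[OF assms(3)] by (auto elim: Ints_cases)
  ultimately have "p dvd N (of_int n)" using nilp_dvd_N[OF p] by (metis O_of_int)
  then have "p dvd n" using p prime_dvd_power by auto
  then show ?thesis using n odvd_of_int_iff[of p n] p by auto
qed

section \<open>The different of an element and its dual basis\<close>

text \<open>\<open>D a\<close> is the different of \<open>a\<close>, the value at \<open>a\<close> of the derivative of its characteristic polynomial. The
  numbers \<open>cof a\<close>, \<open>c1 a\<close>, \<open>c2 a\<close>, \<open>c3 a\<close> and 1 are the coefficients of the product of the \<open>X - \<sigma>\<^sup>ia\<close> with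
  \<open>i = 1, \<dots>, 4\<close>.\<close>

definition D :: "complex \<Rightarrow> complex"
  where "D a = (a - \<sigma> a) * (a - \<sigma>2 a) * (a - \<sigma>3 a) * (a - \<sigma>4 a)"

definition c1 :: "complex \<Rightarrow> complex"
  where "c1 a = - (\<sigma> a * \<sigma>2 a * \<sigma>3 a + \<sigma> a * \<sigma>2 a * \<sigma>4 a
    + \<sigma> a * \<sigma>3 a * \<sigma>4 a + \<sigma>2 a * \<sigma>3 a * \<sigma>4 a)"

definition c2 :: "complex \<Rightarrow> complex"
  where "c2 a = \<sigma> a * \<sigma>2 a + \<sigma> a * \<sigma>3 a + \<sigma> a * \<sigma>4 a
    + \<sigma>2 a * \<sigma>3 a + \<sigma>2 a * \<sigma>4 a + \<sigma>3 a * \<sigma>4 a"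

definition c3 :: "complex \<Rightarrow> complex"
  where "c3 a = - (\<sigma> a + \<sigma>2 a + \<sigma>3 a + \<sigma>4 a)"

lemma c_O: "a \<in> \<O> \<Longrightarrow> c1 a \<in> \<O>" "a \<in> \<O> \<Longrightarrow> c2 a \<in> \<O>" "a \<in> \<O> \<Longrightarrow> c3 a \<in> \<O>"
  unfolding c1_def c2_def c3_def by (intro O_intros; assumption)+

lemma c_K: "a \<in> K \<Longrightarrow> c1 a \<in> K" "a \<in> K \<Longrightarrow> c2 a \<in> K" "a \<in> K \<Longrightarrow> c3 a \<in> K" "a \<in> K \<Longrightarrow> cof a \<in> K"
  unfolding c1_def c2_def c3_def cof_def by (intro K_intros; assumption)+

lemma D_O: "a \<in> \<O> \<Longrightarrow> D a \<in> \<O>"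
  unfolding D_def by (intro O_intros; assumption)

lemma dual_poly:
  assumes a: "a \<in> K"
  shows "cof a + y * c1 a + y ^ 2 * c2 a + y ^ 3 * c3 a + y ^ 4
    = (y - \<sigma> a) * (y - \<sigma>2 a) * (y - \<sigma>3 a) * (y - \<sigma>4 a)"
  unfolding cof_def c1_def c2_def c3_def by (rule quartic_expand)

text \<open>Multiplying the product of the \<open>y - \<sigma>\<^sup>ia\<close>, \<open>i = 1, \<dots>, 4\<close>, by \<open>x\<close>, adding up the conjugates of its coefficients
  and putting \<open>y = a\<close> leaves only one term, since in the others a factor vanishes.\<close>

lemma dual_basis:
  assumes a: "a \<in> K" and x: "x \<in> K"
  shows "x * D a = tr (x * cof a) + a * tr (x * c1 a) + a ^ 2 * tr (x * c2 a)
    + a ^ 3 * tr (x * c3 a) + a ^ 4 * tr x"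
proof -
  have s: "\<sigma> (cof u) = cof (\<sigma> u)" "\<sigma> (c1 u) = c1 (\<sigma> u)" "\<sigma> (c2 u) = c2 (\<sigma> u)" "\<sigma> (c3 u) = c3 (\<sigma> u)"
    if "u \<in> K" for u
    using that by (simp_all add: cof_def c1_def c2_def c3_def \<sigma>_simps K_intros)
  define q where "q b = cof b + a * c1 b + a ^ 2 * c2 b + a ^ 3 * c3 b + a ^ 4" for b
  have "tr (x * cof a) + a * tr (x * c1 a) + a ^ 2 * tr (x * c2 a) + a ^ 3 * tr (x * c3 a) + a ^ 4 * tr x
    = x * q a + \<sigma> x * q (\<sigma> a) + \<sigma>2 x * q (\<sigma>2 a) + \<sigma>3 x * q (\<sigma>3 a)
      + \<sigma>4 x * q (\<sigma>4 a)"
    unfolding tr_def q_def using a x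
    by (simp add: \<sigma>_mult s c_K \<sigma>_K algebra_simps)
  moreover have "q a = D a" unfolding q_def dual_poly[OF a] D_def ..
  moreover have "q b = 0" if "b \<in> {\<sigma> a, \<sigma>2 a, \<sigma>3 a, \<sigma>4 a}" for b
  proof -
    have "b \<in> K" using that a by (auto intro: K_intros)
    then show ?thesis unfolding q_def using that a by (subst dual_poly) (auto simp: \<sigma>_5)
  qed
  ultimately show ?thesis by simp
qed

text \<open>The elementary symmetric functions of degree 2, 3 and 4 of the conjugates of \<open>x\<close>.\<close>

definition s2 :: "complex \<Rightarrow> complex" where "s2 x = x * - c3 x + c2 x"
definition s3 :: "complex \<Rightarrow> complex" where "s3 x = x * c2 x - c1 x"
definition s4 :: "complex \<Rightarrow> complex" where "s4 x = cof x - x * c1 x"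

lemma s_int: assumes "x \<in> \<O>" shows "s2 x \<in> \<int>" "s3 x \<in> \<int>" "s4 x \<in> \<int>"
proof -
  have "\<sigma> (s2 x) = s2 x" "\<sigma> (s3 x) = s3 x" "\<sigma> (s4 x) = s4 x" using O_K[OF assms]
    by (simp_all add: s2_def s3_def s4_def cof_def c1_def c2_def c3_def \<sigma>_simps K_intros algebra_simps)
  moreover have "s2 x \<in> \<O>" "s3 x \<in> \<O>" "s4 x \<in> \<O>"
    unfolding s2_def s3_def s4_def using assms by (intro O_intros c_O cof_O; assumption)+
  ultimately show "s2 x \<in> \<int>" "s3 x \<in> \<int>" "s4 x \<in> \<int>" using O_fixed_int by blast+
qed

lemma char_eq: "x ^ 5 = tr x * x ^ 4 - s2 x * x ^ 3 + s3 x * x ^ 2 - s4 x * x + nm x"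
  unfolding tr_def s2_def s3_def s4_def nm_def cof_def c1_def c2_def c3_def by (rule quintic_char_eqs(1))

lemma cof_eq: "cof x = x ^ 4 - tr x * x ^ 3 + s2 x * x ^ 2 - s3 x * x + s4 x"
  unfolding tr_def s2_def s3_def s4_def nm_def cof_def c1_def c2_def c3_def by (rule quintic_char_eqs(2))

lemma D_eq: "D x = 5 * x ^ 4 - 4 * tr x * x ^ 3 + 3 * s2 x * x ^ 2 - 2 * s3 x * x + s4 x"
  unfolding D_def tr_def s2_def s3_def s4_def nm_def cof_def c1_def c2_def c3_def by (rule quintic_char_eqs(3))

lemma int_adjoin_Ints: "x \<in> \<int> \<Longrightarrow> x \<in> int_adjoin a"
  by (auto elim!: Ints_cases intro: int_adjoin_of_int)

lemma int_adjoin_numeral: "numeral n \<in> int_adjoin a"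
  using int_adjoin_of_int[of "numeral n"] by simp

lemmas int_adjoin_intros = int_adjoin_add int_adjoin_diff int_adjoin_mult int_adjoin_power
  int_adjoin_numeral int_adjoin_Ints

lemma cof_int_adjoin: assumes "x \<in> \<O>" "x \<in> int_adjoin a" shows "cof x \<in> int_adjoin a"
  unfolding cof_eq by (intro int_adjoin_intros s_int tr_int assms)

lemma D_int_adjoin: assumes "a \<in> \<O>" shows "D a \<in> int_adjoin a"
  unfolding D_eq by (intro int_adjoin_intros s_int tr_int assms int_adjoin_self)

text \<open>The quotient \<open>\<O>/\<int>[a]\<close> is annihilated by the norm of the different.\<close>

lemma ND_int_adjoin:
  assumes a: "a \<in> \<O>" and x: "x \<in> \<O>"
  shows "of_int (N (D a)) * x \<in> int_adjoin a"
proof -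
  have "of_int (N (D a)) * x = cof (D a) * (x * D a)"
    using of_int_N[OF D_O[OF a]] by (simp add: nm_cof mult_ac)
  also have "\<dots> \<in> int_adjoin a"
    unfolding dual_basis[OF O_K[OF a] O_K[OF x]]
    by (intro int_adjoin_intros cof_int_adjoin D_int_adjoin D_O tr_int O_mult c_O cof_O a x int_adjoin_self)
  finally show ?thesis .
qed

lemma fixed_powers:
  assumes "a \<in> K" "\<sigma>2 a = a \<or> \<sigma>3 a = a \<or> \<sigma>4 a = a"
  shows "\<sigma> a = a"
  using assms \<sigma>_5[OF assms(1)] by metis

lemma D_nz: assumes "a \<in> K" "\<sigma> a \<noteq> a" shows "D a \<noteq> 0"
  using fixed_powers[OF assms(1)] assms(2) unfolding D_def by (auto simp: eq_commute[of a])

lemma int_adjoin_basis: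
  assumes a: "a \<in> \<O>" and x: "x \<in> int_adjoin a"
  obtains c :: "nat \<Rightarrow> int" where "x = (\<Sum>i<5. of_int (c i) * a ^ i)"
proof -
  define S where "S = {x. \<exists>c0 c1 c2 c3 c4 :: int. x = of_int c0 + of_int c1 * a + of_int c2 * a ^ 2
    + of_int c3 * a ^ 3 + of_int c4 * a ^ 4}"
  have Sadd: "u + v \<in> S" if uv: "u \<in> S" "v \<in> S" for u v
  proof -
    obtain c0 c1 c2 c3 c4 :: int where u: "u = of_int c0 + of_int c1 * a + of_int c2 * a ^ 2
      + of_int c3 * a ^ 3 + of_int c4 * a ^ 4" using uv(1) unfolding S_def by auto
    obtain d0 d1 d2 d3 d4 :: int where v: "v = of_int d0 + of_int d1 * a + of_int d2 * a ^ 2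
      + of_int d3 * a ^ 3 + of_int d4 * a ^ 4" using uv(2) unfolding S_def by auto
    have "u + v = of_int (c0 + d0) + of_int (c1 + d1) * a + of_int (c2 + d2) * a ^ 2
      + of_int (c3 + d3) * a ^ 3 + of_int (c4 + d4) * a ^ 4"
      unfolding u v by (simp add: algebra_simps)
    then show ?thesis unfolding S_def by (intro CollectI exI)
  qed
  have Sint: "of_int n * u \<in> S" if u: "u \<in> S" for n u
  proof -
    obtain c0 c1 c2 c3 c4 :: int where u: "u = of_int c0 + of_int c1 * a + of_int c2 * a ^ 2
      + of_int c3 * a ^ 3 + of_int c4 * a ^ 4" using u unfolding S_def by auto
    have "of_int n * u = of_int (n * c0) + of_int (n * c1) * a + of_int (n * c2) * a ^ 2
      + of_int (n * c3) * a ^ 3 + of_int (n * c4) * a ^ 4"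
      unfolding u by (simp add: algebra_simps)
    then show ?thesis unfolding S_def by (intro CollectI exI)
  qed
  have Sa: "a * u \<in> S" if u: "u \<in> S" for u
  proof -
    obtain c0 c1 c2 c3 c4 :: int where u: "u = of_int c0 + of_int c1 * a + of_int c2 * a ^ 2
      + of_int c3 * a ^ 3 + of_int c4 * a ^ 4" using u unfolding S_def by auto
    obtain t1 t2 t3 t4 t5 where t: "tr a = of_int t1" "s2 a = of_int t2" "s3 a = of_int t3"
      "s4 a = of_int t4" "nm a = of_int t5"
      using tr_int[OF a] s_int[OF a] nm_int[OF a] by (auto elim!: Ints_cases)
    have a5: "a ^ 5 = of_int t1 * a ^ 4 - of_int t2 * a ^ 3 + of_int t3 * a ^ 2 - of_int t4 * a + of_int t5"
      using char_eq[of a] t by simp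
    have "a * u = of_int c0 * a + of_int c1 * a ^ 2 + of_int c2 * a ^ 3 + of_int c3 * a ^ 4 + of_int c4 * a ^ 5"
      unfolding u by (simp add: algebra_simps eval_nat_numeral)
    also have "\<dots> = of_int (c4 * t5) + of_int (c0 - c4 * t4) * a + of_int (c1 + c4 * t3) * a ^ 2
      + of_int (c2 - c4 * t2) * a ^ 3 + of_int (c3 + c4 * t1) * a ^ 4"
      unfolding a5 by (simp add: algebra_simps)
    finally show ?thesis unfolding S_def by (intro CollectI exI)
  qed
  have S1: "1 \<in> S"
  proof -
    have "1 = of_int 1 + of_int 0 * a + of_int 0 * a ^ 2 + of_int 0 * a ^ 3 + of_int 0 * a ^ 4" by simp
    then show ?thesis unfolding S_def by (intro CollectI exI)
  qed
  have Smult: "u * v \<in> S" if uv: "u \<in> S" "v \<in> S" for u v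
  proof -
    obtain c0 c1 c2 c3 c4 :: int where u: "u = of_int c0 + of_int c1 * a + of_int c2 * a ^ 2
      + of_int c3 * a ^ 3 + of_int c4 * a ^ 4" using uv(1) unfolding S_def by auto
    have "u * v = of_int c0 * v + of_int c1 * (a * v) + of_int c2 * (a * (a * v))
      + of_int c3 * (a * (a * (a * v))) + of_int c4 * (a * (a * (a * (a * v))))"
      unfolding u by (simp add: algebra_simps eval_nat_numeral)
    then show ?thesis using Sadd Sint Sa uv by simp
  qed
  have "x \<in> S" using x
  proof (induction rule: int_adjoin_induct)
    case (uminus x)
    then show ?case using Sint[of x "-1"] by simp
  qed (use S1 Sa[OF S1] Sadd Smult in auto)
  then obtain d0 d1 d2 d3 d4 :: int where "x = of_int d0 + of_int d1 * a + of_int d2 * a ^ 2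
      + of_int d3 * a ^ 3 + of_int d4 * a ^ 4" unfolding S_def by auto
  then have "x = (\<Sum>i<5. of_int ([d0,d1,d2,d3,d4] ! i) * a ^ i)"
    by (simp add: eval_nat_numeral)
  then show ?thesis by (rule that)
qed

text \<open>Two elements of \<open>\<O>\<close> are congruent modulo \<open>m\<close> as soon as the coordinates of their \<open>d\<close>-fold multiples, with \<open>d\<close>
  the norm of the different of a fixed generator \<open>a\<close>, agree modulo \<open>d * m\<close>. So \<open>\<O>/m\<O>\<close> is finite; it is
  represented here by a finite set of representatives.\<close>

lemma finite_quotient:
  assumes m: "m \<noteq> 0"
  obtains F where "finite F" "F \<subseteq> \<O>" "\<And>x. x \<in> \<O> \<Longrightarrow> \<exists>y\<in>F. odvd (of_int m) (x - y)"
proof -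
  obtain a where a: "a \<in> \<O>" "\<sigma> a \<noteq> a" using nontriv by blast
  define d where "d = N (D a)"
  have d: "d \<noteq> 0" unfolding d_def using N_eq_0[OF D_O] D_nz a O_K by blast
  define M where "M = d * m"
  have M: "M \<noteq> 0" using d m by (simp add: M_def)
  have "\<exists>c :: nat \<Rightarrow> int. of_int d * x = (\<Sum>i<5. of_int (c i) * a ^ i)" if "x \<in> \<O>" for x
    using int_adjoin_basis[OF a(1) ND_int_adjoin[OF a(1) that]] unfolding d_def by metis
  then have "\<forall>x. \<exists>c :: nat \<Rightarrow> int. x \<in> \<O> \<longrightarrow> of_int d * x = (\<Sum>i<5. of_int (c i) * a ^ i)" by blast
  then obtain c :: "complex \<Rightarrow> nat \<Rightarrow> int"
    where c: "\<And>x. x \<in> \<O> \<Longrightarrow> of_int d * x = (\<Sum>i<5. of_int (c x i) * a ^ i)" by metis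
  define g where "g x = map (\<lambda>i. c x i mod M) [0..<5]" for x
  have "g ` \<O> \<subseteq> {xs. set xs \<subseteq> {-\<bar>M\<bar>..\<bar>M\<bar>} \<and> length xs = 5}"
  proof
    fix t assume "t \<in> g ` \<O>"
    moreover have "n mod M \<in> {-\<bar>M\<bar>..\<bar>M\<bar>}" for n
      using M pos_mod_bound[of M n] pos_mod_sign[of M n] neg_mod_bound[of M n] neg_mod_sign[of M n]
      by (cases "M > 0") (fastforce simp: abs_if)+
    ultimately show "t \<in> {xs. set xs \<subseteq> {-\<bar>M\<bar>..\<bar>M\<bar>} \<and> length xs = 5}" unfolding g_def by auto
  qed
  then have fin: "finite (g ` \<O>)"
    by (rule finite_subset) (rule finite_lists_length_eq, simp)
  define r where "r t = (SOME x. x \<in> \<O> \<and> g x = t)" for t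
  have r: "r (g x) \<in> \<O> \<and> g (r (g x)) = g x" if "x \<in> \<O>" for x
    unfolding r_def by (rule someI[of _ x]) (use that in auto)
  have key: "odvd (of_int m) (x - y)" if xy: "x \<in> \<O>" "y \<in> \<O>" "g x = g y" for x y
  proof -
    have "\<exists>k. c x i - c y i = M * k" if "i < 5" for i
    proof -
      have "g x ! i = g y ! i" using xy by simp
      then have "c x i mod M = c y i mod M" using that by (simp add: g_def)
      then show ?thesis by (metis dvdE mod_eq_dvd_iff)
    qed
    then obtain k where k: "\<And>i. i < 5 \<Longrightarrow> c x i - c y i = M * k i" by metis
    have "of_int d * (x - y) = (\<Sum>i<5. of_int (c x i - c y i) * a ^ i)"
      using c[OF xy(1)] c[OF xy(2)] by (simp add: right_diff_distrib left_diff_distrib sum_subtractf)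
    also have "\<dots> = (\<Sum>i<5. of_int d * (of_int m * (of_int (k i) * a ^ i)))"
      by (intro sum.cong refl) (simp add: k M_def mult_ac)
    also have "\<dots> = of_int d * (of_int m * (\<Sum>i<5. of_int (k i) * a ^ i))"
      by (simp add: sum_distrib_left)
    finally have "x - y = of_int m * (\<Sum>i<5. of_int (k i) * a ^ i)" using d by simp
    then show ?thesis by (rule odvdI[rotated]) (intro O_sum O_intros a)
  qed
  show ?thesis
  proof
    show "finite (r ` (g ` \<O>))" using fin by simp
    show "r ` (g ` \<O>) \<subseteq> \<O>" using r by auto
    fix x assume "x \<in> \<O>"
    then show "\<exists>y\<in>r ` g ` \<O>. odvd (of_int m) (x - y)" using key[of x "r (g x)"] r[of x] by auto
  qed
qed

end

section \<open>Monogenic cyclic quintic fields are unramified outside 11\<close>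

text \<open>The polynomials \<open>1 + X + X\<^sup>2 + X\<^sup>3 + X\<^sup>4\<close> and \<open>(1 + X)\<^bsup>10\<^esup> - 1\<close> generate an ideal of \<open>\<int>[X]\<close>
  containing 11: modulo the first, the second is 11 times a unit.\<close>

lemma eleven_bezout:
  fixes e :: complex
  shows "(11 + 69 * e + 280 * e ^ 2 + 650 * e ^ 3 + 945 * e ^ 4 + 897 * e ^ 5 + 558 * e ^ 6
      + 220 * e ^ 7 + 50 * e ^ 8 + 5 * e ^ 9) * (1 + e + e * e + e * e * e + e * e * e * e)
    - (8 + 5 * e ^ 2 + 5 * e ^ 3) * (((1 + e) * (1 + e) * (1 + e) * (1 + e) * (1 + e)) ^ 2 - 1) = 11"
  by (simp add: algebra_simps eval_nat_numeral)

context cyclic_quintic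
begin

lemma int_adjoin_hom_dvd:
  assumes a: "a \<in> \<O>" and x: "x \<in> int_adjoin a"
    and \<tau>: "\<And>x. x \<in> \<O> \<Longrightarrow> \<tau> x \<in> \<O>" "\<tau> 1 = 1" "\<And>x. x \<in> \<O> \<Longrightarrow> \<tau> (- x) = - \<tau> x"
      "\<And>x y. x \<in> \<O> \<Longrightarrow> y \<in> \<O> \<Longrightarrow> \<tau> (x + y) = \<tau> x + \<tau> y"
      "\<And>x y. x \<in> \<O> \<Longrightarrow> y \<in> \<O> \<Longrightarrow> \<tau> (x * y) = \<tau> x * \<tau> y"
  shows "odvd (\<tau> a - a) (\<tau> x - x)"
  using x
proof (induction rule: int_adjoin_induct)
  case (uminus x)
  then have "\<tau> (- x) - - x = - (\<tau> x - x)" using \<tau> int_adjoin_O[OF a] by auto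
  then show ?case using odvd_uminus uminus by metis
next
  case (add x y)
  then have xy: "x \<in> \<O>" "y \<in> \<O>" using int_adjoin_O[OF a] by auto
  have "\<tau> (x + y) - (x + y) = (\<tau> x - x) + (\<tau> y - y)" using \<tau>(4)[OF xy] by simp
  then show ?case using odvd_add add by metis
next
  case (mult x y)
  then have xy: "x \<in> \<O>" "y \<in> \<O>" using int_adjoin_O[OF a] by auto
  have "\<tau> (x * y) - x * y = \<tau> x * \<tau> y - x * y" using \<tau>(5)[OF xy] by simp
  then show ?case using odvd_cong_mult[OF mult(3,4)] \<tau>(1) xy by simp
qed (use \<tau> in auto)

lemma odvd_mult_mono: assumes "odvd a x" "odvd b y" shows "odvd (a * b) (x * y)"
proof -
  obtain u v where "u \<in> \<O>" "v \<in> \<O>" "x = a * u" "y = b * v" using assms by (auto simp: odvd_def)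
  then show ?thesis by (intro odvdI[of "u * v"]) (auto intro: O_intros)
qed

lemma odvd_uminus_left: assumes "odvd a x" shows "odvd (- a) x"
proof -
  obtain u where "u \<in> \<O>" "x = a * u" using assms by (auto simp: odvd_def)
  then show ?thesis by (intro odvdI[of "- u"]) (auto intro: O_intros)
qed

lemma O_unit_N: assumes "x \<in> \<O>" "y \<in> \<O>" "x * y = 1" shows "N x ^ 2 = 1"
proof -
  have "N x * N y = 1" using assms N_mult by (metis N_one)
  then have "N x = 1 \<or> N x = - 1" using zmult_eq_1_iff by blast
  then show ?thesis by auto
qed

text \<open>In the proof, \<open>d\<close> and \<open>d2\<close> are \<open>\<sigma>a - a\<close> and \<open>\<sigma>\<^sup>2a - a\<close>; they divide all \<open>\<sigma>x - x\<close> and \<open>\<sigma>\<^sup>2x - x\<close>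
  respectively, because \<open>\<O> = \<int>[a]\<close>. Hence \<open>e = \<sigma>d/d\<close> and \<open>1 + e = d2/d\<close> are units.\<close>

proposition D_dvd_11_power:
  assumes mono: "\<O> = int_adjoin a" and na: "\<sigma> a \<noteq> a"
  shows "odvd (D a) (11 ^ 4)"
proof -
  have a: "a \<in> \<O>" using mono int_adjoin_self by auto
  note aK = O_K[OF a]
  define d where "d = \<sigma> a - a"
  define d2 where "d2 = \<sigma>2 a - a"
  have dO: "d \<in> \<O>" "d2 \<in> \<O>" unfolding d_def d2_def by (intro O_intros a)+
  have d0: "d \<noteq> 0" using na by (simp add: d_def)
  have dvd1: "odvd d (\<sigma> x - x)" if "x \<in> \<O>" for x
    unfolding d_def by (rule int_adjoin_hom_dvd[OF a])
      (use that mono in \<open>auto simp: O_K \<sigma>_simps intro: O_intros\<close>)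
  have dvd2: "odvd d2 (\<sigma>2 x - x)" if "x \<in> \<O>" for x
    unfolding d2_def by (rule int_adjoin_hom_dvd[OF a, where \<tau> = "\<lambda>x. \<sigma>2 x"])
      (use that mono in \<open>auto simp: O_K \<sigma>_simps K_intros intro: O_intros\<close>)
  have sd: "\<sigma> d = \<sigma>2 a - \<sigma> a" using aK by (simp add: d_def \<sigma>_simps K_intros)
  have "odvd d (\<sigma> d)" unfolding sd by (intro dvd1 O_intros a)
  then obtain e where e: "e \<in> \<O>" "\<sigma> d = d * e" by (auto simp: odvd_def)
  note eK = O_K[OF e(1)] and dK = O_K[OF dO(1)]
  have "d2 = d + \<sigma> d" unfolding sd by (simp add: d_def d2_def)
  then have d2e: "d2 = d * (1 + e)" using e by (simp add: algebra_simps)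
  have "N d * N e = N d" using N_mult[OF dO(1) e(1)] N_\<sigma>[OF dO(1)] e(2) by simp
  then have Ne: "N e = 1" using N_eq_0[OF dO(1)] d0 by simp
  \<comment> \<open>\<open>\<sigma>\<close> is the cube of \<open>\<sigma>\<^sup>2\<close>, so \<open>\<sigma>a - a\<close> is a sum of three differences \<open>\<sigma>\<^sup>2x - x\<close>.\<close>
  have "odvd d2 d"
  proof -
    have "d = (\<sigma> (\<sigma> (\<sigma>4 a)) - \<sigma>4 a) + (\<sigma>4 a - \<sigma>2 a) + (\<sigma>2 a - a)"
      using \<sigma>_5[OF aK] by (simp add: d_def)
    also have "odvd d2 \<dots>" by (intro odvd_add dvd2 O_intros a)
    finally show ?thesis .
  qed
  then obtain g where g: "g \<in> \<O>" "d = d2 * g" by (auto simp: odvd_def)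
  have "d * ((1 + e) * g) = d * 1" using g d2e by (simp add: mult_ac)
  then have "(1 + e) * g = 1" using d0 by (metis mult_cancel_left)
  then have Ne1: "N (1 + e) ^ 2 = 1" by (intro O_unit_N[of _ g] O_intros e g)
  have dvds: "odvd d (x - \<sigma> x)" "odvd d (x - \<sigma>2 x)" "odvd d (x - \<sigma>3 x)"
    "odvd d (x - \<sigma>4 x)" if x: "x \<in> \<O>" for x
  proof -
    have 1: "odvd d (y - \<sigma> y)" if "y \<in> \<O>" for y using odvd_uminus[OF dvd1[OF that]] by simp
    then show "odvd d (x - \<sigma> x)" using x .
    then have "odvd d ((x - \<sigma> x) + (\<sigma> x - \<sigma>2 x))" by (intro odvd_add 1 O_intros x)
    then show 2: "odvd d (x - \<sigma>2 x)" by simp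
    then have "odvd d ((x - \<sigma>2 x) + (\<sigma>2 x - \<sigma>3 x))" by (intro odvd_add 1 O_intros x)
    then show 3: "odvd d (x - \<sigma>3 x)" by simp
    then have "odvd d ((x - \<sigma>3 x) + (\<sigma>3 x - \<sigma>4 x))"
      by (intro odvd_add 1 O_intros x)
    then show "odvd d (x - \<sigma>4 x)" by simp
  qed
  have nm5: "odvd d (x * x * x * x * x - nm x)" if "x \<in> \<O>" for x
    unfolding nm_def by (intro odvd_cong_mult dvds that O_intros) simp
  have A: "odvd d (((1 + e) * (1 + e) * (1 + e) * (1 + e) * (1 + e)) ^ 2 - 1)"
  proof -
    have "odvd d (((1 + e) * (1 + e) * (1 + e) * (1 + e) * (1 + e)) ^ 2 - nm (1 + e) ^ 2)"
      using nm5[of "1 + e"] O_add[OF O_one e(1)]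
      by (intro odvd_cong_power) (auto simp flip: of_int_N intro: O_intros)
    moreover have "nm (1 + e) ^ 2 = 1"
      using Ne1 of_int_N[OF O_add[OF O_one e(1)]] by (metis of_int_1 of_int_power)
    ultimately show ?thesis by simp
  qed
  have B: "odvd d (1 + e + e * e + e * e * e + e * e * e * e)"
  proof -
    have s2: "\<sigma>2 d = d * e * \<sigma> e" using e eK dK by (simp add: \<sigma>_mult)
    have s3: "\<sigma>3 d = d * e * \<sigma> e * \<sigma>2 e" using s2 e eK dK by (simp add: \<sigma>_mult K_intros)
    have s4: "\<sigma>4 d = d * e * \<sigma> e * \<sigma>2 e * \<sigma>3 e"
      using s3 e eK dK by (simp add: \<sigma>_mult K_intros)
    have "d + \<sigma> d + \<sigma>2 d + \<sigma>3 d + \<sigma>4 d = 0"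
      using aK by (simp add: d_def \<sigma>_simps K_intros)
    then have "d * (1 + e + e * \<sigma> e + e * \<sigma> e * \<sigma>2 e + e * \<sigma> e * \<sigma>2 e * \<sigma>3 e) = 0"
      using e(2) s2 s3 s4 by (simp add: algebra_simps)
    then have z: "1 + e + e * \<sigma> e + e * \<sigma> e * \<sigma>2 e + e * \<sigma> e * \<sigma>2 e * \<sigma>3 e = 0"
      using d0 by simp
    have "1 + e + e * e + e * e * e + e * e * e * e = (e * e - e * \<sigma> e)
      + (e * e * e - e * \<sigma> e * \<sigma>2 e) + (e * e * e * e - e * \<sigma> e * \<sigma>2 e * \<sigma>3 e)"
      using z by (simp add: algebra_simps)
    also have "odvd d \<dots>" by (intro odvd_add odvd_cong_mult dvds O_intros e) simp_all
    finally show ?thesis .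
  qed
  have d11: "odvd d 11"
    by (subst eleven_bezout[of e, symmetric])
      (intro odvd_diff odvd_mult(2) A B O_intros e)
  have d2_11: "odvd d2 11" using odvd_trans[OF \<open>odvd d2 d\<close> d11] .
  have "D a = - d * - d2 * \<sigma>3 d2 * \<sigma>4 d"
    unfolding D_def d_def d2_def using aK by (simp add: \<sigma>_simps K_intros)
  moreover have "odvd (- d * - d2 * \<sigma>3 d2 * \<sigma>4 d) (11 * 11 * 11 * 11)"
  proof (intro odvd_mult_mono odvd_uminus_left d11 d2_11)
    show "odvd (\<sigma>3 d2) 11"
      using odvd_\<sigma>[OF odvd_\<sigma>[OF odvd_\<sigma>[OF d2_11]]] dO by (simp add: O_K K_intros)
    show "odvd (\<sigma>4 d) 11"
      using odvd_\<sigma>[OF odvd_\<sigma>[OF odvd_\<sigma>[OF odvd_\<sigma>[OF d11]]]] dO by (simp add: O_K K_intros)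
  qed
  ultimately show ?thesis by simp
qed

text \<open>A generator whose different divides \<open>m\<close> shows that \<open>\<O>/q\<O>\<close> is reduced for every prime \<open>q\<close> not dividing
  \<open>m\<close>: the traces in the dual basis expansion of a nilpotent element vanish modulo \<open>q\<close>.\<close>

lemma reduced_mod:
  assumes a: "a \<in> \<O>" and Da: "odvd (D a) (of_int m)" and q: "prime q" "\<not> q dvd m"
    and x: "x \<in> \<O>" "nilp q x"
  shows "idvd q x"
proof -
  have t: "idvd q (tr (x * y))" if "y \<in> \<O>" for y
    using nilp_tr[OF q(1) nilp_mult(1)[OF x(2) that]] that x by (simp add: O_mult)
  obtain k where k: "k \<in> \<O>" "of_int m = D a * k" using Da by (auto simp: odvd_def)
  have "idvd q (x * D a)"
    unfolding dual_basis[OF O_K[OF a] O_K[OF x(1)]]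
    using t[of "cof a"] t[of "c1 a"] t[of "c2 a"] t[of "c3 a"] t[of 1] a
    by (intro odvd_add odvd_mult(2)) (auto intro: O_intros cof_O c_O)
  from odvd_mult(1)[OF this k(1)] have "idvd q (of_int m * x)"
    using k by (simp add: mult_ac)
  moreover have "coprime m q" using q by (metis coprime_commute prime_imp_coprime)
  ultimately show ?thesis using coprime_odvd x by blast
qed

theorem monogenic_unramified_outside_11:
  assumes mono: "monogenic K" and q: "prime q" "q \<noteq> 11" and x: "x \<in> \<O>" "nilp q x"
  shows "idvd q x"
proof -
  obtain a where a: "a \<in> K" "\<O> = int_adjoin a" using mono unfolding monogenic_def by auto
  have aO: "a \<in> \<O>" using a int_adjoin_self by auto
  have "\<sigma> a \<noteq> a"
  proof
    assume s: "\<sigma> a = a"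
    have "\<sigma> x = x" if "x \<in> int_adjoin a" for x
      using that int_adjoin_O[OF aO]
      by (induction rule: int_adjoin_induct) (auto simp: s \<sigma>_simps O_K subset_iff)
    then show False using nontriv a(2) by auto
  qed
  from D_dvd_11_power[OF a(2) this] have "odvd (D a) (of_int (11 ^ 4))" by simp
  moreover have "\<not> q dvd 11 ^ 4"
  proof
    assume "q dvd 11 ^ 4"
    then have "q dvd 11" using q prime_dvd_power by blast
    moreover have "prime (11::int)" by simp
    ultimately show False using q primes_dvd_imp_eq by blast
  qed
  ultimately show ?thesis using reduced_mod aO q x by blast
qed

section \<open>Elements of index prime to a given prime\<close>

lemma index_not_dvd:
  fixes p :: nat
  assumes a: "a \<in> \<O>" "\<sigma> a \<noteq> a" and p: "prime p"
    and sat: "\<And>x. x \<in> \<O> \<Longrightarrow> of_nat p * x \<in> int_adjoin a \<Longrightarrow> x \<in> int_adjoin a"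
  shows "\<not> p dvd element_index K a"
proof
  assume dvd: "p dvd element_index K a"
  define G where "G = add_monoid (complex_ring\<lparr>carrier := \<O>\<rparr>)"
  define H where "H = int_adjoin a"
  have G [simp]: "carrier G = \<O>" "x \<otimes>\<^bsub>G\<^esub> y = x + y" "\<one>\<^bsub>G\<^esub> = 0" for x y
    by (simp_all add: G_def ring_of_type_algebra_def)
  have cg: "comm_group G"
  proof (rule comm_groupI)
    fix x assume "x \<in> carrier G"
    then show "\<exists>y\<in>carrier G. y \<otimes>\<^bsub>G\<^esub> x = \<one>\<^bsub>G\<^esub>"
      by (intro bexI[of _ "- x"]) (auto intro: O_intros)
  qed (auto intro: O_intros)
  interpret G: comm_group G by (rule cg)
  have inv: "inv\<^bsub>G\<^esub> x = - x" if "x \<in> \<O>" for x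
    by (rule G.inv_equality) (use that in \<open>auto intro: O_intros\<close>)
  have HO: "H \<subseteq> \<O>" unfolding H_def by (rule int_adjoin_O[OF a(1)])
  have sub: "subgroup H G"
  proof (rule G.subgroupI)
    show "H \<noteq> {}" using int_adjoin_one unfolding H_def by auto
    fix x assume x: "x \<in> H"
    then show "inv\<^bsub>G\<^esub> x \<in> H" using inv HO int_adjoin_uminus by (auto simp: H_def)
  qed (use HO in \<open>auto simp: H_def intro: int_adjoin_add\<close>)
  interpret N: normal H G by (rule G.subgroup_imp_normal[OF sub])
  have coset: "H #>\<^bsub>G\<^esub> x = (\<lambda>h. h + x) ` H" for x by (auto simp: r_coset_def)
  have coset_eq: "H #>\<^bsub>G\<^esub> x = H #>\<^bsub>G\<^esub> y" if xy: "x - y \<in> H" for x y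
  proof -
    have "(\<lambda>h. h + u) ` H \<subseteq> (\<lambda>h. h + v) ` H" if "u - v \<in> H" for u v
    proof
      fix z assume "z \<in> (\<lambda>h. h + u) ` H"
      then obtain h where h: "h \<in> H" "z = (h + (u - v)) + v" by auto
      then have "h + (u - v) \<in> H" using that by (auto simp: H_def intro: int_adjoin_add)
      then show "z \<in> (\<lambda>h. h + v) ` H" using h(2) by blast
    qed
    moreover have "y - x \<in> H" using int_adjoin_uminus[of "x - y"] xy by (simp add: H_def)
    ultimately show ?thesis unfolding coset using xy by blast
  qed
  have ei: "element_index K a = card (rcosets\<^bsub>G\<^esub> H)"
    by (simp add: element_index_def A_RCOSETS_def G_def H_def)
  have rc: "rcosets\<^bsub>G\<^esub> H = (\<lambda>x. H #>\<^bsub>G\<^esub> x) ` \<O>" by (auto simp: RCOSETS_def)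
  have fin: "finite (rcosets\<^bsub>G\<^esub> H)"
  proof -
    have "N (D a) \<noteq> 0" using N_eq_0[OF D_O] D_nz a O_K by blast
    then obtain F where F: "finite F" "F \<subseteq> \<O>"
      "\<And>x. x \<in> \<O> \<Longrightarrow> \<exists>y\<in>F. odvd (of_int (N (D a))) (x - y)"
      using finite_quotient by blast
    have "rcosets\<^bsub>G\<^esub> H \<subseteq> (\<lambda>x. H #>\<^bsub>G\<^esub> x) ` F"
      unfolding rc
    proof (rule subsetI)
      fix C assume "C \<in> (\<lambda>x. H #>\<^bsub>G\<^esub> x) ` \<O>"
      then obtain x where x: "x \<in> \<O>" "C = H #>\<^bsub>G\<^esub> x" by auto
      obtain y where y: "y \<in> F" "odvd (of_int (N (D a))) (x - y)" using F(3) x by blast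
      then have "x - y \<in> H" using ND_int_adjoin[OF a(1)] by (auto simp: odvd_def H_def)
      then show "C \<in> (\<lambda>x. H #>\<^bsub>G\<^esub> x) ` F" using coset_eq x y by blast
    qed
    then show ?thesis using F(1) finite_surj by blast
  qed
  \<comment> \<open>By Cauchy's theorem the finite group \<open>\<O>/\<int>[a]\<close> would contain an element of order \<open>p\<close>.\<close>
  obtain m where "card (rcosets\<^bsub>G\<^esub> H) = p * m" using dvd ei by auto
  then have ord: "Coset.order (G Mod H) = p ^ 1 * m" by (simp add: Coset.order_def FactGroup_def)
  interpret Q: group "G Mod H" by (rule N.factorgroup_is_group)
  have "finite (carrier (G Mod H))" using fin by (simp add: FactGroup_def)
  then obtain P where P: "subgroup P (G Mod H)" "card P = p ^ 1"
    using sylow_thm[OF p Q.group_axioms ord] by blast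
  have "P \<noteq> {H}" "P \<noteq> {}" using P(2) prime_gt_1_nat[OF p] by auto
  then obtain C where C: "C \<in> P" "C \<noteq> H" by auto
  have "C \<in> carrier (G Mod H)" using C P subgroup.subset by blast
  then obtain x where x: "x \<in> \<O>" "C = H #>\<^bsub>G\<^esub> x" by (auto simp: FactGroup_def rc)
  interpret P: group "(G Mod H)\<lparr>carrier := P\<rparr>" by (rule subgroup.subgroup_is_group[OF P(1) Q.group_axioms])
  have "C [^]\<^bsub>(G Mod H)\<lparr>carrier := P\<rparr>\<^esub> p = H"
    using P.pow_order_eq_1[of C] C P by (simp add: Coset.order_def)
  then have "C [^]\<^bsub>G Mod H\<^esub> p = H" using Q.nat_pow_consistent[of C p P] by simp
  moreover have "C [^]\<^bsub>G Mod H\<^esub> p = H #>\<^bsub>G\<^esub> (x [^]\<^bsub>G\<^esub> p)"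
    using N.FactGroup_pow[of x p] x by simp
  moreover have "x [^]\<^bsub>G\<^esub> n = of_nat n * x" for n :: nat
    by (induction n) (auto simp: nat_pow_def algebra_simps)
  ultimately have "H #>\<^bsub>G\<^esub> (of_nat p * x) = H" by simp
  moreover have "0 + of_nat p * x \<in> H #>\<^bsub>G\<^esub> (of_nat p * x)"
    unfolding coset using int_adjoin_zero by (intro imageI) (simp add: H_def)
  ultimately have "of_nat p * x \<in> H" by simp
  then have "x \<in> H" using sat x by (simp add: H_def)
  then have "C = H #>\<^bsub>G\<^esub> 0" using coset_eq[of x 0] x by simp
  also have "\<dots> = H" unfolding coset by simp
  finally show False using C by simp
qed

lemma index_not_dvd_N:
  fixes p :: nat
  assumes a: "a \<in> \<O>" and p: "prime p" and n: "\<not> int p dvd N (D a)"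
  shows "\<sigma> a \<noteq> a \<and> \<not> p dvd element_index K a"
proof -
  have "D a \<noteq> 0"
    using n N_eq_0[OF D_O[OF a]] by auto
  then have na: "\<sigma> a \<noteq> a" by (auto simp: D_def)
  moreover have "\<not> p dvd element_index K a"
  proof (rule index_not_dvd[OF a na p])
    fix x assume x: "x \<in> \<O>" "of_nat p * x \<in> int_adjoin a"
    have "coprime (N (D a)) (int p)" using p n by (metis coprime_commute prime_imp_coprime prime_nat_int_transfer)
    then obtain u v where uv: "u * N (D a) + v * int p = 1"
      by (metis bezout_int coprime_imp_gcd_eq_1)
    have "x = of_int (u * N (D a) + v * int p) * x" by (simp add: uv)
    also have "\<dots> = of_int u * (of_int (N (D a)) * x) + of_int v * (of_nat p * x)"
      by (simp add: algebra_simps)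
    also have "\<dots> \<in> int_adjoin a"
      by (intro int_adjoin_add int_adjoin_mult int_adjoin_of_int ND_int_adjoin a x)
    finally show "x \<in> int_adjoin a" .
  qed
  ultimately show ?thesis ..
qed

lemma rat_adjoin_eq: assumes a: "a \<in> K" "\<sigma> a \<noteq> a" shows "rat_adjoin a = K"
proof
  show "rat_adjoin a \<subseteq> K"
    by (rule rat_adjoin_subset) (auto intro: K_intros inverse_K a)
  have Q: "t \<in> rat_adjoin a" if "t \<in> \<rat>" for t using that rat_adjoin_of_rat by (auto elim!: Rats_cases)
  have trQ: "tr t \<in> \<rat>" if "t \<in> K" for t
    by (rule fixed_rat) (use that in \<open>auto simp: tr_def \<sigma>_simps K_intros\<close>)
  have *: "x * D a \<in> rat_adjoin a" if "x \<in> K" for x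
    unfolding dual_basis[OF a(1) that]
    by (intro rat_adjoin_add rat_adjoin_mult rat_adjoin_power rat_adjoin_self Q trQ mult_K that c_K a)
  show "K \<subseteq> rat_adjoin a"
  proof
    fix x assume "x \<in> K"
    have "x = x * D a * inverse (1 * D a)" using D_nz[OF a] by simp
    also have "\<dots> \<in> rat_adjoin a"
      by (rule rat_adjoin_mult[OF *[OF \<open>x \<in> K\<close>] rat_adjoin_inverse[OF *[OF one_K]]])
    finally show "x \<in> rat_adjoin a" .
  qed
qed

lemma not_dvd_N_D:
  assumes p: "prime p" and a: "a \<in> \<O>" and n: "\<not> p dvd N (a - \<sigma> a)" "\<not> p dvd N (a - \<sigma>2 a)"
  shows "\<not> p dvd N (D a)"
proof
  note aK = O_K[OF a]
  have e: "a - \<sigma>3 a = - \<sigma> (\<sigma> (\<sigma> (a - \<sigma>2 a)))" "a - \<sigma>4 a = - \<sigma> (\<sigma> (\<sigma> (\<sigma> (a - \<sigma> a))))"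
    using aK by (simp_all add: \<sigma>_simps K_intros)
  assume "p dvd N (D a)"
  then have "p dvd N (a - \<sigma> a) * N (a - \<sigma>2 a) * N (a - \<sigma>3 a) * N (a - \<sigma>4 a)"
    unfolding D_def using a by (simp add: N_mult O_intros)
  moreover have "N (a - \<sigma>3 a) = - N (a - \<sigma>2 a)" "N (a - \<sigma>4 a) = - N (a - \<sigma> a)"
    unfolding e using a by (simp_all add: N_uminus N_\<sigma> O_intros)
  ultimately show False using n p by (auto simp: prime_dvd_mult_iff)
qed

lemma nilp_int: assumes "prime p" "nilp p (of_int n)" shows "p dvd n"
  using nilp_dvd_N[OF assms O_of_int] prime_dvd_power assms by auto

section \<open>Primes with several primes above them\<close>

text \<open>If \<open>f\<close> is an idempotent modulo \<open>p\<close> with orthogonal conjugates, the conjugates add up to 1, for their sum is an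
  integer fixing \<open>f\<close>. The element \<open>a\<close> with coordinates 0, 1, 2, 3, 4 with respect to them then has
  coordinates pairwise distinct modulo \<open>p\<close>, and so \<open>a - \<sigma>a\<close> and \<open>a - \<sigma>\<^sup>2a\<close> are invertible.\<close>

lemma split_case:
  assumes p: "prime p" "p \<ge> 5" and f: "f \<in> \<O>" "\<not> idvd p f"
    and idem: "idvd p (f * f - f)"
    and orth: "idvd p (f * \<sigma> f)" "idvd p (f * \<sigma>2 f)"
  obtains a where "a \<in> \<O>" "\<not> p dvd N (a - \<sigma> a)" "\<not> p dvd N (a - \<sigma>2 a)"
proof -
  note fK = O_K[OF f(1)]
  note s1 = odvd_int_\<sigma>[of p]
  define f1 where "f1 = \<sigma> f"
  define f2 where "f2 = \<sigma> f1"
  define f3 where "f3 = \<sigma> f2"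
  define f4 where "f4 = \<sigma> f3"
  have O: "f1 \<in> \<O>" "f2 \<in> \<O>" "f3 \<in> \<O>" "f4 \<in> \<O>"
    unfolding f1_def f2_def f3_def f4_def by (intro O_intros f)+
  note Ks = fK O[THEN O_K]
  have s4: "\<sigma> f4 = f" unfolding f1_def f2_def f3_def f4_def using \<sigma>_5[OF fK] .
  note ss = f1_def[symmetric] f2_def[symmetric] f3_def[symmetric] f4_def[symmetric] s4
  have o1: "idvd p (f * f1)" "idvd p (f1 * f2)" "idvd p (f2 * f3)"
    "idvd p (f3 * f4)" "idvd p (f4 * f)"
  proof -
    show 1: "idvd p (f * f1)" using orth by (simp add: f1_def)
    show 2: "idvd p (f1 * f2)" using s1[OF 1] Ks by (simp add: \<sigma>_mult ss)
    show 3: "idvd p (f2 * f3)" using s1[OF 2] Ks by (simp add: \<sigma>_mult ss)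
    show 4: "idvd p (f3 * f4)" using s1[OF 3] Ks by (simp add: \<sigma>_mult ss)
    show "idvd p (f4 * f)" using s1[OF 4] Ks by (simp add: \<sigma>_mult ss)
  qed
  have o2: "idvd p (f * f2)" "idvd p (f1 * f3)" "idvd p (f2 * f4)"
    "idvd p (f3 * f)" "idvd p (f4 * f1)"
  proof -
    show 1: "idvd p (f * f2)" using orth by (simp add: f1_def f2_def)
    show 2: "idvd p (f1 * f3)" using s1[OF 1] Ks by (simp add: \<sigma>_mult ss)
    show 3: "idvd p (f2 * f4)" using s1[OF 2] Ks by (simp add: \<sigma>_mult ss)
    show 4: "idvd p (f3 * f)" using s1[OF 3] Ks by (simp add: \<sigma>_mult ss)
    show "idvd p (f4 * f1)" using s1[OF 4] Ks by (simp add: \<sigma>_mult ss)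
  qed
  have i: "idvd p (f1 * f1 - f1)" "idvd p (f2 * f2 - f2)"
    "idvd p (f3 * f3 - f3)" "idvd p (f4 * f4 - f4)"
  proof -
    show 1: "idvd p (f1 * f1 - f1)" using s1[OF idem] Ks by (simp add: \<sigma>_simps K_intros ss)
    show 2: "idvd p (f2 * f2 - f2)" using s1[OF 1] Ks by (simp add: \<sigma>_simps K_intros ss)
    show 3: "idvd p (f3 * f3 - f3)" using s1[OF 2] Ks by (simp add: \<sigma>_simps K_intros ss)
    show 4: "idvd p (f4 * f4 - f4)" using s1[OF 3] Ks by (simp add: \<sigma>_simps K_intros ss)
  qed
  have trf: "tr f = f + f1 + f2 + f3 + f4" by (simp add: tr_def ss)
  obtain T where T: "tr f = of_int T" using tr_int[OF f(1)] by (auto elim: Ints_cases)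
  have "of_int (T - 1) * f = (f * f - f) + f * f1 + f * f2 + f3 * f + f4 * f"
    using T[symmetric] trf by (simp add: algebra_simps)
  also have "idvd p \<dots>" by (intro odvd_add idem o1 o2)
  finally have "idvd p (of_int (T - 1) * f)" .
  then have "p dvd T - 1"
    using coprime_odvd[OF _ f(1)] f(2) p prime_imp_coprime coprime_commute by blast
  then have "idvd p (of_int (T - 1))"
    using p by (subst odvd_of_int_iff) auto
  then have t: "idvd p (f + f1 + f2 + f3 + f4 - 1)" using T trf by simp
  define a where "a = f1 + 2 * f2 + 3 * f3 + 4 * f4"
  have aO: "a \<in> \<O>" unfolding a_def by (intro O_intros O)
  have sa: "\<sigma> a = f2 + 2 * f3 + 3 * f4 + 4 * f" "\<sigma>2 a = f3 + 2 * f4 + 3 * f + 4 * f1"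
    unfolding a_def using Ks by (simp_all add: \<sigma>_simps K_intros ss)
  note rules = odvd_add odvd_mult(2) o1 o2 i idem t O_intros O f
  have nd: "\<not> p dvd m" if "0 < m" "m < 7" "m \<noteq> 5" for m
  proof
    assume d: "p dvd m"
    then have "p \<le> m" using that zdvd_imp_le by blast
    then have "p = 5 \<or> p = 6" using p that by linarith
    then show False
    proof
      assume "p = 5"
      then show False using d that by presburger
    next
      assume "p = 6"
      moreover have "\<not> prime (6::int)"
        using primes_dvd_imp_eq[of "2::int" 6] by auto
      ultimately show False using p by simp
    qed
  qed
  show ?thesis
  proof (rule that[OF aO])
    show "\<not> p dvd N (a - \<sigma> a)"
      \<comment> \<open>\<open>a - \<sigma>a\<close> has coordinates \<open>-4, 1, 1, 1, 1\<close> and \<open>w\<close> has \<open>-1, 4, 4, 4, 4\<close>.\<close>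
    proof (rule not_dvd_N[OF p(1), where w = "4 * (f1 + f2 + f3 + f4) - f" and m = 4])
      show "a - \<sigma> a \<in> \<O>" by (intro O_intros aO)
      show "4 * (f1 + f2 + f3 + f4) - f \<in> \<O>" by (intro O_intros O f)
      have "(a - \<sigma> a) * (4 * (f1 + f2 + f3 + f4) - f) - of_int 4 =
        4 * (f * f - f) + 4 * (f1 * f1 - f1) + 4 * (f2 * f2 - f2) + 4 * (f3 * f3 - f3) + 4 * (f4 * f4 - f4)
        + 4 * (f + f1 + f2 + f3 + f4 - 1)
        + (- 17) * (f * f1 + f * f2 + f3 * f + f4 * f)
        + 8 * (f1 * f2 + f1 * f3 + f4 * f1 + f2 * f3 + f2 * f4 + f3 * f4)"
        unfolding sa(1) unfolding a_def by (simp add: algebra_simps)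
      also have "idvd p \<dots>" by (intro rules)
      finally show "idvd p ((a - \<sigma> a) * (4 * (f1 + f2 + f3 + f4) - f) - of_int 4)" .
    qed (use nd[of 4] in auto)
    show "\<not> p dvd N (a - \<sigma>2 a)"
      \<comment> \<open>\<open>a - \<sigma>\<^sup>2a\<close> has coordinates \<open>-3, -3, 2, 2, 2\<close> and \<open>w\<close> has \<open>-2, -2, 3, 3, 3\<close>.\<close>
    proof (rule not_dvd_N[OF p(1), where w = "3 * (f2 + f3 + f4) - 2 * (f + f1)" and m = 6])
      show "a - \<sigma>2 a \<in> \<O>" by (intro O_intros aO)
      show "3 * (f2 + f3 + f4) - 2 * (f + f1) \<in> \<O>" by (intro O_intros O f)
      have "(a - \<sigma>2 a) * (3 * (f2 + f3 + f4) - 2 * (f + f1)) - of_int 6 =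
        6 * (f * f - f) + 6 * (f1 * f1 - f1) + 6 * (f2 * f2 - f2) + 6 * (f3 * f3 - f3) + 6 * (f4 * f4 - f4)
        + 6 * (f + f1 + f2 + f3 + f4 - 1)
        + (- 13) * (f * f2 + f3 * f + f4 * f + f1 * f2 + f1 * f3 + f4 * f1)
        + 12 * (f * f1 + f2 * f3 + f2 * f4 + f3 * f4)"
        unfolding sa(2) unfolding a_def by (simp add: algebra_simps)
      also have "idvd p \<dots>" by (intro rules)
      finally show "idvd p ((a - \<sigma>2 a) * (3 * (f2 + f3 + f4) - 2 * (f + f1)) - of_int 6)" .
    qed (use nd[of 6] in auto)
  qed
qed

text \<open>In the finite ring \<open>\<O>/p\<O>\<close> some power of every element is idempotent. The idempotent is nontrivial if
  the element is neither nilpotent nor invertible.\<close>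

lemma idempotent_power:
  assumes p: "prime p" and x: "x \<in> \<O>" "p dvd N x" "\<not> nilp p x"
  obtains e where "e \<in> \<O>" "idvd p (e * e - e)" "\<not> idvd p e" "idvd p (nm e)"
proof -
  have p0: "p \<noteq> 0" using p by auto
  obtain F where F: "finite F" "F \<subseteq> \<O>" "\<And>x. x \<in> \<O> \<Longrightarrow> \<exists>y\<in>F. idvd p (x - y)"
    using finite_quotient[OF p0] by blast
  have "\<forall>k. \<exists>y\<in>F. idvd p (x ^ k - y)" using F(3) O_power[OF x(1)] by blast
  then obtain g where g: "\<And>k::nat. g k \<in> F" "\<And>k. idvd p (x ^ k - g k)" by metis
  have "\<not> inj g"
    using F(1) g(1) finite_imageD[of g UNIV] finite_subset[of "range g" F] infinite_UNIV_nat by blast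
  then obtain i j where "i < j" "g i = g j" unfolding inj_def by (metis linorder_neqE_nat)
  then have "idvd p (x ^ i - x ^ j)"
    using odvd_diff[OF g(2)[of i] g(2)[of j]] by simp
  moreover define t where "t = j - i"
  ultimately have t: "t > 0" "idvd p (x ^ i - x ^ (i + t))" using \<open>i < j\<close> by auto
  have per: "idvd p (x ^ n - x ^ (n + k * t))" if "n \<ge> i" for n k
  proof (induction k)
    case (Suc k)
    have "x ^ (n + k * t) - x ^ (n + Suc k * t) = x ^ (n + k * t - i) * (x ^ i - x ^ (i + t))"
      using that by (simp add: right_diff_distrib flip: power_add) (simp add: algebra_simps)
    then have "idvd p (x ^ (n + k * t) - x ^ (n + Suc k * t))"
      using odvd_mult(2)[OF t(2) O_power[OF x(1)]] by simp
    from odvd_add[OF Suc this] show ?case by simp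
  qed simp
  define m where "m = (i + 1) * t"
  have m: "m \<ge> i" "m > 0" using t(1) unfolding m_def by (auto simp: trans_le_add2)
  have "idvd p (x ^ m - x ^ (m + m))"
    using per[OF m(1), of "i + 1"] unfolding m_def[symmetric] .
  then have "idvd p (x ^ m - x ^ m * x ^ m)" by (simp add: power_add)
  then have "idvd p (x ^ m * x ^ m - x ^ m)" using odvd_uminus by fastforce
  moreover have "\<not> idvd p (x ^ m)" using x(3) by (auto simp: nilp_def)
  moreover have "idvd p (nm (x ^ m))"
  proof -
    have "p dvd N x ^ m" using x(2) m(2) dvd_power[of m "N x"] dvd_trans by blast
    then have "p dvd N (x ^ m)" using x(1) by (simp add: N_power)
    then show ?thesis using of_int_N[OF O_power[OF x(1)]] odvd_of_int_iff[OF p0] by metis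
  qed
  ultimately show ?thesis using that O_power[OF x(1)] by blast
qed

text \<open>The conjugates of \<open>f\<close> by \<open>\<sigma>\<close> and \<open>\<sigma>\<^sup>2\<close> suffice, as the remaining ones give the same products up
  to conjugation.\<close>

lemma orthogonal_idempotent:
  assumes e: "e \<in> \<O>" "idvd p (e * e - e)" "\<not> idvd p e" "idvd p (nm e)"
  obtains f where "f \<in> \<O>" "\<not> idvd p f" "idvd p (f * f - f)"
    "idvd p (f * \<sigma> f)" "idvd p (f * \<sigma>2 f)"
proof -
  note s1 = odvd_int_\<sigma>[of p]
  define e1 where "e1 = \<sigma> e"
  define e2 where "e2 = \<sigma> e1"
  define e3 where "e3 = \<sigma> e2"
  define e4 where "e4 = \<sigma> e3"
  have O: "e1 \<in> \<O>" "e2 \<in> \<O>" "e3 \<in> \<O>" "e4 \<in> \<O>"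
    unfolding e1_def e2_def e3_def e4_def by (intro O_intros e)+
  have Ks: "e \<in> K" "e1 \<in> K" "e2 \<in> K" "e3 \<in> K" "e4 \<in> K" using O e O_K by auto
  have s4: "\<sigma> e4 = e" unfolding e1_def e2_def e3_def e4_def using \<sigma>_5[OF Ks(1)] .
  note ss = e1_def[symmetric] e2_def[symmetric] e3_def[symmetric] e4_def[symmetric] s4
  define I where "I x \<longleftrightarrow> x \<in> \<O> \<and> idvd p (x * x - x)" for x
  have I_\<sigma>: "I (\<sigma> x)" if "I x" for x
    using that s1[of "x * x - x"] by (auto simp: I_def \<sigma>_simps O_K K_intros O_\<sigma>)
  have I_mult: "I (x * y)" if "I x" "I y" for x y
  proof -
    have "idvd p ((x * x) * (y * y) - x * y)"
      using that by (intro odvd_cong_mult O_intros) (auto simp: I_def)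
    then show ?thesis using that by (auto simp: I_def O_mult mult_ac)
  qed
  have I0: "I e" using e by (simp add: I_def)
  have I1: "I e1" "I e2" "I e3" "I e4" unfolding e1_def e2_def e3_def e4_def by (intro I_\<sigma> I0)+
  have z5: "idvd p (e * e1 * e2 * e3 * e4)" using e(4) by (simp add: nm_def ss)
  have fin: thesis if "I f" "\<not> idvd p f" "\<sigma> f = g" "\<sigma> g = h"
    "f * g = A * B" "f * h = C * E" "idvd p A" "idvd p C" "B \<in> \<O>" "E \<in> \<O>" for f g h A B C E
    using that odvd_mult(1)[OF that(7,9)] odvd_mult(1)[OF that(8,10)]
    by (intro \<open>\<And>f. \<lbrakk>f \<in> \<O>; \<not> idvd p f; idvd p (f * f - f);
      idvd p (f * \<sigma> f); idvd p (f * \<sigma>2 f)\<rbrakk> \<Longrightarrow> thesis\<close>[of f]) (auto simp: I_def)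
  \<comment> \<open>Take for \<open>f\<close> a product of the \<open>\<sigma>\<^sup>ie\<close>, \<open>i \<in> I\<close>, that does not vanish modulo \<open>p\<close>, with \<open>I\<close> of
    maximal size. As \<open>I\<close> is nonempty and proper and 5 is prime, \<open>I\<close> is not invariant under shifts modulo 5, so \<open>f * \<sigma>f\<close> and
    \<open>f * \<sigma>\<^sup>2f\<close> contain vanishing products over larger sets. Up to shifts there are six possible
    sets \<open>I\<close>.\<close>
  show ?thesis
  proof (cases "idvd p (e * e1 * e2 * e3)")
    case False
    show ?thesis
      by (rule fin[of "e * e1 * e2 * e3" "e1 * e2 * e3 * e4" "e2 * e3 * e4 * e"
            "e * e1 * e2 * e3 * e4" "e1 * e2 * e3" "e * e1 * e2 * e3 * e4" "e * e2 * e3"])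
        (use False Ks z5 in \<open>auto simp: \<sigma>_mult ss K_intros mult_ac intro!: I_mult I0 I1 O_intros O e\<close>)
  next
    case z4: True
    show ?thesis
    proof (cases "idvd p (e * e1 * e2)")
      case False
      show ?thesis
        by (rule fin[of "e * e1 * e2" "e1 * e2 * e3" "e2 * e3 * e4"
              "e * e1 * e2 * e3" "e1 * e2" "e * e1 * e2 * e3 * e4" "e2"])
          (use False Ks z4 z5 in \<open>auto simp: \<sigma>_mult ss K_intros mult_ac intro!: I_mult I0 I1 O_intros O e\<close>)
    next
      case z3: True
      show ?thesis
      proof (cases "idvd p (e * e1 * e3)")
        case False
        show ?thesis
          by (rule fin[of "e * e1 * e3" "e1 * e2 * e4" "e2 * e3 * e"
                "e * e1 * e2 * e3 * e4" "e1" "e * e1 * e2 * e3" "e * e3"])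
            (use False Ks z4 z5 in \<open>auto simp: \<sigma>_mult ss K_intros mult_ac intro!: I_mult I0 I1 O_intros O e\<close>)
      next
        case z3': True
        have z3'': "idvd p (e4 * e * e2)"
          using s1[OF s1[OF s1[OF s1[OF z3']]]] Ks by (simp add: \<sigma>_mult ss K_intros)
        show ?thesis
        proof (cases "idvd p (e * e1)")
          case False
          show ?thesis
            by (rule fin[of "e * e1" "e1 * e2" "e2 * e3" "e * e1 * e2" "e1" "e * e1 * e2" "e3"])
              (use False Ks z3 in \<open>auto simp: \<sigma>_mult ss K_intros mult_ac intro!: I_mult I0 I1 O_intros O e\<close>)
        next
          case z2: True
          show ?thesis
          proof (cases "idvd p (e * e2)")
            case False
            show ?thesis
              by (rule fin[of "e * e2" "e1 * e3" "e2 * e4" "e * e1 * e2" "e3" "e4 * e * e2" "e2"])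
                (use False Ks z3 z3'' in \<open>auto simp: \<sigma>_mult ss K_intros mult_ac intro!: I_mult I0 I1 O_intros O e\<close>)
          next
            case z2': True
            show ?thesis
              by (rule fin[of e e1 e2 "e * e1" 1 "e * e2" 1])
                (use e z2 z2' in \<open>auto simp: ss intro!: I0\<close>)
          qed
        qed
      qed
    qed
  qed
qed

section \<open>Ramified primes\<close>

text \<open>A nilpotent element whose norm is exactly divisible by \<open>p\<close> has an Eisenstein characteristic polynomial, so its
  powers are linearly independent modulo \<open>p\<O>\<close>.\<close>

lemma eisenstein_case:
  assumes p: "prime p" and a: "a \<in> \<O>" "nilp p a" "\<not> p ^ 2 dvd N a"
    and x: "x \<in> \<O>" "of_int p * x \<in> int_adjoin a"
  shows "x \<in> int_adjoin a"
proof -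
  have p0: "p \<noteq> 0" using p by auto
  have "p dvd N a" using nilp_dvd_N p a by blast
  then obtain m where m: "N a = p * m" ..
  have pm: "\<not> p dvd m" using a(3) m by (auto simp: power2_eq_square)
  have ni: "idvd p z" if "nilp p z" "z \<in> \<int>" for z
    using that nilp_int[OF p] odvd_of_int_iff[OF p0] by (auto elim!: Ints_cases)
  have ns: "nilp p (\<sigma> a)" "nilp p (\<sigma>2 a)" "nilp p (\<sigma>3 a)" "nilp p (\<sigma>4 a)"
    by (intro nilp_\<sigma> a O_intros)+
  have nc: "nilp p (cof a)" "nilp p (c1 a)" "nilp p (c2 a)" "nilp p (c3 a)"
  proof -
    show "nilp p (cof a)" unfolding cof_def by (intro nilp_mult(1) ns O_intros a)
    have "nilp p (- c1 a)" unfolding c1_def minus_minus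
      by (intro nilp_add nilp_mult(1) ns O_intros a)
    from nilp_mult(1)[OF this, of "-1"] show "nilp p (c1 a)" using O_uminus[OF O_one] by simp
    show "nilp p (c2 a)" unfolding c2_def by (intro nilp_add nilp_mult(1) ns O_intros a)
    have "nilp p (- c3 a)" unfolding c3_def minus_minus
      by (intro nilp_add ns O_intros a)
    from nilp_mult(1)[OF this, of "-1"] show "nilp p (c3 a)" using O_uminus[OF O_one] by simp
  qed
  have nneg: "nilp p (- z)" if "nilp p z" for z
    using nilp_mult(1)[OF that, of "-1"] O_uminus[OF O_one] by simp
  have "nilp p (s2 a)" unfolding s2_def by (intro nilp_add nilp_mult(2) nc nneg O_intros c_O a)
  moreover have "nilp p (s3 a)" unfolding s3_def diff_conv_add_uminus
    by (intro nilp_add nilp_mult(2) nc nneg O_intros c_O a)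
  moreover have "nilp p (s4 a)" unfolding s4_def diff_conv_add_uminus
    by (intro nilp_add nilp_mult(2) nc nneg O_intros c_O cof_O a)
  moreover have "nilp p (nm a)" unfolding nm_cof by (intro nilp_mult(1) a cof_O)
  ultimately have a5: "idvd p (a ^ 5)"
    unfolding char_eq[of a]
    by (intro odvd_add odvd_diff odvd_mult(1) ni nilp_tr[OF p] s_int nm_int O_intros a) 
  obtain c where c: "of_int p * x = (\<Sum>i<5. of_int (c i) * a ^ i)"
    using int_adjoin_basis[OF a(1) x(2)] .
  \<comment> \<open>Multiplication by \<open>a\<^bsup>4 - i\<^esup>\<close> kills, modulo \<open>p\<close>, the terms after the \<open>i\<close>-th; those before it
    vanish by induction.\<close>
  have "p dvd c i" if "i < 5" for i
    using that
  proof (induction i rule: less_induct)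
    case (less i)
    have "idvd p (of_int p * x * a ^ (4 - i) -
        (\<Sum>j\<in>{..<5} - {i}. of_int (c j) * a ^ j * a ^ (4 - i)))"
    proof (intro odvd_diff odvd_sum)
      show "idvd p (of_int p * x * a ^ (4 - i))"
        by (intro odvd_mult(1) odvd_refl O_intros x a)
      fix j assume j: "j \<in> {..<5} - {i}"
      show "idvd p (of_int (c j) * a ^ j * a ^ (4 - i))"
      proof (cases "j < i")
        case True
        then have "p dvd c j" using less by auto
        then have "idvd p (of_int (c j))" using odvd_of_int_iff[OF p0] by blast
        then show ?thesis by (intro odvd_mult(1) O_intros a)
      next
        case False
        then have "a ^ j * a ^ (4 - i) = a ^ 5 * a ^ (j - i - 1)"
          using j less by (simp add: add.commute flip: power_add)
        then have "of_int (c j) * a ^ j * a ^ (4 - i) = of_int (c j) * (a ^ 5 * a ^ (j - i - 1))"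
          by (simp add: mult.assoc)
        also have "idvd p \<dots>" by (intro odvd_mult(2) odvd_mult(1) a5 O_intros a)
        finally show ?thesis .
      qed
    qed
    also have "of_int p * x * a ^ (4 - i) - (\<Sum>j\<in>{..<5} - {i}. of_int (c j) * a ^ j * a ^ (4 - i))
      = of_int (c i) * a ^ i * a ^ (4 - i)"
      unfolding c using less by (subst sum.remove[of _ i]) (auto simp: sum_distrib_right distrib_right)
    also have "\<dots> = of_int (c i) * a ^ 4" using less(2) by (simp add: mult.assoc flip: power_add)
    finally have "N (of_int p) dvd N (of_int (c i) * a ^ 4)" by (intro N_dvd O_of_int)
    also have "N (of_int (c i) * a ^ 4) = c i ^ 5 * (p * m) ^ 4"
      using a m by (simp add: N_mult O_power N_power)
    also have "\<dots> = p ^ 4 * (c i ^ 5 * m ^ 4)" by (simp add: power_mult_distrib)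
    also have "N (of_int p) = p ^ 4 * p" by (simp add: eval_nat_numeral)
    finally have "p ^ 4 * p dvd p ^ 4 * (c i ^ 5 * m ^ 4)" .
    then have "p dvd c i ^ 5 * m ^ 4" using p0 by simp
    then show ?case using pm p by (metis prime_dvd_mult_iff prime_dvd_power)
  qed
  then obtain d where d: "\<And>i. i < 5 \<Longrightarrow> c i = p * d i" unfolding dvd_def by metis
  have "of_int p * x = of_int p * (\<Sum>i<5. of_int (d i) * a ^ i)"
    unfolding c sum_distrib_left by (intro sum.cong refl) (simp add: d)
  then have "x = (\<Sum>i<5. of_int (d i) * a ^ i)" using p0 by simp
  also have "\<dots> = of_int (d 0) * a ^ 0 + of_int (d 1) * a ^ 1 + of_int (d 2) * a ^ 2
      + of_int (d 3) * a ^ 3 + of_int (d 4) * a ^ 4"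
    by (simp add: eval_nat_numeral)
  also have "\<dots> \<in> int_adjoin a"
    by (intro int_adjoin_add int_adjoin_mult int_adjoin_power int_adjoin_of_int int_adjoin_self)
  finally show ?thesis .
qed

text \<open>If \<open>\<sigma>\<close> acts trivially modulo the nilradical, every element is congruent to an integer. For \<open>p \<noteq> 5\<close> this
  integer is a fifth of the trace; for \<open>p = 5\<close> it is the norm, the residue field being perfect.\<close>

lemma nilp_const_residue:
  assumes p: "prime p" and triv: "\<And>x. x \<in> \<O> \<Longrightarrow> nilp p (\<sigma> x - x)" and x: "x \<in> \<O>"
  obtains c where "nilp p (x - of_int c)"
proof -
  have p0: "p \<noteq> 0" using p by auto
  have nneg: "nilp p (- z)" if "nilp p z" for z
    using nilp_mult(1)[OF that, of "-1"] O_uminus[OF O_one] by simp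
  have t: "nilp p (y - \<sigma> y)" if "y \<in> \<O>" for y using nneg[OF triv[OF that]] by simp
  have t2: "nilp p (y - \<sigma>2 y)" if "y \<in> \<O>" for y
    using nilp_add[OF t t, of y "\<sigma> y"] that by (simp add: O_intros)
  have t3: "nilp p (y - \<sigma>3 y)" if "y \<in> \<O>" for y
    using nilp_add[OF t2 t, of y "\<sigma>2 y"] that by (simp add: O_intros)
  have t4: "nilp p (y - \<sigma>4 y)" if "y \<in> \<O>" for y
    using nilp_add[OF t3 t, of y "\<sigma>3 y"] that by (simp add: O_intros)
  note ts = t[OF x] t2[OF x] t3[OF x] t4[OF x]
  show ?thesis
  proof (cases "p = 5")
    case False
    have "\<not> p dvd 5" using p False primes_dvd_imp_eq[of p 5] by auto
    then have "coprime 5 p" using p by (metis coprime_commute prime_imp_coprime)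
    then obtain u v where uv: "u * 5 + v * p = 1"
      by (metis bezout_int coprime_imp_gcd_eq_1)
    obtain T where T: "tr x = of_int T" using tr_int[OF x] by (auto elim: Ints_cases)
    have "x - of_int (u * T) = of_int (u * 5 + v * p) * x - of_int u * tr x"
      by (simp add: uv T)
    also have "\<dots> = of_int u * ((x - \<sigma> x) + (x - \<sigma>2 x) + (x - \<sigma>3 x)
        + (x - \<sigma>4 x)) + of_int p * (of_int v * x)"
      by (simp add: tr_def algebra_simps)
    also have "nilp p \<dots>"
      by (intro nilp_add nilp_mult(2) ts O_intros x odvd_nilp odvd_mult(1) odvd_refl)
    finally show ?thesis by (rule that)
  next
    case p5: True
    obtain n where n: "nm x = of_int n" using nm_int[OF x] by (auto elim: Ints_cases)
    have cong: "nilp p (u * u' - v * v')" if "nilp p (u - v)" "nilp p (u' - v')" "u' \<in> \<O>" "v \<in> \<O>" "u \<in> \<O>" "v' \<in> \<O>" for u v u' v'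
    proof -
      have "u * u' - v * v' = (u - v) * u' + v * (u' - v')" by (simp add: algebra_simps)
      also have "nilp p \<dots>" using that by (intro nilp_add nilp_mult O_intros) auto
      finally show ?thesis .
    qed
    have n0: "nilp p (x - x)" using odvd_nilp[of p 0] by simp
    have "nilp p (x * x * x * x * x - nm x)" unfolding nm_def
      by (intro cong ts n0 O_intros x)
    then have 1: "nilp p (x ^ 5 - of_int n)" by (simp add: n eval_nat_numeral mult.assoc)
    have "n mod 5 = 0 \<or> n mod 5 = 1 \<or> n mod 5 = 2 \<or> n mod 5 = 3 \<or> n mod 5 = 4" by presburger
    then have "(n mod 5) ^ 5 mod 5 = n mod 5" by (elim disjE) simp_all
    then have "n mod 5 = n ^ 5 mod 5" by (simp add: power_mod)
    then have "p dvd n - n ^ 5" using p5 by (simp add: mod_eq_dvd_iff)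
    then have 2: "nilp p (of_int n - of_int (n ^ 5))"
      using odvd_of_int_iff[OF p0, of "n - n ^ 5"] odvd_nilp by simp
    let ?n = "of_int n :: complex"
    have "(x - ?n) ^ 5 = (x ^ 5 - ?n) + (?n - of_int (n ^ 5))
      + of_int p * (2 * x ^ 3 * ?n ^ 2 - x ^ 4 * ?n - 2 * x ^ 2 * ?n ^ 3 + x * ?n ^ 4)"
      unfolding p5 by (simp add: algebra_simps eval_nat_numeral)
    also have "nilp p \<dots>"
      by (intro nilp_add 1 2 odvd_nilp odvd_mult(1) odvd_refl O_intros x)
    finally obtain k where "idvd p (((x - ?n) ^ 5) ^ k)" by (auto simp: nilp_def)
    then have "nilp p (x - ?n)" unfolding nilp_def power_mult[symmetric] by blast
    then show ?thesis by (rule that)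
  qed
qed

text \<open>The nilradical of the finite ring \<open>\<O>/p\<O>\<close> is nilpotent, so it is annihilated by some nonzero element.\<close>

lemma nilradical_annihilator:
  assumes p: "prime p"
  obtains b where "b \<in> \<O>" "\<not> idvd p b" "\<And>x. x \<in> \<O> \<Longrightarrow> nilp p x \<Longrightarrow> idvd p (b * x)"
proof -
  have p0: "p \<noteq> 0" using p by auto
  obtain F where F: "finite F" "F \<subseteq> \<O>" "\<And>x. x \<in> \<O> \<Longrightarrow> \<exists>y\<in>F. idvd p (x - y)"
    using finite_quotient[OF p0] by blast
  have "\<exists>b\<in>\<O>. \<not> idvd p b \<and> (\<forall>y\<in>S. idvd p (b * y))"
    if "finite S" "S \<subseteq> {y \<in> \<O>. nilp p y}" for S
    using that
  proof (induction S rule: finite_induct)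
    case empty
    have "\<not> idvd p (of_int 1)" using odvd_of_int_iff[OF p0] p not_prime_unit by blast
    then show ?case by (intro bexI[of _ 1]) auto
  next
    case (insert y S)
    then obtain b where b: "b \<in> \<O>" "\<not> idvd p b" "\<And>z. z \<in> S \<Longrightarrow> idvd p (b * z)" by auto
    have y: "y \<in> \<O>" "nilp p y" using insert by auto
    then obtain l where "idvd p (y ^ l)" by (auto simp: nilp_def)
    then have ex: "idvd p (b * y ^ l)" using odvd_mult(2) b by blast
    define k where "k = (LEAST k. idvd p (b * y ^ k))"
    have k: "idvd p (b * y ^ k)" unfolding k_def using ex by (rule LeastI)
    have "k \<noteq> 0" using k b(2) by (metis mult.right_neutral power_0)
    then obtain j where j: "k = Suc j" by (cases k) auto
    have "\<not> idvd p (b * y ^ j)"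
      using not_less_Least[of j "\<lambda>k. idvd p (b * y ^ k)"] j unfolding k_def by simp
    moreover have "idvd p (b * y ^ j * z)" if "z \<in> insert y S" for z
    proof (cases "z = y")
      case True
      then show ?thesis using k j by (simp add: mult_ac)
    next
      case False
      then have "idvd p (b * z)" using that b(3) by auto
      then have "idvd p (b * z * y ^ j)" by (rule odvd_mult(1)) (intro O_intros y)
      then show ?thesis by (simp add: mult_ac)
    qed
    ultimately show ?case using b y by (intro bexI[of _ "b * y ^ j"]) (auto intro: O_intros)
  qed
  moreover have "finite {y \<in> F. nilp p y}" "{y \<in> F. nilp p y} \<subseteq> {y \<in> \<O>. nilp p y}" using F by auto
  ultimately obtain b where
    b: "b \<in> \<O>" "\<not> idvd p b" "\<And>y. y \<in> F \<Longrightarrow> nilp p y \<Longrightarrow> idvd p (b * y)"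
    by (metis (mono_tags, lifting) mem_Collect_eq)
  show ?thesis
  proof (rule that[OF b(1,2)])
    fix x assume x: "x \<in> \<O>" "nilp p x"
    obtain y where y: "y \<in> F" "idvd p (x - y)" using F(3) x by blast
    have "nilp p (y - x)" using odvd_nilp odvd_uminus[OF y(2)] by simp
    then have "nilp p (x + (y - x))" using x y F by (intro nilp_add O_intros) auto
    then have "idvd p (b * y)" using b(3)[OF y(1)] by simp
    from odvd_add[OF this odvd_mult(2)[OF y(2) b(1)]]
    have "idvd p (b * y + b * (x - y))" .
    then show "idvd p (b * x)" by (simp add: algebra_simps)
  qed
qed

text \<open>If \<open>z = b/p\<close> maps the nilradical \<open>J\<close> (the elements of \<open>\<O>\<close> nilpotent modulo \<open>p\<close>) to itself, it is integral.
  Indeed, \<open>Q j u\<close> says that \<open>u\<close> maps \<open>J\<close> into \<open>p\<^sup>jJ\<close>; so the \<open>j\<close>-th elementary symmetric function of the conjugates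
  of \<open>b\<close> has this property, and being an integer it is divisible by \<open>p\<^sup>j\<close>.\<close>

lemma divide_nilradical:
  assumes p: "prime p" and b: "b \<in> \<O>"
    and stab: "\<And>x. x \<in> \<O> \<Longrightarrow> nilp p x \<Longrightarrow> \<exists>y\<in>\<O>. nilp p y \<and> b * x = of_int p * y"
  shows "idvd p b"
proof -
  have p0: "p \<noteq> 0" "(of_int p :: complex) \<noteq> 0" using p by auto
  define Q where "Q j z \<longleftrightarrow> z \<in> \<O> \<and> (\<forall>x\<in>\<O>. nilp p x \<longrightarrow> (\<exists>y\<in>\<O>. nilp p y \<and> z * x = of_int p ^ j * y))" for j z
  have Q1: "Q 1 b" using b stab by (auto simp: Q_def)
  have Q_\<sigma>: "Q j (\<sigma> z)" if z: "Q j z" for j z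
    unfolding Q_def
  proof (intro conjI ballI impI)
    show "\<sigma> z \<in> \<O>" using z by (auto simp: Q_def O_\<sigma>)
    fix x assume x: "x \<in> \<O>" "nilp p x"
    have "\<sigma>4 x \<in> \<O>" "nilp p (\<sigma>4 x)" by (intro O_intros nilp_\<sigma> x)+
    then obtain y where y: "y \<in> \<O>" "nilp p y" "z * \<sigma>4 x = of_int p ^ j * y"
      using z unfolding Q_def by blast
    then have "\<sigma> (z * \<sigma>4 x) = \<sigma> (of_int p ^ j * y)" by simp
    moreover have "z \<in> K" "x \<in> K" "y \<in> K" using z x y O_K unfolding Q_def by blast+
    ultimately have "\<sigma> z * x = of_int p ^ j * \<sigma> y"
      by (simp add: \<sigma>_simps K_intros)
    then show "\<exists>y\<in>\<O>. nilp p y \<and> \<sigma> z * x = of_int p ^ j * y" using y O_\<sigma> nilp_\<sigma> by blast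
  qed
  have Q_mult: "Q (i + j) (u * v)" if uv: "Q i u" "Q j v" for i j u v
    unfolding Q_def
  proof (intro conjI ballI impI)
    show "u * v \<in> \<O>" using uv by (auto simp: Q_def O_mult)
    fix x assume x: "x \<in> \<O>" "nilp p x"
    obtain y where y: "y \<in> \<O>" "nilp p y" "v * x = of_int p ^ j * y" using uv x unfolding Q_def by blast
    obtain z where z: "z \<in> \<O>" "nilp p z" "u * y = of_int p ^ i * z" using uv y unfolding Q_def by blast
    have "u * v * x = of_int p ^ j * (u * y)" using y by (simp add: mult_ac)
    also have "\<dots> = of_int p ^ (i + j) * z" using z by (simp add: power_add mult_ac)
    finally show "\<exists>y\<in>\<O>. nilp p y \<and> u * v * x = of_int p ^ (i + j) * y" using z by blast
  qed
  have Q_add: "Q j (u + v)" if uv: "Q j u" "Q j v" for j u v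
    unfolding Q_def
  proof (intro conjI ballI impI)
    show "u + v \<in> \<O>" using uv by (auto simp: Q_def O_add)
    fix x assume x: "x \<in> \<O>" "nilp p x"
    obtain y where y: "y \<in> \<O>" "nilp p y" "u * x = of_int p ^ j * y" using uv x unfolding Q_def by blast
    obtain z where z: "z \<in> \<O>" "nilp p z" "v * x = of_int p ^ j * z" using uv x unfolding Q_def by blast
    have "(u + v) * x = of_int p ^ j * (y + z)" using y z by (simp add: distrib_left distrib_right)
    then show "\<exists>y\<in>\<O>. nilp p y \<and> (u + v) * x = of_int p ^ j * y" using y z nilp_add O_add by blast
  qed
  have Q_int: "odvd (of_int p ^ j) z" if z: "Q j z" "z \<in> \<int>" for j z
  proof -
    obtain m where m: "z = of_int m" using z by (auto elim: Ints_cases)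
    have "nilp p (of_int p)" by (intro odvd_nilp odvd_refl)
    then obtain y where y: "y \<in> \<O>" "nilp p y" "of_int m * of_int p = of_int p ^ j * y"
      using z m unfolding Q_def by (metis O_of_int)
    have "y = of_int (m * p) / of_int (p ^ j)" using y(3) p0 by (simp add: field_simps)
    then have "y \<in> \<rat>" by (metis Rats_divide Rats_of_int)
    then obtain n where n: "y = of_int n" using O_rat_int y(1) by (auto elim: Ints_cases)
    obtain l where l: "n = p * l" using nilp_int[OF p] y(2) n by (auto elim: dvdE)
    have "z * of_int p = (of_int p ^ j * of_int l) * of_int p" using y(3) by (simp add: m n l)
    then have "z = of_int p ^ j * of_int l" using p0 by simp
    then show ?thesis by (intro odvdI[of "of_int l"]) auto
  qed
  note bs = Q1 Q_\<sigma>[OF Q1] Q_\<sigma>[OF Q_\<sigma>[OF Q1]] Q_\<sigma>[OF Q_\<sigma>[OF Q_\<sigma>[OF Q1]]]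
    Q_\<sigma>[OF Q_\<sigma>[OF Q_\<sigma>[OF Q_\<sigma>[OF Q1]]]]
  have m2: "Q 2 (u * v)" if "Q 1 u" "Q 1 v" for u v
    using Q_mult[of 1 u 1 v] that by (simp add: eval_nat_numeral)
  have m3: "Q 3 (u * v)" if "Q 2 u" "Q 1 v" for u v
    using Q_mult[of 2 u 1 v] that by (simp add: eval_nat_numeral)
  have m4: "Q 4 (u * v)" if "Q 3 u" "Q 1 v" for u v
    using Q_mult[of 3 u 1 v] that by (simp add: eval_nat_numeral)
  have m5: "Q 5 (u * v)" if "Q 4 u" "Q 1 v" for u v
    using Q_mult[of 4 u 1 v] that by (simp add: eval_nat_numeral)
  have m3': "Q 3 (u * v)" if "Q 1 u" "Q 2 v" for u v
    using Q_mult[of 1 u 2 v] that by (simp add: eval_nat_numeral)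
  have m4': "Q 4 (u * v)" if "Q 1 u" "Q 3 v" for u v
    using Q_mult[of 1 u 3 v] that by (simp add: eval_nat_numeral)
  have c3: "Q 1 (- c3 b)" unfolding c3_def minus_minus by (intro Q_add bs)
  have c2: "Q 2 (c2 b)" unfolding c2_def by (intro Q_add m2 bs)
  have c1: "Q 3 (- c1 b)" unfolding c1_def minus_minus by (intro Q_add m3 m2 bs)
  have c0: "Q 4 (cof b)" unfolding cof_def by (intro m4 m3 m2 bs)
  have "Q 1 (tr b)" unfolding tr_def by (intro Q_add bs)
  moreover have "Q 2 (s2 b)" unfolding s2_def by (intro Q_add m2 c3 c2 bs)
  moreover have "Q 3 (s3 b)" unfolding s3_def diff_conv_add_uminus by (intro Q_add m3' c1 c2 bs)
  moreover have "Q 4 (s4 b)"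
  proof -
    have "s4 b = cof b + b * - c1 b" by (simp add: s4_def)
    also have "Q 4 \<dots>" by (intro Q_add m4' c0 c1 bs)
    finally show ?thesis .
  qed
  moreover have "Q 5 (nm b)" unfolding nm_def by (intro m5 m4 m3 m2 bs)
  ultimately have "odvd (of_int p ^ 1) (tr b)" "odvd (of_int p ^ 2) (s2 b)" "odvd (of_int p ^ 3) (s3 b)"
    "odvd (of_int p ^ 4) (s4 b)" "odvd (of_int p ^ 5) (nm b)"
    using Q_int tr_int[OF b] s_int[OF b] nm_int[OF b] by blast+
  then obtain t1 t2 t3 t4 t5 where t: "t1 \<in> \<O>" "t2 \<in> \<O>" "t3 \<in> \<O>" "t4 \<in> \<O>" "t5 \<in> \<O>"
    "tr b = of_int p * t1" "s2 b = of_int p ^ 2 * t2" "s3 b = of_int p ^ 3 * t3"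
    "s4 b = of_int p ^ 4 * t4" "nm b = of_int p ^ 5 * t5"
    by (auto simp: odvd_def)
  have rat: "z \<in> \<int>" if "w \<in> \<int>" "w = of_int p ^ k * z" "z \<in> \<O>" for w z k
  proof -
    have "z = w / of_int (p ^ k)" using that(2) p0 by simp
    then have "z \<in> \<rat>" using that(1) by (metis Rats_divide Rats_of_int Ints_cases)
    then show ?thesis using O_rat_int that(3) by blast
  qed
  have ti: "t1 \<in> \<int>" "t2 \<in> \<int>" "t3 \<in> \<int>" "t4 \<in> \<int>" "t5 \<in> \<int>"
    using rat[OF tr_int[OF b], of 1 t1] rat[OF s_int(1)[OF b], of 2 t2] rat[OF s_int(2)[OF b], of 3 t3]
      rat[OF s_int(3)[OF b], of 4 t4] rat[OF nm_int[OF b], of 5 t5] t by simp_all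
  define z where "z = b / of_int p"
  have bz: "b = of_int p * z" using p0 by (simp add: z_def)
  have "of_int p ^ 5 * z ^ 5 = of_int p ^ 5 * (t1 * z ^ 4 - t2 * z ^ 3 + t3 * z ^ 2 - t4 * z + t5)"
    using char_eq[of b] unfolding t(6-10) unfolding bz
    by (simp add: power_mult_distrib algebra_simps eval_nat_numeral)
  then have z5: "z ^ 5 = t1 * z ^ 4 - t2 * z ^ 3 + t3 * z ^ 2 - t4 * z + t5"
    using p0 by simp
  have "algebraic_int z"
  proof (rule algebraic_int.intros[of "[: - t5, t4, - t3, t2, - t1, 1 :]"])
    show "\<forall>i. coeff [: - t5, t4, - t3, t2, - t1, 1 :] i \<in> \<int>"
      using ti by (auto simp: coeff_pCons split: nat.split)
    show "poly [: - t5, t4, - t3, t2, - t1, 1 :] z = 0"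
      using z5 by (simp add: algebra_simps eval_nat_numeral)
  qed simp
  moreover have "z \<in> K" unfolding z_def by (intro divide_K O_K[OF b] of_int_K)
  ultimately have "z \<in> \<O>" by (simp add: ring_of_integers_def)
  then show ?thesis using bz by (intro odvdI)
qed

text \<open>Otherwise \<open>\<O> = \<int> + p\<O>\<close>, and iterating this, \<open>\<sigma>a - a\<close> would be divisible by all powers of \<open>p\<close>.\<close>

lemma not_nilradical_eq_multiples:
  assumes p: "prime p" and triv: "\<And>x. x \<in> \<O> \<Longrightarrow> nilp p (\<sigma> x - x)"
  shows "\<exists>x\<in>\<O>. nilp p x \<and> \<not> idvd p x"
proof (rule ccontr)
  assume "\<not> ?thesis"
  then have mult: "\<And>x. x \<in> \<O> \<Longrightarrow> nilp p x \<Longrightarrow> idvd p x" by blast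
  obtain a where a: "a \<in> \<O>" "\<sigma> a \<noteq> a" using nontriv by blast
  have "\<exists>z\<in>\<O>. \<sigma> a - a = of_int p ^ k * (\<sigma> z - z)" for k
  proof (induction k)
    case 0
    show ?case using a by (intro bexI[of _ a]) auto
  next
    case (Suc k)
    then obtain z where z: "z \<in> \<O>" "\<sigma> a - a = of_int p ^ k * (\<sigma> z - z)" by blast
    obtain c where c: "nilp p (z - of_int c)" using nilp_const_residue[OF p triv z(1)] .
    have "idvd p (z - of_int c)" by (rule mult[OF _ c]) (intro O_intros z)
    then obtain w where w: "w \<in> \<O>" "z - of_int c = of_int p * w" by (auto simp: odvd_def)
    then have ze: "z = of_int c + of_int p * w" by (simp add: algebra_simps)
    have "\<sigma> z - z = of_int p * (\<sigma> w - w)"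
      unfolding ze using O_K[OF w(1)] by (simp add: \<sigma>_simps K_intros algebra_simps)
    then show ?case using z w by (intro bexI[of _ w]) (auto simp: mult_ac)
  qed
  moreover define M where "M = N (\<sigma> a - a)"
  ultimately have dv: "p ^ k dvd M" for k
  proof -
    obtain z where "z \<in> \<O>" "\<sigma> a - a = of_int (p ^ k) * (\<sigma> z - z)"
      using \<open>\<And>k. \<exists>z\<in>\<O>. \<sigma> a - a = of_int p ^ k * (\<sigma> z - z)\<close>[of k] by auto
    then have "M = (p ^ k) ^ 5 * N (\<sigma> z - z)"
      unfolding M_def using N_mult[OF O_of_int[of "p ^ k"], of "\<sigma> z - z"] N_of_int[of "p ^ k"]
      by (simp add: O_intros)
    then have "(p ^ k) ^ 5 dvd M" by simp
    then show ?thesis by (meson dvd_power dvd_trans zero_less_numeral)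
  qed
  have M0: "M \<noteq> 0" unfolding M_def using N_eq_0 a O_intros by (metis eq_iff_diff_eq_0)
  have "finite {k. p ^ k dvd M}"
    using M0 p not_prime_unit by (intro finite_divisor_powers) auto
  then show False using dv by simp
qed

text \<open>This is the statement that the localization at \<open>p\<close> is a discrete valuation ring with ramification index 5. If
  \<open>b\<close> annihilates the nilradical modulo \<open>p\<close>, then \<open>b/p\<close> is not integral, so by \<open>divide_nilradical\<close> there is a
  nilpotent \<open>n\<close> such that \<open>b * n = p * y\<close> with \<open>y\<close> invertible modulo \<open>p\<close>. This \<open>n\<close> divides all nilpotent elements
  locally, so the \<open>p\<close>-adic valuation \<open>v\<close> of the norm of \<open>n\<close> divides that of the norm of every nonzero element, in particular 5, the
  valuation of the norm of \<open>p\<close>. It is not 5, because then all nilpotent elements would be multiples of \<open>p\<close>.\<close>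

lemma ramified_case:
  assumes p: "prime p" and nil: "\<And>x. x \<in> \<O> \<Longrightarrow> p dvd N x \<Longrightarrow> nilp p x"
    and triv: "\<And>x. x \<in> \<O> \<Longrightarrow> nilp p (\<sigma> x - x)"
  obtains a where "a \<in> \<O>" "nilp p a" "\<not> p ^ 2 dvd N a"
proof -
  have p0: "p \<noteq> 0" "(of_int p :: complex) \<noteq> 0" using p by auto
  obtain b where b: "b \<in> \<O>" "\<not> idvd p b" "\<And>x. x \<in> \<O> \<Longrightarrow> nilp p x \<Longrightarrow> idvd p (b * x)"
    using nilradical_annihilator[OF p] by blast
  have "\<exists>x\<in>\<O>. nilp p x \<and> \<not> (\<exists>y\<in>\<O>. nilp p y \<and> b * x = of_int p * y)"
    using divide_nilradical[OF p b(1)] b(2) by blast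
  then obtain n where n: "n \<in> \<O>" "nilp p n" "\<not> (\<exists>y\<in>\<O>. nilp p y \<and> b * n = of_int p * y)" by blast
  obtain y where y: "y \<in> \<O>" "b * n = of_int p * y" using b(3)[OF n(1,2)] by (auto simp: odvd_def)
  have Ny: "\<not> p dvd N y" using nil y n(3) by blast
  then have "y \<noteq> 0" using N_eq_0[OF y(1)] by auto
  then have nz: "n \<noteq> 0" "b \<noteq> 0" using y p0 by auto
  define v where "v x = multiplicity p (N x)" for x
  have v_mult: "v (x * z) = v x + v z" if "x \<in> \<O>" "z \<in> \<O>" "x \<noteq> 0" "z \<noteq> 0" for x z
    unfolding v_def N_mult[OF that(1,2)]
    by (rule prime_elem_multiplicity_mult_distrib) (use that p N_eq_0 in auto)
  have vy: "v y = 0" unfolding v_def by (rule not_dvd_imp_multiplicity_0[OF Ny])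
  have vp: "v (of_int p) = 5"
    unfolding v_def N_of_int using p0(1) p not_prime_unit multiplicity_same_power by blast
  have pO: "of_int p \<in> \<O>" by simp
  have step: "\<exists>a'\<in>\<O>. a' \<noteq> 0 \<and> v a = v a' + v n" if a: "a \<in> \<O>" "a \<noteq> 0" "nilp p a" for a
  proof -
    obtain a' where a': "a' \<in> \<O>" "b * a = of_int p * a'" using b(3) a by (auto simp: odvd_def)
    have "of_int p * (a * y) = of_int p * (a' * n)" using y(2) a'(2) by (metis mult.assoc mult.commute)
    then have eq: "a * y = a' * n" using p0 by simp
    then have "a' \<noteq> 0" using a \<open>y \<noteq> 0\<close> by auto
    then show ?thesis using v_mult[of a y] v_mult[of a' n] eq vy a a' y n nz \<open>y \<noteq> 0\<close>
      by (intro bexI[of _ a']) auto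
  qed
  have vn: "v n > 0"
    using nilp_dvd_N[OF p n(2,1)] N_eq_0[OF n(1)] nz p unfolding v_def
    by (metis multiplicity_gt_zero_iff not_prime_unit)
  have dvd: "v n dvd v a" if "a \<in> \<O>" "a \<noteq> 0" for a
    using that
  proof (induction "v a" arbitrary: a rule: less_induct)
    case less
    show ?case
    proof (cases "nilp p a")
      case True
      then obtain a' where a': "a' \<in> \<O>" "a' \<noteq> 0" "v a = v a' + v n" using step less by blast
      then have "v n dvd v a'" using less(1)[of a'] vn by simp
      then show ?thesis using a'(3) by simp
    next
      case False
      then have "\<not> p dvd N a" using nil less by blast
      then have "v a = 0" unfolding v_def by (rule not_dvd_imp_multiplicity_0)
      then show ?thesis by simp
    qed
  qed
  have "v n dvd 5" using dvd[OF pO p0(2)] vp by simp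
  moreover have "prime (5::nat)" by simp
  ultimately have "v n = 1 \<or> v n = 5" by (metis prime_nat_iff)
  moreover have "v n \<noteq> 5"
  proof
    assume v5: "v n = 5"
    have "v b + v n = v (of_int p) + v y"
      using v_mult[of b n] v_mult[of "of_int p" y] y b n nz p0 \<open>y \<noteq> 0\<close> by simp
    then have "v b = 0" using v5 vp vy by simp
    then have "\<not> p dvd N b" using N_eq_0[OF b(1)] nz p unfolding v_def
      by (metis multiplicity_gt_zero_iff not_prime_unit less_irrefl)
    then obtain w where w: "w \<in> \<O>" "idvd p (b * w - 1)" using unit_mod[OF p b(1)] by blast
    have "idvd p x" if x: "x \<in> \<O>" "nilp p x" for x
    proof -
      have "idvd p (w * (b * x) - x * (b * w - 1))"
        using odvd_diff[OF odvd_mult(2)[OF b(3)[OF x] w(1)] odvd_mult(2)[OF w(2) x(1)]] .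
      then show ?thesis by (simp add: algebra_simps)
    qed
    then show False using not_nilradical_eq_multiples[OF p triv] by blast
  qed
  ultimately have v1: "v n = 1" by blast
  have "\<not> p ^ 2 dvd N n"
  proof
    assume "p ^ 2 dvd N n"
    then have "2 \<le> v n" unfolding v_def using N_eq_0[OF n(1)] nz p not_prime_unit
      by (intro multiplicity_geI) auto
    then show False using v1 by simp
  qed
  then show ?thesis using that n by blast
qed

text \<open>No prime \<open>p \<ge> 5\<close>, the degree, divides the index of the field.\<close>

theorem exists_index_not_dvd:
  fixes p :: nat
  assumes p: "prime p" "p \<ge> 5"
  shows "\<exists>a\<in>\<O>. \<sigma> a \<noteq> a \<and> \<not> p dvd element_index K a"
proof -
  define q where "q = int p"
  have q: "prime q" "q \<ge> 5" using p by (auto simp: q_def)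
  have unram: ?thesis if "a \<in> \<O>" "\<not> q dvd N (a - \<sigma> a)" "\<not> q dvd N (a - \<sigma>2 a)" for a
    using index_not_dvd_N[OF that(1) p(1)] not_dvd_N_D[OF q(1) that] that(1) by (auto simp: q_def)
  show ?thesis
  proof (cases "\<forall>x\<in>\<O>. q dvd N x \<longrightarrow> nilp q x")
    case False
    then obtain x where x: "x \<in> \<O>" "q dvd N x" "\<not> nilp q x" by blast
    obtain e where e: "e \<in> \<O>" "idvd q (e * e - e)" "\<not> idvd q e" "idvd q (nm e)"
      using idempotent_power[OF q(1) x] .
    obtain f where f: "f \<in> \<O>" "\<not> idvd q f" "idvd q (f * f - f)"
      "idvd q (f * \<sigma> f)" "idvd q (f * \<sigma>2 f)"
      using orthogonal_idempotent[OF e] .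
    show ?thesis using split_case[OF q f] unram by blast
  next
    case nil: True
    show ?thesis
    proof (cases "\<forall>x\<in>\<O>. nilp q (\<sigma> x - x)")
      case True
      then obtain a where a: "a \<in> \<O>" "nilp q a" "\<not> q ^ 2 dvd N a"
        using ramified_case[OF q(1)] nil by blast
      have "\<sigma> a \<noteq> a"
      proof
        assume "\<sigma> a = a"
        then obtain m where m: "a = of_int m" using O_fixed_int[OF a(1)] by (auto elim: Ints_cases)
        then have "q dvd m" using nilp_int q a by blast
        then have "q ^ 2 dvd N a" unfolding m N_of_int
          by (meson dvd_power_same dvd_trans le_imp_power_dvd numeral_le_iff semiring_norm)
        then show False using a(3) by blast
      qed
      moreover have "\<not> p dvd element_index K a"
        by (rule index_not_dvd[OF a(1) calculation p(1)])
          (rule eisenstein_case[OF q(1) a], auto simp: q_def)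
      ultimately show ?thesis using a(1) by blast
    next
      case False
      then obtain x where x: "x \<in> \<O>" "\<not> nilp q (\<sigma> x - x)" by blast
      have xK: "x \<in> K" using O_K x by blast
      have 2: "\<not> nilp q (\<sigma>2 x - x)"
      proof
        assume h: "nilp q (\<sigma>2 x - x)"
        define y where "y = \<sigma>2 x - x"
        have y: "y \<in> \<O>" "nilp q y" unfolding y_def using h by (auto intro: O_intros x)
        have "\<sigma> x - x = y + \<sigma>2 y + \<sigma>4 y"
          unfolding y_def using xK by (simp add: \<sigma>_simps K_intros)
        also have "nilp q \<dots>" by (intro nilp_add nilp_\<sigma> O_intros y)
        finally show False using x by blast
      qed
      have "\<not> q dvd N (\<sigma> x - x)" "\<not> q dvd N (\<sigma>2 x - x)"
        using nil x 2 by (auto intro: O_intros)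
      moreover have "N (x - \<sigma> x) = - N (\<sigma> x - x)" "N (x - \<sigma>2 x) = - N (\<sigma>2 x - x)"
        using N_uminus[of "\<sigma> x - x"] N_uminus[of "\<sigma>2 x - x"] x(1) by (simp_all add: O_intros)
      ultimately show ?thesis using unram[OF x(1)] by simp
    qed
  qed
qed

end

section \<open>Cyclic quintic fields from roots of a polynomial\<close>

interpretation of_rat_poly_hom: map_poly_comm_ring_hom "of_rat :: rat \<Rightarrow> complex" ..

lemma clear_denominators:
  fixes p :: "rat poly"
  obtains d :: int and q :: "int poly" where "d \<noteq> 0" "smult (of_int d) p = map_poly of_int q"
proof -
  have "\<exists>d :: int. \<exists>q :: int poly. d \<noteq> 0 \<and> smult (of_int d) p = map_poly of_int q"
  proof (induction p)
    case 0
    show ?case by (intro exI[of _ 1] exI[of _ 0]) auto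
  next
    case (pCons a p)
    then obtain d :: int and q :: "int poly" where d: "d \<noteq> 0" "smult (of_int d) p = map_poly of_int q" by blast
    obtain m n where mn: "quotient_of a = (m, n)" by fastforce
    have a: "a = of_int m / of_int n" "n \<noteq> 0"
      using mn quotient_of_div[OF mn] quotient_of_denom_pos[OF mn] by auto
    have "smult (of_int (d * n)) (pCons a p) = pCons (of_int (d * m)) (smult (of_int n) (smult (of_int d) p))"
      using a by (simp add: mult_ac)
    also have "\<dots> = map_poly of_int (pCons (d * m) (smult n q))"
      unfolding d(2) by (intro poly_eqI) (simp add: coeff_map_poly coeff_pCons split: nat.split)
    finally show ?case using d a by (intro exI[of _ "d * n"] exI) auto
  qed
  then show ?thesis using that by blast
qed

text \<open>Gauss's lemma: a monic integer polynomial without nontrivial integral factorization is irreducible over \<open>\<rat>\<close>.\<close>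

lemma irreducible_map_of_int:
  fixes F :: "int poly"
  assumes monic: "lead_coeff F = 1" and deg: "degree F > 0"
    and fac: "\<And>A B. F = A * B \<Longrightarrow> degree A = 0 \<or> degree B = 0"
  shows "irreducible (map_poly of_int F :: rat poly)"
proof (rule irreducibleI)
  have dF: "degree (map_poly of_int F :: rat poly) = degree F" by (rule degree_map_poly) auto
  show "map_poly of_int F \<noteq> (0 :: rat poly)" using dF deg by auto
  show "\<not> map_poly of_int F dvd (1 :: rat poly)" using dF deg by (metis is_unit_iff_degree not_gr0 degree_0)
  fix g h :: "rat poly" assume eq: "map_poly of_int F = g * h"
  have nz: "g \<noteq> 0" "h \<noteq> 0" using eq dF deg by auto
  obtain d G where d: "d \<noteq> 0" "smult (of_int d) g = map_poly of_int (G :: int poly)"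
    using clear_denominators .
  obtain e H where e: "e \<noteq> 0" "smult (of_int e) h = map_poly of_int (H :: int poly)"
    using clear_denominators .
  have "map_poly of_int (smult (d * e) F) = smult (of_int d * of_int e) (g * h)"
    unfolding eq[symmetric] by (intro poly_eqI) (simp add: coeff_map_poly)
  also have "\<dots> = smult (of_int d) g * smult (of_int e) h" by (simp add: mult_ac)
  also have "\<dots> = map_poly of_int (G * H)" by (simp add: d e of_int_poly_hom.hom_mult)
  finally have "smult (d * e) F = G * H"
    by (subst (asm) poly_eq_iff, subst poly_eq_iff) (simp add: coeff_map_poly flip: of_int_mult)
  then have pp: "primitive_part (smult (d * e) F) = primitive_part G * primitive_part H"
    by (simp add: primitive_part_mult)
  have cF: "Polynomial.content F = 1"
  proof -
    have "Polynomial.content F dvd lead_coeff F" by (rule content_dvd_coeff)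
    then show ?thesis using monic by (metis is_unit_content_iff dvd_refl)
  qed
  have "primitive_part (smult (d * e) F) = smult (unit_factor (d * e)) (primitive_part F)"
    by (rule primitive_part_smult)
  also have "primitive_part F = F" using content_times_primitive_part[of F] cF by simp
  finally have pp2: "smult (unit_factor (d * e)) F = primitive_part G * primitive_part H" using pp by simp
  have u: "unit_factor (d * e) * unit_factor (d * e) = 1" using d(1) e(1) by (auto simp: sgn_mult sgn_if)
  have "F = smult (unit_factor (d * e)) (smult (unit_factor (d * e)) F)" using u by simp
  also have "\<dots> = smult (unit_factor (d * e)) (primitive_part G) * primitive_part H"
    unfolding pp2 by simp
  finally have "degree (smult (unit_factor (d * e)) (primitive_part G)) = 0 \<or> degree (primitive_part H) = 0"
    by (rule fac)
  then have "degree G = 0 \<or> degree H = 0" using d(1) e(1) by (auto simp: sgn_if split: if_splits)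
  moreover have "degree g = degree (map_poly of_int G :: rat poly)" "degree h = degree (map_poly of_int H :: rat poly)"
    using d e by (metis degree_smult_eq of_int_eq_0_iff)+
  moreover have "degree (map_poly of_int P :: rat poly) = degree P" for P :: "int poly"
    by (rule degree_map_poly) auto
  ultimately show "g dvd 1 \<or> h dvd 1" using nz is_unit_iff_degree by metis
qed

text \<open>The Lecacheux polynomial with integer coefficients.\<close>

definition lecacheux_int :: "int \<Rightarrow> int poly"
  where "lecacheux_int s =
    [: s^5,
       - (s^2 * (s^7 + 2 * s^6 + 3 * s^5 + 5 * s^4 + 5 * s^3 + 2 * s^2 - s + 1)),
       s^10 + 2 * s^9 + 4 * s^8 + 6 * s^7 + 10 * s^6 + 9 * s^5 + 4 * s^4 - 2 * s^3 + 2 * s^2 - 1,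
       - (s^9) - 2 * s^8 - 3 * s^7 - 5 * s^6 - 6 * s^5 - 2 * s^4 + s^3 - s^2 + 3,
       s^5 - 3,
       1 :]"

lemma map_poly_lecacheux_int: "map_poly of_int (lecacheux_int s) = lecacheux_poly (of_int s)"
  by (simp add: lecacheux_int_def lecacheux_poly_def map_poly_pCons)

lemma irreducible_lecacheux_poly:
  assumes s: "odd s"
  shows "irreducible (lecacheux_poly (of_int s))"
  unfolding map_poly_lecacheux_int[symmetric]
proof (rule irreducible_map_of_int)
  show lc: "lead_coeff (lecacheux_int s) = 1" by (simp add: lecacheux_int_def)
  have d5: "degree (lecacheux_int s) = 5" by (simp add: lecacheux_int_def)
  then show "degree (lecacheux_int s) > 0" by simp
  \<comment> \<open>Modulo 2 the polynomial is \<open>X\<^sup>5 + X\<^sup>2 + 1\<close>, which has no factor of degree 1 or 2.\<close>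
  have key: False if F: "lecacheux_int s = A * B" "degree A = 1 \<or> degree A = 2" for A B
  proof -
    have nz: "A \<noteq> 0" "B \<noteq> 0" using F(1) d5 by auto
    then have dAB: "degree A + degree B = 5" using d5 F(1) degree_mult_eq by metis
    define a where "a = coeff A"
    define b where "b = coeff B"
    have van: "\<And>i. i > degree A \<Longrightarrow> a i = 0" "\<And>i. i > degree B \<Longrightarrow> b i = 0"
      by (simp_all add: a_def b_def coeff_eq_0)
    have c: "coeff (lecacheux_int s) n = (\<Sum>i\<le>n. a i * b (n - i))" for n
      unfolding F(1) a_def b_def by (rule coeff_mult)
    have pe: "odd (coeff (lecacheux_int s) 0)" "even (coeff (lecacheux_int s) 1)"
      "odd (coeff (lecacheux_int s) 2)" "even (coeff (lecacheux_int s) 3)"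
      "even (coeff (lecacheux_int s) 4)" "odd (coeff (lecacheux_int s) 5)"
      using s by (simp_all add: lecacheux_int_def numeral_eq_Suc)
    have e: "odd (a 0 * b 0)" "even (a 0 * b 1 + a 1 * b 0)"
      "odd (a 0 * b 2 + a 1 * b 1 + a 2 * b 0)"
      "even (a 0 * b 3 + a 1 * b 2 + a 2 * b 1 + a 3 * b 0)"
      "even (a 0 * b 4 + a 1 * b 3 + a 2 * b 2 + a 3 * b 1 + a 4 * b 0)"
      "odd (a 0 * b 5 + a 1 * b 4 + a 2 * b 3 + a 3 * b 2 + a 4 * b 1 + a 5 * b 0)"
      using pe unfolding c by (simp_all add: eval_nat_numeral)
    show False
    proof (cases "degree A = 1")
      case True
      then have "a 2 = 0" "a 3 = 0" "a 4 = 0" "a 5 = 0" "b 5 = 0" using van dAB by auto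
      then show False using e by auto
    next
      case False
      then have "a 3 = 0" "a 4 = 0" "a 5 = 0" "b 4 = 0" "b 5 = 0" using van dAB F(2) by auto
      then show False using e by auto
    qed
  qed
  fix A B assume F: "lecacheux_int s = A * B"
  show "degree A = 0 \<or> degree B = 0"
  proof (rule ccontr)
    assume n: "\<not> ?thesis"
    have "degree A + degree B = 5" using d5 F degree_mult_eq by (metis degree_0 mult_eq_0_iff numeral_eq_Suc zero_neq_numeral)
    then consider "degree A = 1 \<or> degree A = 2" | "degree B = 1 \<or> degree B = 2" using n by linarith
    then show False using key[of A B] key[of B A] F by cases (auto simp: mult.commute)
  qed
qed

abbreviation rpoly :: "rat poly \<Rightarrow> complex \<Rightarrow> complex"
  where "rpoly h x \<equiv> poly (map_poly of_rat h) x"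

lemma rpoly_simps [simp]:
  "rpoly (g + h) x = rpoly g x + rpoly h x"
  "rpoly (g * h) x = rpoly g x * rpoly h x"
  "rpoly (- g) x = - rpoly g x" "rpoly (g - h) x = rpoly g x - rpoly h x"
  "rpoly 1 x = 1" "rpoly 0 x = 0"
  "rpoly [:0, 1:] x = x"
  by (simp_all add: of_rat_poly_hom.hom_add of_rat_poly_hom.hom_mult of_rat_poly_hom.hom_uminus
    of_rat_poly_hom.hom_minus map_poly_pCons)

lemma rpoly_pCons [simp]: "rpoly (pCons c h) x = of_rat c + x * rpoly h x"
  by (cases "c = 0 \<and> h = 0") (auto simp: map_poly_pCons)

lemma rpoly_smult [simp]: "rpoly (smult c h) x = of_rat c * rpoly h x"
  by (induction h) (simp_all add: of_rat_mult algebra_simps)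

lemma irreducible_root_dvd:
  assumes irr: "irreducible f" and root: "rpoly f x = 0" and h: "rpoly h x = 0"
  shows "f dvd h"
proof (rule ccontr)
  assume "\<not> f dvd h"
  then have "coprime f h" using irr by (metis irreducible_imp_prime_elem prime_elem_imp_coprime)
  then obtain u v where "u * f + v * h = 1"
    by (metis bezout_coefficients_fst_snd coprime_imp_gcd_eq_1)
  then have "rpoly (u * f + v * h) x = 1" by simp
  then show False using root h by simp
qed

lemma rat_adjoin_irreducible:
  assumes irr: "irreducible f" and root: "rpoly f x = 0"
  shows "rat_adjoin x = range (\<lambda>h. rpoly h x)"
proof
  show "rat_adjoin x \<subseteq> range (\<lambda>h. rpoly h x)"
  proof (rule rat_adjoin_subset)
    show "x \<in> range (\<lambda>h. rpoly h x)" by (rule range_eqI[of _ _ "[:0, 1:]"]) simp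
    show "1 \<in> range (\<lambda>h. rpoly h x)" by (rule range_eqI[of _ _ 1]) simp
    fix y assume "y \<in> range (\<lambda>h. rpoly h x)"
    then obtain g where g: "y = rpoly g x" by blast
    show "- y \<in> range (\<lambda>h. rpoly h x)" by (rule range_eqI[of _ _ "- g"]) (simp add: g)
    show "inverse y \<in> range (\<lambda>h. rpoly h x)"
    proof (cases "y = 0")
      case True
      then show ?thesis by (intro range_eqI[of _ _ 0]) simp
    next
      case False
      then have "\<not> f dvd g" using g root by (auto elim!: dvdE)
      then have "coprime f g" using irr by (metis irreducible_imp_prime_elem prime_elem_imp_coprime)
      then obtain u v where "u * f + v * g = 1"
        by (metis bezout_coefficients_fst_snd coprime_imp_gcd_eq_1)
      then have "rpoly (u * f + v * g) x = 1" by simp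
      then have "rpoly v x * y = 1" using root g by simp
      then have "inverse y = rpoly v x" using False by (metis inverse_unique mult.commute)
      then show ?thesis by blast
    qed
    fix z assume "z \<in> range (\<lambda>h. rpoly h x)"
    then obtain h where h: "z = rpoly h x" by blast
    show "y + z \<in> range (\<lambda>h. rpoly h x)" by (rule range_eqI[of _ _ "g + h"]) (simp add: g h)
    show "y * z \<in> range (\<lambda>h. rpoly h x)" by (rule range_eqI[of _ _ "g * h"]) (simp add: g h)
  qed
  show "range (\<lambda>h. rpoly h x) \<subseteq> rat_adjoin x"
  proof clarify
    fix h
    show "rpoly h x \<in> rat_adjoin x"
      by (induction h) (auto simp: map_poly_pCons intro: rat_adjoin_zero rat_adjoin_add rat_adjoin_mult
          rat_adjoin_of_rat rat_adjoin_self)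
  qed
qed

text \<open>The homomorphism from \<open>\<rat>(x)\<close> to \<open>\<rat>(x')\<close> that maps \<open>x\<close> to \<open>x'\<close>. It is well defined if \<open>x\<close> and \<open>x'\<close> are roots
  of the same irreducible polynomial.\<close>

definition conj_map :: "complex \<Rightarrow> complex \<Rightarrow> complex \<Rightarrow> complex"
  where "conj_map x x' y = rpoly (SOME h. rpoly h x = y) x'"

lemma conj_map_rpoly:
  assumes "irreducible f" "rpoly f x = 0" "rpoly f x' = 0"
  shows "conj_map x x' (rpoly h x) = rpoly h x'"
proof -
  define g where "g = (SOME g. rpoly g x = rpoly h x)"
  have "rpoly g x = rpoly h x" unfolding g_def by (rule someI) simp
  then have "rpoly (g + - h) x = 0" by (simp only: rpoly_simps) simp
  then have "f dvd g + - h" using irreducible_root_dvd assms by blast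
  then obtain k where "g + - h = f * k" by (elim dvdE)
  then have "rpoly (g + - h) x' = rpoly f x' * rpoly k x'" by (simp only: rpoly_simps)
  then have "rpoly (g + - h) x' = 0" using assms(3) by simp
  then have "rpoly g x' = rpoly h x'" by (simp only: rpoly_simps) simp
  then show ?thesis by (simp add: conj_map_def g_def)
qed

theorem cyclic_quintic_conj_map:
  assumes irr: "irreducible f" and deg: "degree f = 5"
    and x: "rpoly f x = 0" "algebraic_int x"
    and x': "rpoly f x' = 0" "x' \<in> rat_adjoin x" "x' \<noteq> x"
    and cyc: "conj_map x x' (conj_map x x' (conj_map x x' (conj_map x x' x'))) = x"
  shows "cyclic_quintic (rat_adjoin x) (conj_map x x')"
proof -
  let ?K = "rat_adjoin x" and ?\<sigma> = "conj_map x x'"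
  note K = rat_adjoin_irreducible[OF irr x(1)]
  note \<sigma> = conj_map_rpoly[OF irr x(1) x'(1)]
  have ex: "\<exists>h. y = rpoly h x" if "y \<in> ?K" for y
  proof -
    have "y \<in> range (\<lambda>h. rpoly h x)" using that K by simp
    then show ?thesis by (rule rangeE) (rule exI)
  qed
  have mem: "?\<sigma> y \<in> ?K" if yK: "y \<in> ?K" for y
  proof -
    obtain h where "y = rpoly h x" using ex[OF yK] by (rule exE)
    then have "?\<sigma> y = rpoly h x'" using \<sigma> by simp
    also have "\<dots> \<in> ?K"
      by (induction h) (auto simp: map_poly_pCons intro: rat_adjoin_zero rat_adjoin_add rat_adjoin_mult
          rat_adjoin_of_rat x')
    finally show ?thesis .
  qed
  have add: "?\<sigma> (y + z) = ?\<sigma> y + ?\<sigma> z" and mult: "?\<sigma> (y * z) = ?\<sigma> y * ?\<sigma> z" if yzK: "y \<in> ?K" "z \<in> ?K" for y z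
  proof -
    obtain g where "y = rpoly g x" using ex[OF yzK(1)] by (rule exE)
    moreover obtain h where "z = rpoly h x" using ex[OF yzK(2)] by (rule exE)
    ultimately show "?\<sigma> (y + z) = ?\<sigma> y + ?\<sigma> z" "?\<sigma> (y * z) = ?\<sigma> y * ?\<sigma> z"
      using \<sigma>[of g] \<sigma>[of h] \<sigma>[of "g + h"] \<sigma>[of "g * h"] by simp_all
  qed
  have rat: "?\<sigma> (of_rat c) = of_rat c" for c using \<sigma>[of "[:c:]"] by simp
  have \<sigma>x: "?\<sigma> x = x'" using \<sigma>[of "[:0,1:]"] by simp
  have poly: "?\<sigma> (rpoly h y) = rpoly h (?\<sigma> y)" "rpoly h y \<in> ?K" if y: "y \<in> ?K" for h y
  proof -
    have "?\<sigma> (rpoly h y) = rpoly h (?\<sigma> y) \<and> rpoly h y \<in> ?K"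
    proof (induction h)
      case (pCons c h)
      then show ?case using add[of "of_rat c" "y * rpoly h y"] mult[of y "rpoly h y"] rat[of c] y
        by (auto simp: map_poly_pCons intro!: rat_adjoin_add rat_adjoin_mult rat_adjoin_of_rat)
    qed (use rat[of 0] in \<open>auto intro: rat_adjoin_zero\<close>)
    then show "?\<sigma> (rpoly h y) = rpoly h (?\<sigma> y)" "rpoly h y \<in> ?K" by auto
  qed
  have five: "?\<sigma> (?\<sigma> (?\<sigma> (?\<sigma> (?\<sigma> y)))) = y" if yK: "y \<in> ?K" for y
  proof -
    obtain h where h: "y = rpoly h x" using ex[OF yK] by (rule exE)
    show ?thesis unfolding h using mem rat_adjoin_self[of x] x'(2) \<sigma>x cyc by (simp add: poly(1))
  qed
  define x1 where "x1 = ?\<sigma> x"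
  define x2 where "x2 = ?\<sigma> x1"
  define x3 where "x3 = ?\<sigma> x2"
  define x4 where "x4 = ?\<sigma> x3"
  have xK: "x \<in> ?K" by (rule rat_adjoin_self)
  have xs: "?\<sigma> x = x1" "?\<sigma> x1 = x2" "?\<sigma> x2 = x3" "?\<sigma> x3 = x4" "?\<sigma> x4 = x"
    using five[OF xK] by (simp_all add: x1_def x2_def x3_def x4_def)
  have dist: "x \<noteq> x1" "x \<noteq> x2" "x \<noteq> x3" "x \<noteq> x4" "x1 \<noteq> x2" "x1 \<noteq> x3" "x1 \<noteq> x4"
    "x2 \<noteq> x3" "x2 \<noteq> x4" "x3 \<noteq> x4"
    using x'(3) \<sigma>x xs by metis+
  have xsK: "x1 \<in> ?K" "x2 \<in> ?K" "x3 \<in> ?K" "x4 \<in> ?K"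
    unfolding x1_def x2_def x3_def x4_def by (intro mem xK)+
  show ?thesis
  proof
    fix y assume y: "y \<in> ?K" "?\<sigma> y = y"
    obtain h where h: "y = rpoly h x" using ex[OF y(1)] by (rule exE)
    define g where "g = h mod f"
    have g: "rpoly g x = y"
    proof -
      have "rpoly (h div f * f + g) x = y" unfolding g_def by (simp add: h)
      then show ?thesis using x(1) by simp
    qed
    have "degree g < 5" using degree_mod_less'[of f h] deg unfolding g_def
      by (metis degree_0 degree_mod_less zero_less_numeral zero_neq_numeral)
    define q where "q = map_poly of_rat g - [:y:]"
    have "degree q < 5" unfolding q_def
      using \<open>degree g < 5\<close> degree_map_poly_le[of "of_rat :: rat \<Rightarrow> complex" g]
      by (intro degree_diff_less) auto
    have roots: "poly q x = 0" "poly q x1 = 0" "poly q x2 = 0" "poly q x3 = 0" "poly q x4 = 0"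
      using g poly(1)[OF xK, of g] poly(1)[OF xsK(1), of g] poly(1)[OF xsK(2), of g]
        poly(1)[OF xsK(3), of g] xs y(2) by (simp_all add: q_def)
    have "q = 0"
    proof (rule ccontr)
      assume q: "q \<noteq> 0"
      have "card {x, x1, x2, x3, x4} \<le> card {t. poly q t = 0}"
        by (rule card_mono) (use q roots poly_roots_finite in auto)
      also have "\<dots> \<le> degree q" using card_poly_roots_bound[OF q] .
      finally show False using dist \<open>degree q < 5\<close> by simp
    qed
    then have "y = coeff (map_poly of_rat g) 0" unfolding q_def by (metis coeff_pCons_0 eq_iff_diff_eq_0)
    then show "y \<in> \<rat>" by (simp add: coeff_map_poly)
  next
    show "\<exists>a\<in>ring_of_integers ?K. ?\<sigma> a \<noteq> a"
      using x(2) xK \<sigma>x x'(3) by (intro bexI[of _ x]) (auto simp: ring_of_integers_def)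
    show "?\<sigma> 1 = 1" using rat[of 1] by simp
  qed (use mem add mult five in \<open>auto intro: rat_adjoin_one rat_adjoin_uminus rat_adjoin_add rat_adjoin_mult rat_adjoin_inverse\<close>)
qed

context cyclic_quintic
begin

lemma \<sigma>_int_poly:
  assumes x: "x \<in> K"
  shows "\<sigma> (poly (map_poly of_int p) x) = poly (map_poly of_int p) (\<sigma> x)"
proof -
  have ev: "poly (map_poly of_int p) y = (\<Sum>i\<le>degree p. of_int (coeff p i) * y ^ i)" for y :: complex
    by (simp add: poly_altdef degree_map_poly coeff_map_poly)
  show ?thesis unfolding ev using x by (simp add: \<sigma>_sum \<sigma>_mult \<sigma>_power mult_K power_K)
qed

lemma monic_int_poly_eq_prod:
  fixes p :: "int poly"
  assumes x: "x \<in> K" "\<sigma> x \<noteq> x" and p: "degree p = 5" "coeff p 5 = 1" "poly (map_poly of_int p) x = 0"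
  shows "map_poly of_int p = [:-x, 1:] * ([:- \<sigma> x, 1:] * [:- \<sigma>2 x, 1:]
    * [:- \<sigma>3 x, 1:] * [:- \<sigma>4 x, 1:])" (is "?p = ?r")
proof -
  define x1 where "x1 = \<sigma> x"
  define x2 where "x2 = \<sigma> x1"
  define x3 where "x3 = \<sigma> x2"
  define x4 where "x4 = \<sigma> x3"
  have xs: "\<sigma> x = x1" "\<sigma> x1 = x2" "\<sigma> x2 = x3" "\<sigma> x3 = x4" "\<sigma> x4 = x"
    using \<sigma>_5[OF x(1)] by (simp_all add: x1_def x2_def x3_def x4_def)
  have K: "x1 \<in> K" "x2 \<in> K" "x3 \<in> K" "x4 \<in> K"
    unfolding x1_def x2_def x3_def x4_def by (intro \<sigma>_K x)+
  have dist: "x \<noteq> x1" "x \<noteq> x2" "x \<noteq> x3" "x \<noteq> x4" "x1 \<noteq> x2" "x1 \<noteq> x3" "x1 \<noteq> x4"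
    "x2 \<noteq> x3" "x2 \<noteq> x4" "x3 \<noteq> x4"
    using x(2) xs by metis+
  have roots: "poly ?p x = 0" "poly ?p x1 = 0" "poly ?p x2 = 0" "poly ?p x3 = 0" "poly ?p x4 = 0"
    using p(3) \<sigma>_int_poly[OF x(1), of p] \<sigma>_int_poly[OF K(1), of p] \<sigma>_int_poly[OF K(2), of p]
      \<sigma>_int_poly[OF K(3), of p] xs by simp_all
  define r where "r = ?r"
  have rr: "poly r x = 0" "poly r x1 = 0" "poly r x2 = 0" "poly r x3 = 0" "poly r x4 = 0"
    unfolding r_def poly_mult by (simp_all add: xs)
  have dr: "degree r = 5" "coeff r 5 = 1" unfolding r_def by (simp_all add: numeral_eq_Suc)
  have "?p - r = 0"
  proof (rule ccontr)
    assume q: "?p - r \<noteq> 0"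
    have dp: "degree (?p :: complex poly) = 5" using p(1) by (simp add: degree_map_poly)
    have "degree (?p - r) \<le> 5" using dp dr degree_diff_le[of ?p 5 r] by simp
    moreover have "coeff (?p - r) 5 = 0"
      unfolding coeff_diff dr(2) using p(2) by (simp add: coeff_map_poly)
    ultimately have "degree (?p - r) < 5"
      using q by (metis le_neq_implies_less leading_coeff_0_iff)
    moreover have "card {x, x1, x2, x3, x4} \<le> card {t. poly (?p - r) t = 0}"
      by (rule card_mono) (use poly_roots_finite[OF q] roots rr in auto)
    moreover have "card {t. poly (?p - r) t = 0} \<le> degree (?p - r)" using card_poly_roots_bound[OF q] .
    ultimately show False using dist by simp
  qed
  then show ?thesis by (simp add: r_def)
qed

lemma N_monic_int_poly:
  fixes p :: "int poly"
  assumes x: "x \<in> \<O>" "\<sigma> x \<noteq> x" and p: "degree p = 5" "coeff p 5 = 1" "poly (map_poly of_int p) x = 0"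
  shows "N x = - coeff p 0"
proof -
  have "poly (map_poly of_int p) 0 = - nm x"
    unfolding monic_int_poly_eq_prod[OF O_K[OF x(1)] x(2) p] nm_def by simp
  then have "of_int (N x) = (of_int (- coeff p 0) :: complex)"
    using of_int_N[OF x(1)] by (simp add: poly_0_coeff_0 coeff_map_poly)
  then show ?thesis by (simp only: of_int_eq_iff)
qed

lemma D_monic_int_poly:
  fixes p :: "int poly"
  assumes x: "x \<in> K" "\<sigma> x \<noteq> x" and p: "degree p = 5" "coeff p 5 = 1" "poly (map_poly of_int p) x = 0"
  shows "D x = poly (pderiv (map_poly of_int p)) x"
  unfolding monic_int_poly_eq_prod[OF x p] D_def
  by (subst pderiv_mult, unfold poly_add poly_mult) (simp add: pderiv_pCons)

end

section \<open>The conjugates of a root of the Lecacheux polynomial\<close>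

text \<open>The value at \<open>x\<close> of the Lecacheux polynomial with parameter \<open>s\<close>.\<close>

definition lecacheux_val :: "complex \<Rightarrow> complex \<Rightarrow> complex"
  where "lecacheux_val s x = x^5 + (s^5 - 3) * x^4
    + (3 - s^2 + s^3 - 2 * s^4 - 6 * s^5 - 5 * s^6 - 3 * s^7 - 2 * s^8 - s^9) * x^3
    + (s^10 + 2 * s^9 + 4 * s^8 + 6 * s^7 + 10 * s^6 + 9 * s^5 + 4 * s^4 - 2 * s^3 + 2 * s^2 - 1) * x^2
    - (s^2 * (s^7 + 2 * s^6 + 3 * s^5 + 5 * s^4 + 5 * s^3 + 2 * s^2 - s + 1)) * x + s^5"

text \<open>The relation between a root \<open>a\<close> and the next root \<open>b\<close> in the cyclic order. It is linear in \<open>b\<close>, so it expresses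
  \<open>b\<close> as a quotient of polynomials of degree at most 2 in \<open>a\<close>.\<close>

definition lecacheux_rel :: "complex \<Rightarrow> complex \<Rightarrow> complex \<Rightarrow> complex"
  where "lecacheux_rel s a b = a^2 + (s + 1) * a * b - (s^2 + s + 1) * b
    - (s^4 + s^3 + s^2 + s + 2) * a + (s^3 + s^2 + s + 1)"

lemma lecacheux_rel_frac:
  assumes "d \<noteq> 0" "e \<noteq> 0"
    and num: "n^2 * e + (s + 1) * n * d * m - (s^2 + s + 1) * m * d^2
    - (s^4 + s^3 + s^2 + s + 2) * n * d * e + (s^3 + s^2 + s + 1) * d^2 * e = 0"
  shows "lecacheux_rel s (n / d) (m / e) = 0"
proof -
  define x y where "x = n / d" and "y = m / e"
  have nm: "n = x * d" "m = y * e" using assms by (simp_all add: x_def y_def)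
  have "lecacheux_rel s x y * (d^2 * e) = n^2 * e + (s + 1) * n * d * m - (s^2 + s + 1) * m * d^2
    - (s^4 + s^3 + s^2 + s + 2) * n * d * e + (s^3 + s^2 + s + 1) * d^2 * e"
    unfolding nm lecacheux_rel_def by (simp add: algebra_simps power2_eq_square)
  then show ?thesis using num assms by (simp add: x_def y_def)
qed

text \<open>Polynomial identities in two variables \<open>s\<close> and \<open>t\<close> are checked in \<open>\<int>[s][t]\<close>, where they are equalities of
  explicit lists of coefficients, and then evaluated.\<close>

definition eval2 :: "int poly poly \<Rightarrow> complex \<Rightarrow> complex \<Rightarrow> complex"
  where "eval2 P s t = poly (map_poly (\<lambda>c. poly (map_poly of_int c) s) P) t"

lemma eval2_hom:
  "eval2 (P + Q) s t = eval2 P s t + eval2 Q s t"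
  "eval2 (P - Q) s t = eval2 P s t - eval2 Q s t"
  "eval2 (P * Q) s t = eval2 P s t * eval2 Q s t"
  "eval2 (P ^ n) s t = eval2 P s t ^ n"
proof -
  interpret h: comm_ring_hom "\<lambda>c::int poly. poly (map_poly of_int c) s"
    by unfold_locales (simp_all add: of_int_poly_hom.hom_add of_int_poly_hom.hom_mult)
  interpret map_poly_comm_ring_hom "\<lambda>c::int poly. poly (map_poly of_int c) s" ..
  show "eval2 (P + Q) s t = eval2 P s t + eval2 Q s t"
    "eval2 (P - Q) s t = eval2 P s t - eval2 Q s t"
    "eval2 (P * Q) s t = eval2 P s t * eval2 Q s t"
    "eval2 (P ^ n) s t = eval2 P s t ^ n"
    by (simp_all add: eval2_def hom_add hom_minus hom_mult hom_power)
qed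

lemma poly_of_int_pCons:
  "poly (map_poly of_int (pCons c p)) (s::complex) = of_int c + s * poly (map_poly of_int p) s"
  by (cases "c = 0 \<and> p = 0") (auto simp: map_poly_pCons)

lemma eval2_pCons:
  "eval2 (pCons c P) s t = poly (map_poly of_int c) s + t * eval2 P s t" "eval2 0 s t = 0"
  by (cases "c = 0 \<and> P = 0"; auto simp: eval2_def map_poly_pCons) (simp add: eval2_def)

lemmas eval2_simps = eval2_pCons poly_of_int_pCons

text \<open>The Lecacheux polynomial as an element of \<open>\<int>[s][t]\<close>.\<close>

definition lecacheux_poly2 :: "int poly poly"
  where "lecacheux_poly2 = [: [:0, 0, 0, 0, 0, 1:], [:0, 0, -1, 1, -2, -5, -5, -3, -2, -1:],
    [:-1, 0, 2, -2, 4, 9, 10, 6, 4, 2, 1:], [:3, 0, -1, 1, -2, -6, -5, -3, -2, -1:],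
    [:-3, 0, 0, 0, 0, 1:], [:1:] :]"

lemma eval2_lecacheux: "eval2 lecacheux_poly2 s t = lecacheux_val s t"
  by (simp add: lecacheux_poly2_def lecacheux_val_def eval2_simps algebra_simps eval_nat_numeral)

lemma eval2_lecacheux_consts:
  "eval2 [:[:1, 1:]:] s t = s + 1" "eval2 [:[:1, 1, 1:]:] s t = s^2 + s + 1"
  "eval2 [:[:2, 1, 1, 1, 1:]:] s t = s^4 + s^3 + s^2 + s + 2"
  "eval2 [:[:1, 1, 1, 1:]:] s t = s^3 + s^2 + s + 1"
  "eval2 [:[:2, 2, 1:]:] s t = s^2 + 2 * s + 2" "eval2 [:[:0, 1:]:] s t = s" "eval2 [:0, [:1:]:] s t = t"
  by (simp_all add: eval2_simps algebra_simps eval_nat_numeral)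

text \<open>With \<open>n/d\<close> the next root after \<open>t\<close>, this says that the expression for the previous root, that is the
  fourth root after \<open>n/d\<close>, gives back \<open>t\<close>.\<close>

lemma lecacheux_next_identity:
  fixes s t :: complex
  defines "n \<equiv> (s^4 + s^3 + s^2 + s + 2) * t - t^2 - (s^3 + s^2 + s + 1)"
    and "d \<equiv> (s + 1) * t - (s^2 + s + 1)"
  shows "(s + 1) * n^2 - (s^2 + 2 * s + 2) * n * d + (s^2 + s + 1) * d^2
    - t * (n^2 - (s^4 + s^3 + s^2 + s + 2) * n * d + (s^3 + s^2 + s + 1) * d^2) + lecacheux_val s t = 0"
proof -
  define P :: "int poly poly" where "P = [:[:-1, -1, -1, -1:], [:2, 1, 1, 1, 1:], [:-1:]:]"
  define Q :: "int poly poly" where "Q = [:[:-1, -1, -1:], [:1, 1:]:]"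
  have ev: "eval2 P s t = n" "eval2 Q s t = d"
    unfolding P_def Q_def n_def d_def
    by (simp_all add: eval2_simps algebra_simps eval_nat_numeral)
  have "[:[:1, 1:]:] * P^2 - [:[:2, 2, 1:]:] * P * Q + [:[:1, 1, 1:]:] * Q^2
      - [:0, [:1:]:] * (P^2 - [:[:2, 1, 1, 1, 1:]:] * P * Q + [:[:1, 1, 1, 1:]:] * Q^2) + lecacheux_poly2 = 0"
    unfolding P_def Q_def lecacheux_poly2_def eval_nat_numeral by simp
  from arg_cong[OF this, of "\<lambda>P. eval2 P s t"] show ?thesis
    unfolding eval2_hom ev eval2_lecacheux eval2_lecacheux_consts eval2_pCons(2) .
qed

text \<open>The quotient \<open>n/d\<close> is the root before \<open>x\<close>: the relation between them holds because \<open>x\<close> is a root of the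
  Lecacheux polynomial.\<close>

lemma lecacheux_last_identity:
  fixes s x :: complex
  defines "n \<equiv> (s + 1) * x^2 - (s^2 + 2 * s + 2) * x + (s^2 + s + 1)"
    and "d \<equiv> x^2 - (s^4 + s^3 + s^2 + s + 2) * x + (s^3 + s^2 + s + 1)"
  shows "n^2 + (s + 1) * n * d * x - (s^2 + s + 1) * x * d^2
    - (s^4 + s^3 + s^2 + s + 2) * n * d + (s^3 + s^2 + s + 1) * d^2 = s * lecacheux_val s x"
proof -
  define P :: "int poly poly" where "P = [:[:1, 1, 1:], [:-2, -2, -1:], [:1, 1:]:]"
  define Q :: "int poly poly" where "Q = [:[:1, 1, 1, 1:], [:-2, -1, -1, -1, -1:], [:1:]:]"
  have ev: "eval2 P s x = n" "eval2 Q s x = d"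
    unfolding P_def Q_def n_def d_def
    by (simp_all add: eval2_simps algebra_simps eval_nat_numeral)
  have "P^2 + [:[:1, 1:]:] * P * Q * [:0, [:1:]:] - [:[:1, 1, 1:]:] * [:0, [:1:]:] * Q^2
      - [:[:2, 1, 1, 1, 1:]:] * P * Q + [:[:1, 1, 1, 1:]:] * Q^2 - [:[:0, 1:]:] * lecacheux_poly2 = 0"
    unfolding P_def Q_def lecacheux_poly2_def eval_nat_numeral by simp
  from arg_cong[OF this, of "\<lambda>P. eval2 P s x"] show ?thesis
    unfolding eval2_hom ev eval2_lecacheux eval2_lecacheux_consts eval2_pCons(2) by (simp only: right_minus_eq)
qed

text \<open>The following three identities say that the consecutive conjugates \<open>\<theta>1, \<theta>2, \<theta>3, \<theta>4\<close> defined below satisfy the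
  relation.\<close>

lemma lecacheux_rel12:
  fixes s t :: complex
  defines "n \<equiv> (s^4 + s^3 + s^2 + s + 2) * t - t^2 - (s^3 + s^2 + s + 1)"
    and "d \<equiv> (s + 1) * t - (s^2 + s + 1)"
    and "m \<equiv> t^2 - (s^4 + s^3 + s^2 + 1) * t + s^3"
  shows "n^2 * (t * d) + (s + 1) * n * d * m - (s^2 + s + 1) * m * d^2
    - (s^4 + s^3 + s^2 + s + 2) * n * d * (t * d) + (s^3 + s^2 + s + 1) * d^2 * (t * d)
    = ((s + 1) * t - (s^2 + s + 1)) * lecacheux_val s t"
proof -
  define P :: "int poly poly" where "P = [:[:-1, -1, -1, -1:], [:2, 1, 1, 1, 1:], [:-1:]:]"
  define Q :: "int poly poly" where "Q = [:[:-1, -1, -1:], [:1, 1:]:]"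
  define P' :: "int poly poly" where "P' = [:[:0, 0, 0, 1:], [:-1, 0, -1, -1, -1:], [:1:]:]"
  have ev: "eval2 P s t = n" "eval2 Q s t = d" "eval2 P' s t = m"
    unfolding P_def Q_def P'_def n_def d_def m_def
    by (simp_all add: eval2_simps algebra_simps eval_nat_numeral)
  have "P^2 * ([:0, [:1:]:] * Q) + [:[:1, 1:]:] * P * Q * P' - [:[:1, 1, 1:]:] * P' * Q^2
      - [:[:2, 1, 1, 1, 1:]:] * P * Q * ([:0, [:1:]:] * Q) + [:[:1, 1, 1, 1:]:] * Q^2 * ([:0, [:1:]:] * Q) - Q * lecacheux_poly2 = 0"
    unfolding P_def Q_def P'_def lecacheux_poly2_def eval_nat_numeral by simp
  from arg_cong[OF this, of "\<lambda>P. eval2 P s t"] show ?thesis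
    unfolding eval2_hom ev eval2_lecacheux eval2_lecacheux_consts eval2_pCons(2) by (simp only: right_minus_eq d_def)
qed

lemma lecacheux_rel23:
  fixes s t :: complex
  defines "n \<equiv> t^2 - (s^4 + s^3 + s^2 + 1) * t + s^3"
    and "d \<equiv> t * ((s + 1) * t - (s^2 + s + 1))"
    and "m \<equiv> t^2 + (s^5 + s^4 + s^3 + s^2 - 1) * t - s^2 * (s^4 + s^3 + s^2 + 1)"
    and "e \<equiv> t^2 + (s^3 + s^2 - 1) * t - s^2"
  shows "n^2 * e + (s + 1) * n * d * m - (s^2 + s + 1) * m * d^2
    - (s^4 + s^3 + s^2 + s + 2) * n * d * e + (s^3 + s^2 + s + 1) * d^2 * e
    + (s^3 + (s + s^2 + s^3) * t) * lecacheux_val s t = 0"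
proof -
  define P :: "int poly poly" where "P = [:[:0, 0, 0, 1:], [:-1, 0, -1, -1, -1:], [:1:]:]"
  define Q :: "int poly poly" where "Q = [:0, [:-1, -1, -1:], [:1, 1:]:]"
  define P' :: "int poly poly" where "P' = [:[:0, 0, -1, 0, -1, -1, -1:], [:-1, 0, 1, 1, 1, 1:], [:1:]:]"
  define Q' :: "int poly poly" where "Q' = [:[:0, 0, -1:], [:-1, 0, 1, 1:], [:1:]:]"
  define U :: "int poly poly" where "U = [:[:0, 0, 0, 1:], [:0, 1, 1, 1:]:]"
  have ev: "eval2 P s t = n" "eval2 Q s t = d" "eval2 P' s t = m" "eval2 Q' s t = e" "eval2 U s t = s^3 + (s + s^2 + s^3) * t"
    unfolding P_def Q_def P'_def Q'_def U_def n_def d_def m_def e_def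
    by (simp_all add: eval2_simps algebra_simps eval_nat_numeral)
  have "P^2 * Q' + [:[:1, 1:]:] * P * Q * P' - [:[:1, 1, 1:]:] * P' * Q^2
      - [:[:2, 1, 1, 1, 1:]:] * P * Q * Q' + [:[:1, 1, 1, 1:]:] * Q^2 * Q' + U * lecacheux_poly2 = 0"
    unfolding P_def Q_def P'_def Q'_def U_def lecacheux_poly2_def eval_nat_numeral by simp
  from arg_cong[OF this, of "\<lambda>P. eval2 P s t"] show ?thesis
    unfolding eval2_hom ev eval2_lecacheux eval2_lecacheux_consts eval2_pCons(2) .
qed

lemma lecacheux_rel34:
  fixes s t :: complex
  defines "n \<equiv> t^2 + (s^5 + s^4 + s^3 + s^2 - 1) * t - s^2 * (s^4 + s^3 + s^2 + 1)"
    and "d \<equiv> t^2 + (s^3 + s^2 - 1) * t - s^2"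
    and "m \<equiv> (s + 1) * t^2 - (s^2 + 2 * s + 2) * t + (s^2 + s + 1)"
    and "e \<equiv> t^2 - (s^4 + s^3 + s^2 + s + 2) * t + (s^3 + s^2 + s + 1)"
  shows "n^2 * e + (s + 1) * n * d * m - (s^2 + s + 1) * m * d^2
    - (s^4 + s^3 + s^2 + s + 2) * n * d * e + (s^3 + s^2 + s + 1) * d^2 * e
    = (s^2 + s^3 + s^4 - s^5 - 2 * s^6 - s^7 - (s^2 + s^3 + s^4) * t) * lecacheux_val s t"
proof -
  define P :: "int poly poly" where "P = [:[:0, 0, -1, 0, -1, -1, -1:], [:-1, 0, 1, 1, 1, 1:], [:1:]:]"
  define Q :: "int poly poly" where "Q = [:[:0, 0, -1:], [:-1, 0, 1, 1:], [:1:]:]"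
  define P' :: "int poly poly" where "P' = [:[:1, 1, 1:], [:-2, -2, -1:], [:1, 1:]:]"
  define Q' :: "int poly poly" where "Q' = [:[:1, 1, 1, 1:], [:-2, -1, -1, -1, -1:], [:1:]:]"
  define U :: "int poly poly" where "U = [:[:0, 0, 1, 1, 1, -1, -2, -1:], [:0, 0, -1, -1, -1:]:]"
  have ev: "eval2 P s t = n" "eval2 Q s t = d" "eval2 P' s t = m" "eval2 Q' s t = e" "eval2 U s t = s^2 + s^3 + s^4 - s^5 - 2 * s^6 - s^7 - (s^2 + s^3 + s^4) * t"
    unfolding P_def Q_def P'_def Q'_def U_def n_def d_def m_def e_def
    by (simp_all add: eval2_simps algebra_simps eval_nat_numeral)
  have "P^2 * Q' + [:[:1, 1:]:] * P * Q * P' - [:[:1, 1, 1:]:] * P' * Q^2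
      - [:[:2, 1, 1, 1, 1:]:] * P * Q * Q' + [:[:1, 1, 1, 1:]:] * Q^2 * Q' - U * lecacheux_poly2 = 0"
    unfolding P_def Q_def P'_def Q'_def U_def lecacheux_poly2_def eval_nat_numeral by simp
  from arg_cong[OF this, of "\<lambda>P. eval2 P s t"] show ?thesis
    unfolding eval2_hom ev eval2_lecacheux eval2_lecacheux_consts eval2_pCons(2) by (simp only: right_minus_eq)
qed

lemma lecacheux_next_root:
  assumes ab: "lecacheux_rel s a b = 0" and a: "lecacheux_val s a = 0"
    and d: "(s + 1) * a - (s^2 + s + 1) \<noteq> 0" and s: "s \<noteq> 0"
  shows "lecacheux_val s b = 0"
proof -
  define n where "n = (s^4 + s^3 + s^2 + s + 2) * a - a^2 - (s^3 + s^2 + s + 1)"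
  define e where "e = (s + 1) * a - (s^2 + s + 1)"
  have "b * e - n = lecacheux_rel s a b" unfolding n_def e_def lecacheux_rel_def by (simp add: algebra_simps)
  then have be: "n = b * e" using ab by simp
  define u where "u = (s + 1) * b^2 - (s^2 + 2 * s + 2) * b + (s^2 + s + 1)"
  define v where "v = b^2 - (s^4 + s^3 + s^2 + s + 2) * b + (s^3 + s^2 + s + 1)"
  have "(u - a * v) * e^2 + lecacheux_val s a = 0"
    using lecacheux_next_identity[where s = s and t = a]
    unfolding n_def[symmetric] e_def[symmetric] be u_def v_def
    by (simp add: algebra_simps power2_eq_square)
  then have u: "u = a * v" using a d by (simp add: e_def)
  have "s * lecacheux_val s b = v^2 * lecacheux_rel s a b"
    unfolding lecacheux_last_identity[symmetric] u_def[symmetric] v_def[symmetric] u lecacheux_rel_def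
    by (simp add: algebra_simps power2_eq_square)
  then show ?thesis using ab s by simp
qed

lemma lecacheux_rel_unique:
  assumes "lecacheux_rel s a b = 0" "lecacheux_rel s a c = 0" "(s + 1) * a - (s^2 + s + 1) \<noteq> 0"
  shows "b = c"
proof -
  have "((s + 1) * a - (s^2 + s + 1)) * (b - c) = lecacheux_rel s a b - lecacheux_rel s a c"
    by (simp add: lecacheux_rel_def algebra_simps)
  then show ?thesis using assms by simp
qed

text \<open>A root of a Lecacheux polynomial with odd parameter \<open>s\<close> different from 1 and -1.\<close>

locale lecacheux =
  fixes s :: int and \<theta> :: complex
  assumes s_odd: "odd s" and s_ne: "s \<noteq> 1" "s \<noteq> -1"
    and root: "rpoly (lecacheux_poly (of_int s)) \<theta> = 0"
begin

abbreviation S :: complex where "S \<equiv> of_int s"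
abbreviation f :: "rat poly" where "f \<equiv> lecacheux_poly (of_int s)"

lemma irr: "irreducible f" by (rule irreducible_lecacheux_poly[OF s_odd])

lemma deg: "degree f = 5" by (simp add: lecacheux_poly_def)

lemma rpoly_f: "rpoly f x = lecacheux_val S x"
  by (simp add: lecacheux_poly_def lecacheux_val_def of_rat_add of_rat_mult of_rat_diff of_rat_power
      of_rat_minus algebra_simps eval_nat_numeral)

lemma s0: "s \<noteq> 0" using s_odd by auto

lemma not_low_degree:
  assumes "lecacheux_val S x = 0" "rpoly q x = 0" "degree q < 5"
  shows "q = 0"
proof -
  have "f dvd q" using irreducible_root_dvd[OF irr _ assms(2)] assms(1) by (simp add: rpoly_f)
  then show ?thesis using assms(3) deg dvd_imp_degree_le by (metis not_less)
qed

lemma quadratic_independent: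
  fixes a b c :: int
  assumes "lecacheux_val S x = 0" "of_int a + of_int b * x + of_int c * x^2 = 0"
  shows "a = 0" "b = 0" "c = 0"
proof -
  have "rpoly [: of_int a, of_int b, of_int c :] x = 0"
    using assms(2) by (simp add: algebra_simps power2_eq_square)
  moreover have "degree [: of_int a, of_int b, of_int c :: rat :] < 5" by auto
  ultimately have "[: of_int a, of_int b, of_int c :: rat :] = 0"
    by (rule not_low_degree[OF assms(1)])
  then show "a = 0" "b = 0" "c = 0" by simp_all
qed

lemma den_nz: assumes "lecacheux_val S x = 0" shows "(S + 1) * x - (S^2 + S + 1) \<noteq> 0"
proof
  assume "(S + 1) * x - (S^2 + S + 1) = 0"
  then have "of_int (- (s^2 + s + 1)) + of_int (s + 1) * x + of_int 0 * x^2 = 0"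
    by (simp add: algebra_simps)
  then have "s + 1 = 0" by (rule quadratic_independent(2)[OF assms])
  then show False using s_ne by simp
qed

text \<open>The other roots, as rational functions of the root \<open>\<theta>\<close>, in the cyclic order; \<open>A\<close> is a recurring coefficient.\<close>

definition "A = S^4 + S^3 + S^2 + S + 2"
definition "\<theta>1 = (A * \<theta> - \<theta>^2 - (S^3 + S^2 + S + 1)) / ((S + 1) * \<theta> - (S^2 + S + 1))"
definition "\<theta>2 = (\<theta>^2 - (S^4 + S^3 + S^2 + 1) * \<theta> + S^3) / (\<theta> * ((S + 1) * \<theta> - (S^2 + S + 1)))"
definition "\<theta>3 = (\<theta>^2 + (S^5 + S^4 + S^3 + S^2 - 1) * \<theta> - S^2 * (S^4 + S^3 + S^2 + 1)) / (\<theta>^2 + (S^3 + S^2 - 1) * \<theta> - S^2)"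
definition "\<theta>4 = ((S + 1) * \<theta>^2 - (S^2 + 2 * S + 2) * \<theta> + (S^2 + S + 1)) / (\<theta>^2 - A * \<theta> + (S^3 + S^2 + S + 1))"

lemma val: "lecacheux_val S \<theta> = 0" using root by (simp add: rpoly_f)

lemma dens:
  "(S + 1) * \<theta> - (S^2 + S + 1) \<noteq> 0" "\<theta> * ((S + 1) * \<theta> - (S^2 + S + 1)) \<noteq> 0"
  "\<theta>^2 + (S^3 + S^2 - 1) * \<theta> - S^2 \<noteq> 0" "\<theta>^2 - A * \<theta> + (S^3 + S^2 + S + 1) \<noteq> 0"
proof -
  show 1: "(S + 1) * \<theta> - (S^2 + S + 1) \<noteq> 0" by (rule den_nz[OF val])
  have "\<theta> \<noteq> 0" using val s0 by (auto simp: lecacheux_val_def)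
  then show "\<theta> * ((S + 1) * \<theta> - (S^2 + S + 1)) \<noteq> 0" using 1 by simp
  show "\<theta>^2 + (S^3 + S^2 - 1) * \<theta> - S^2 \<noteq> 0"
  proof
    assume "\<theta>^2 + (S^3 + S^2 - 1) * \<theta> - S^2 = 0"
    then have "of_int (- (s^2)) + of_int (s^3 + s^2 - 1) * \<theta> + of_int 1 * \<theta>^2 = 0"
      by (simp add: algebra_simps)
    then have "(1::int) = 0" by (rule quadratic_independent(3)[OF val])
    then show False by simp
  qed
  show "\<theta>^2 - A * \<theta> + (S^3 + S^2 + S + 1) \<noteq> 0"
  proof
    assume "\<theta>^2 - A * \<theta> + (S^3 + S^2 + S + 1) = 0"
    then have "of_int (s^3 + s^2 + s + 1) + of_int (- (s^4 + s^3 + s^2 + s + 2)) * \<theta> + of_int 1 * \<theta>^2 = 0"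
      by (simp add: A_def algebra_simps)
    then have "(1::int) = 0" by (rule quadratic_independent(3)[OF val])
    then show False by simp
  qed
qed

lemma rels: "lecacheux_rel S \<theta> \<theta>1 = 0" "lecacheux_rel S \<theta>1 \<theta>2 = 0" "lecacheux_rel S \<theta>2 \<theta>3 = 0"
  "lecacheux_rel S \<theta>3 \<theta>4 = 0" "lecacheux_rel S \<theta>4 \<theta> = 0"
proof -
  have "lecacheux_rel S \<theta> \<theta>1 = \<theta>1 * ((S + 1) * \<theta> - (S^2 + S + 1)) - (A * \<theta> - \<theta>^2 - (S^3 + S^2 + S + 1))"
    by (simp add: lecacheux_rel_def A_def algebra_simps)
  then show "lecacheux_rel S \<theta> \<theta>1 = 0" using dens(1) by (simp add: \<theta>1_def)
  show "lecacheux_rel S \<theta>1 \<theta>2 = 0"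
    unfolding \<theta>1_def \<theta>2_def A_def
    by (rule lecacheux_rel_frac[OF dens(1,2)]) (simp only: lecacheux_rel12 val mult_zero_right)
  show "lecacheux_rel S \<theta>2 \<theta>3 = 0"
    unfolding \<theta>3_def \<theta>2_def A_def
    by (rule lecacheux_rel_frac[OF dens(2,3)]) (use lecacheux_rel23[where s = S and t = \<theta>] in \<open>simp only: val mult_zero_right add_0_right\<close>)
  show "lecacheux_rel S \<theta>3 \<theta>4 = 0"
    unfolding \<theta>3_def \<theta>4_def A_def
    by (rule lecacheux_rel_frac[OF dens(3,4)[unfolded A_def]]) (simp only: lecacheux_rel34 val mult_zero_right)
  have "lecacheux_rel S \<theta>4 (\<theta> / 1) = 0"
    unfolding \<theta>4_def A_def
    by (rule lecacheux_rel_frac[OF dens(4)[unfolded A_def]])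
      (use lecacheux_last_identity[of S \<theta>] val in \<open>simp_all add: mult_ac\<close>)
  then show "lecacheux_rel S \<theta>4 \<theta> = 0" by simp
qed

lemma vals: "lecacheux_val S \<theta>1 = 0" "lecacheux_val S \<theta>2 = 0" "lecacheux_val S \<theta>3 = 0" "lecacheux_val S \<theta>4 = 0"
proof -
  have S0: "S \<noteq> 0" using s0 by simp
  note nr = lecacheux_next_root[OF _ _ den_nz S0]
  show 1: "lecacheux_val S \<theta>1 = 0" by (rule nr[OF rels(1) val val])
  show 2: "lecacheux_val S \<theta>2 = 0" by (rule nr[OF rels(2) 1 1])
  show 3: "lecacheux_val S \<theta>3 = 0" by (rule nr[OF rels(3) 2 2])
  show 4: "lecacheux_val S \<theta>4 = 0" by (rule nr[OF rels(4) 3 3])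
qed

abbreviation K :: "complex set" where "K \<equiv> rat_adjoin \<theta>"
abbreviation \<sigma> :: "complex \<Rightarrow> complex" where "\<sigma> \<equiv> conj_map \<theta> \<theta>1"

lemma K_of_int: "of_int n \<in> K" using rat_adjoin_of_rat[of "of_int n"] by simp

lemma K_diff: "x \<in> K \<Longrightarrow> y \<in> K \<Longrightarrow> x - y \<in> K"
  using rat_adjoin_add[of x \<theta> "- y"] rat_adjoin_uminus[of y \<theta>] by simp

lemma K_numeral: "numeral n \<in> K" using K_of_int[of "numeral n"] by simp

lemma K_divide: "x \<in> K \<Longrightarrow> y \<in> K \<Longrightarrow> x / y \<in> K"
  unfolding divide_inverse by (intro rat_adjoin_mult rat_adjoin_inverse)

lemma \<theta>s_K: "\<theta>1 \<in> K" "\<theta>2 \<in> K" "\<theta>3 \<in> K" "\<theta>4 \<in> K"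
  unfolding \<theta>1_def \<theta>2_def \<theta>3_def \<theta>4_def A_def
  by (intro K_divide K_diff rat_adjoin_add rat_adjoin_mult rat_adjoin_power rat_adjoin_self K_of_int
      rat_adjoin_one K_numeral)+

lemma rel_\<sigma>:
  assumes "a \<in> K" "b \<in> K" and ab: "lecacheux_rel S a b = 0"
  shows "lecacheux_rel S (\<sigma> a) (\<sigma> b) = 0"
proof -
  have root1: "rpoly f \<theta>1 = 0" using vals by (simp add: rpoly_f)
  note \<sigma>r = conj_map_rpoly[OF irr root root1]
  have "a \<in> range (\<lambda>h. rpoly h \<theta>)" "b \<in> range (\<lambda>h. rpoly h \<theta>)"
    using assms(1,2) unfolding rat_adjoin_irreducible[OF irr root] by simp_all
  then obtain g h where gh: "a = rpoly g \<theta>" "b = rpoly h \<theta>" by (elim rangeE)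
  define q where "q = g * g + smult (of_int (s + 1)) (g * h) - smult (of_int (s^2 + s + 1)) h
    - smult (of_int (s^4 + s^3 + s^2 + s + 2)) g + [:of_int (s^3 + s^2 + s + 1):]"
  have q: "rpoly q x = lecacheux_rel S (rpoly g x) (rpoly h x)" for x
    by (simp add: q_def lecacheux_rel_def power2_eq_square of_rat_add of_rat_mult of_rat_power)
  have "f dvd q" using irreducible_root_dvd[OF irr root] ab q gh by simp
  then have "rpoly q \<theta>1 = 0" using root1 by (auto elim!: dvdE)
  then show ?thesis using q gh \<sigma>r by simp
qed

lemma \<sigma>_cycle: "\<sigma> \<theta> = \<theta>1" "\<sigma> \<theta>1 = \<theta>2" "\<sigma> \<theta>2 = \<theta>3" "\<sigma> \<theta>3 = \<theta>4" "\<sigma> \<theta>4 = \<theta>"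
proof -
  have root1: "rpoly f \<theta>1 = 0" using vals by (simp add: rpoly_f)
  show 0: "\<sigma> \<theta> = \<theta>1" using conj_map_rpoly[OF irr root root1, of "[:0,1:]"] by simp
  note u = lecacheux_rel_unique[OF _ _ den_nz]
  have t: "\<theta> \<in> K" by (rule rat_adjoin_self)
  show 1: "\<sigma> \<theta>1 = \<theta>2" using u[OF _ rels(2) vals(1)] rel_\<sigma>[OF t \<theta>s_K(1) rels(1)] 0 by simp
  show 2: "\<sigma> \<theta>2 = \<theta>3" using u[OF _ rels(3) vals(2)] rel_\<sigma>[OF \<theta>s_K(1,2) rels(2)] 1 by simp
  show 3: "\<sigma> \<theta>3 = \<theta>4" using u[OF _ rels(4) vals(3)] rel_\<sigma>[OF \<theta>s_K(2,3) rels(3)] 2 by simp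
  show "\<sigma> \<theta>4 = \<theta>" using u[OF _ rels(5) vals(4)] rel_\<sigma>[OF \<theta>s_K(3,4) rels(4)] 3 by simp
qed

lemma \<theta>1_ne: "\<theta>1 \<noteq> \<theta>"
proof
  assume "\<theta>1 = \<theta>"
  then have h: "lecacheux_rel S \<theta> \<theta> = 0" using rels(1) by simp
  then have "of_int (s^3 + s^2 + s + 1) + of_int (- (s^4 + s^3 + 2 * s^2 + 2 * s + 3)) * \<theta>
      + of_int (s + 2) * \<theta>^2 = 0"
    by (simp add: lecacheux_rel_def algebra_simps power2_eq_square)
  then have "s + 2 = 0" by (rule quadratic_independent(3)[OF val])
  then show False using s_odd by presburger
qed

lemma int_root: "poly (map_poly of_int (lecacheux_int s)) \<theta> = (0 :: complex)"
proof -
  have "poly (map_poly of_int (lecacheux_int s)) \<theta> = lecacheux_val S \<theta>"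
    by (simp add: lecacheux_int_def lecacheux_val_def map_poly_pCons algebra_simps eval_nat_numeral)
  then show ?thesis using val by simp
qed

lemma algebraic_int_\<theta>: "algebraic_int \<theta>"
  unfolding algebraic_int_altdef_ipoly
  using int_root by (intro exI[of _ "lecacheux_int s"]) (simp add: lecacheux_int_def)

sublocale cyclic_quintic K \<sigma>
proof (rule cyclic_quintic_conj_map[OF irr deg root algebraic_int_\<theta>])
  show "rpoly f \<theta>1 = 0" using vals by (simp add: rpoly_f)
qed (use \<theta>s_K \<theta>1_ne \<sigma>_cycle in auto)

end

section \<open>A ramified prime different from 11\<close>

text \<open>The cofactor \<open>C\<close> in the norm \<open>-E\<^sub>1E\<^sub>2\<^sup>2C\<close> of \<open>5\<theta> + s\<^sup>5 - 3\<close>.\<close>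

definition lecacheux_C :: "int \<Rightarrow> int"
  where "lecacheux_C s = 4 * s^13 + 9 * s^12 - 22 * s^11 + 22 * s^10 + 6 * s^8 - 74 * s^7 + 142 * s^6
    - 142 * s^5 + 96 * s^3 - 84 * s^2 + 72 * s - 72"

lemma E1_E2_bezout:
  fixes s :: int
  shows "(7 * s^3 + 22 * s^2 + 29 * s + 11) * lecacheux_E1 s
    + (13 * s^2 + 14 - 7 * s^3 - 24 * s) * lecacheux_E2 s = 25"
  unfolding lecacheux_E1_def lecacheux_E2_def by (simp add: algebra_simps eval_nat_numeral)

lemma E1_C_bezout:
  fixes s :: int
  shows "(20 * s^12 + 77 * s^11 - 14 * s^10 + 75 * s^8 + 105 * s^7 - 282 * s^6 + 159 * s^5 - 475 * s^3
      + 5 * s^2 + 3 * s + 49) * lecacheux_E1 s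
    - (5 * s^3 - 2 * s^2 + 10 * s + 8) * lecacheux_C s = 625"
proof -
  have "[:49, 3, 5, -475, 0, 159, -282, 105, 75, 0, -14, 77, 20:] * [:1, -3, 4, -2, 1:]
    - [:8, 10, -2, 5:] * [:-72, 72, -84, 96, 0, -142, 142, -74, 6, 0, 22, -22, 9, 4:] = [:625 :: int:]"
    by simp
  note eq = this
  have ev: "poly [:49, 3, 5, -475, 0, 159, -282, 105, 75, 0, -14, 77, 20:] s
      = 20 * s^12 + 77 * s^11 - 14 * s^10 + 75 * s^8 + 105 * s^7 - 282 * s^6 + 159 * s^5 - 475 * s^3
        + 5 * s^2 + 3 * s + 49"
    "poly [:1, -3, 4, -2, 1:] s = lecacheux_E1 s" "poly [:8, 10, -2, 5:] s = 5 * s^3 - 2 * s^2 + 10 * s + 8"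
    "poly [:-72, 72, -84, 96, 0, -142, 142, -74, 6, 0, 22, -22, 9, 4:] s = lecacheux_C s" "poly [:625:] s = 625"
    by (simp_all add: lecacheux_E1_def lecacheux_C_def algebra_simps eval_nat_numeral)
  from arg_cong[OF eq, of "\<lambda>p. poly p s"] show ?thesis
    unfolding poly_mult poly_diff ev .
qed

lemma exists_prime_divisor_avoiding_5_11:
  fixes n :: int
  assumes n: "n > 605" "\<not> 25 dvd n" "\<not> 11 ^ 3 dvd n"
  shows "\<exists>m. m dvd n \<and> m > 1 \<and> \<not> 5 dvd m \<and> \<not> 11 dvd m"
proof -
  obtain m where m: "m dvd n" "\<not> 5 dvd m" "m > 121"
  proof (cases "5 dvd n")
    case True
    then obtain m where m: "n = 5 * m" ..
    have "\<not> 5 dvd m" using n(2) m by (auto elim!: dvdE)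
    then show ?thesis using that[of m] m n(1) by simp
  next
    case False
    then show ?thesis using that[of n] n(1) by simp
  qed
  show ?thesis
  proof (cases "11 dvd m")
    case False
    then show ?thesis using m by (intro exI[of _ m]) simp
  next
    case True
    then obtain k where k: "m = 11 * k" ..
    have kn: "k dvd n" using k m(1) by (meson dvd_trans dvd_triv_right)
    have k5: "\<not> 5 dvd k" using k m(2) by auto
    show ?thesis
    proof (cases "11 dvd k")
      case False
      then show ?thesis using kn k5 k m by (intro exI[of _ k]) simp
    next
      case True
      then obtain l where l: "k = 11 * l" ..
      have "\<not> 11 dvd l"
      proof
        assume "11 dvd l"
        then have "11 ^ 3 dvd m" using k l by (auto elim!: dvdE)
        then show False using n(3) m(1) dvd_trans by blast
      qed
      moreover have "l dvd n" using l kn by (meson dvd_trans dvd_triv_right)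
      moreover have "\<not> 5 dvd l" using l k5 by auto
      ultimately show ?thesis using l k m by (intro exI[of _ l]) simp
    qed
  qed
qed

text \<open>In terms of \<open>w = s(s - 1)\<close>, \<open>E\<^sub>1 = w\<^sup>2 + 3w + 1\<close> is congruent to \<open>(w - 1)\<^sup>2\<close> modulo 5.\<close>

lemma not_25_dvd_E1: "\<not> 25 dvd lecacheux_E1 s"
proof
  define w where "w = s * (s - 1)"
  have E: "lecacheux_E1 s = w * w + 3 * w + 1"
    by (simp add: lecacheux_E1_def w_def algebra_simps eval_nat_numeral)
  assume h: "25 dvd lecacheux_E1 s"
  then have "5 dvd w * w + 3 * w + 1" unfolding E by (rule dvd_trans[rotated]) simp
  then have "5 dvd (w * w + 3 * w + 1) - 5 * w" by (intro dvd_diff) auto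
  also have "(w * w + 3 * w + 1) - 5 * w = (w - 1) ^ 2" by (simp add: power2_eq_square algebra_simps)
  finally have "5 dvd (w - 1) ^ 2" .
  moreover have "prime (5::int)" by simp
  ultimately have "5 dvd w - 1" using prime_dvd_power by blast
  then obtain k where "w - 1 = 5 * k" ..
  then have w: "w = 5 * k + 1" by simp
  have "lecacheux_E1 s = 25 * (k * k + k) + 5" unfolding E w by (simp add: algebra_simps)
  then have "25 dvd 25 * (k * k + k) + (5::int)" using h by simp
  then have "25 dvd (5::int)" by (simp only: dvd_add_right_iff dvd_triv_left)
  then show False by simp
qed

text \<open>If \<open>E\<^sub>1 > 605 = 5 \<cdot> 11\<^sup>2\<close>, it has a prime divisor other than 5 and 11, since 25 and \<open>11\<^sup>3\<close> do not divide it. The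
  remaining values \<open>s = 5\<close> and \<open>s = -3\<close> give the primes 461 and 181. Only for \<open>s = 3\<close>, where \<open>E\<^sub>1 = 55\<close>, the prime is
  taken from \<open>E\<^sub>2 = 205 = 5 \<cdot> 41\<close>.\<close>

lemma exists_ramified_prime:
  assumes s: "odd s" "s \<noteq> 1" "s \<noteq> -1" and cf: "cube_free (lecacheux_E1 s)"
  obtains q where "prime q" "q \<noteq> 11" "q dvd lecacheux_E1 s * lecacheux_E2 s"
    "\<not> q ^ 5 dvd lecacheux_E1 s * lecacheux_E2 s ^ 2 * lecacheux_C s"
proof (cases "s = 3")
  case True
  show ?thesis
  proof (rule that[of 41])
    show "prime (41::int)" by simp
  qed (simp_all add: True lecacheux_E1_def lecacheux_E2_def lecacheux_C_def)
next
  case False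
  have "\<exists>m. m dvd lecacheux_E1 s \<and> m > 1 \<and> \<not> 5 dvd m \<and> \<not> 11 dvd m"
  proof (cases "s = 5 \<or> s = -3")
    case True
    then show ?thesis by (intro exI[of _ "lecacheux_E1 s"]) (auto simp: lecacheux_E1_def)
  next
    case ns: False
    define w where "w = s * (s - 1)"
    have E: "lecacheux_E1 s = w * w + 3 * w + 1"
      by (simp add: lecacheux_E1_def w_def algebra_simps eval_nat_numeral)
    have "s \<ge> 7 \<or> s \<le> -5" using s False ns by presburger
    then have "w \<ge> 30"
    proof
      assume "s \<ge> 7"
      then have "7 * 6 \<le> s * (s - 1)" by (intro mult_mono) auto
      then show ?thesis by (simp add: w_def)
    next
      assume "s \<le> -5"
      then have "5 * 6 \<le> (- s) * (1 - s)" by (intro mult_mono) auto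
      then show ?thesis by (simp add: w_def algebra_simps)
    qed
    moreover from this have "30 * 30 \<le> w * w" by (intro mult_mono) auto
    ultimately have "lecacheux_E1 s > 605" unfolding E by linarith
    moreover have "prime (11::int)" by simp
    then have "\<not> 11 ^ 3 dvd lecacheux_E1 s" using cf unfolding cube_free_def by blast
    ultimately show ?thesis using exists_prime_divisor_avoiding_5_11 not_25_dvd_E1 \<open>\<not> 11 ^ 3 dvd lecacheux_E1 s\<close> by blast
  qed
  then obtain m where m: "m dvd lecacheux_E1 s" "m > 1" "\<not> 5 dvd m" "\<not> 11 dvd m" by blast
  then obtain q where q: "prime q" "q dvd m" using prime_factor_int[of m] by auto
  have q5: "q \<noteq> 5" "q \<noteq> 11" using q m by auto
  have qE1: "q dvd lecacheux_E1 s" using q m dvd_trans by blast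
  have n5: "\<not> q dvd 5"
    using q(1) q5 primes_dvd_imp_eq[of q 5] by auto
  have nE2: "\<not> q dvd lecacheux_E2 s"
  proof
    assume "q dvd lecacheux_E2 s"
    then have "q dvd 25" unfolding E1_E2_bezout[of s, symmetric] using qE1 by (intro dvd_add dvd_mult)
    then have "q dvd 5 ^ 2" by simp
    then show False using n5 q(1) prime_dvd_power by blast
  qed
  have nC: "\<not> q dvd lecacheux_C s"
  proof
    assume "q dvd lecacheux_C s"
    then have "q dvd 625" unfolding E1_C_bezout[of s, symmetric] using qE1 by (intro dvd_diff dvd_mult)
    then have "q dvd 5 ^ 4" by simp
    then show False using n5 q(1) prime_dvd_power by blast
  qed
  show ?thesis
  proof (rule that[OF q(1) q5(2)])
    show "q dvd lecacheux_E1 s * lecacheux_E2 s" using qE1 by simp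
    show "\<not> q ^ 5 dvd lecacheux_E1 s * lecacheux_E2 s ^ 2 * lecacheux_C s"
    proof
      assume h: "q ^ 5 dvd lecacheux_E1 s * lecacheux_E2 s ^ 2 * lecacheux_C s"
      have c: "coprime (q ^ 5) (lecacheux_E2 s ^ 2)" "coprime (q ^ 5) (lecacheux_C s)"
        using q(1) nE2 nC by (simp_all add: prime_imp_coprime)
      have "q ^ 5 dvd lecacheux_E1 s"
        using h c by (simp add: coprime_dvd_mult_left_iff)
      then have "q ^ 3 dvd lecacheux_E1 s" by (rule dvd_trans[rotated]) (simp add: le_imp_power_dvd)
      then show False using cf q(1) by (auto simp: cube_free_def)
    qed
  qed
qed

text \<open>The characteristic polynomial of \<open>5\<theta> + s\<^sup>5 - 3\<close>.\<close>

lemma lecacheux_shift_identity: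
  fixes s t :: complex
  defines "E1 \<equiv> s^4 - 2 * s^3 + 4 * s^2 - 3 * s + 1" and "E2 \<equiv> s^4 + 3 * s^3 + 4 * s^2 + 2 * s + 1"
    and "b \<equiv> 5 * t + (s^5 - 3)"
  shows "b^5 - E1 * E2 * (15 + 15 * s + 10 * s^2) * b^3
    + E1 * E2^2 * (10 - 10 * s - 5 * s^2 + 20 * s^3) * b^2
    + E1 * E2^2 * (60 - 60 * s + 20 * s^2 + 20 * s^3 - 45 * s^5 + 45 * s^6 - 15 * s^7 - 15 * s^8) * b
    + E1 * E2^2 * (4 * s^13 + 9 * s^12 - 22 * s^11 + 22 * s^10 + 6 * s^8 - 74 * s^7 + 142 * s^6
    - 142 * s^5 + 96 * s^3 - 84 * s^2 + 72 * s - 72) = 3125 * lecacheux_val s t"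
proof -
  have horner: "(((y^2 - k3) * y + k2) * y + k1) * y + k0 = y^5 - k3 * y^3 + k2 * y^2 + k1 * y + k0"
    for y k0 k1 k2 k3 :: complex
    by (simp add: algebra_simps eval_nat_numeral)
  define B :: "int poly poly" where "B = [:[:-3, 0, 0, 0, 0, 1:], [:5:]:]"
  define P :: "int poly poly" where "P = [:[:1, -3, 4, -2, 1:]:]"
  define Q :: "int poly poly" where "Q = [:[:1, 2, 4, 3, 1:]:]"
  define U3 :: "int poly poly" where "U3 = [:[:15, 15, 10:]:]"
  define U2 :: "int poly poly" where "U2 = [:[:10, -10, -5, 20:]:]"
  define U1 :: "int poly poly" where "U1 = [:[:60, -60, 20, 20, 0, -45, 45, -15, -15:]:]"
  define U0 :: "int poly poly" where "U0 = [:[:-72, 72, -84, 96, 0, -142, 142, -74, 6, 0, 22, -22, 9, 4:]:]"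
  define V :: "int poly poly" where "V = [:[:3125:]:]"
  have ev: "eval2 B s t = b" "eval2 P s t = E1" "eval2 Q s t = E2" "eval2 U3 s t = 15 + 15 * s + 10 * s^2" "eval2 U2 s t = 10 - 10 * s - 5 * s^2 + 20 * s^3" "eval2 U1 s t = 60 - 60 * s + 20 * s^2 + 20 * s^3 - 45 * s^5 + 45 * s^6 - 15 * s^7 - 15 * s^8" "eval2 U0 s t = 4 * s^13 + 9 * s^12 - 22 * s^11 + 22 * s^10 + 6 * s^8 - 74 * s^7 + 142 * s^6
    - 142 * s^5 + 96 * s^3 - 84 * s^2 + 72 * s - 72" "eval2 V s t = 3125"
    unfolding B_def P_def Q_def U3_def U2_def U1_def U0_def V_def b_def E1_def E2_def
    by (simp_all add: eval2_simps algebra_simps eval_nat_numeral)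
  have "(((B^2 - P * Q * U3) * B + P * Q^2 * U2) * B + P * Q^2 * U1) * B + P * Q^2 * U0
      - V * lecacheux_poly2 = 0"
    unfolding B_def P_def Q_def U3_def U2_def U1_def U0_def V_def lecacheux_poly2_def eval_nat_numeral by simp
  from arg_cong[OF this, of "\<lambda>P. eval2 P s t"] show ?thesis
    unfolding eval2_hom ev eval2_lecacheux eval2_lecacheux_consts eval2_pCons(2) horner by (simp only: right_minus_eq)
qed

section \<open>Monogenicity and index of Lecacheux quintic fields\<close>

context lecacheux
begin

lemma \<theta>_O: "\<theta> \<in> \<O>"
  using algebraic_int_\<theta> rat_adjoin_self by (simp add: ring_of_integers_def)

lemma \<sigma>_\<theta>_ne: "\<sigma> \<theta> \<noteq> \<theta>" using \<sigma>_cycle \<theta>1_ne by simp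

theorem not_monogenic:
  assumes cf: "cube_free (lecacheux_E1 s)"
  shows "\<not> monogenic K"
proof
  assume mono: "monogenic K"
  obtain q where q: "prime q" "q \<noteq> 11" "q dvd lecacheux_E1 s * lecacheux_E2 s"
    "\<not> q ^ 5 dvd lecacheux_E1 s * lecacheux_E2 s ^ 2 * lecacheux_C s"
    using exists_ramified_prime[OF s_odd s_ne cf] .
  define b where "b = 5 * \<theta> + of_int (s^5 - 3)"
  have bO: "b \<in> \<O>" unfolding b_def by (intro O_intros \<theta>_O)
  have \<theta>K: "\<theta> \<in> K" by (rule O_K[OF \<theta>_O])
  have "\<sigma> b = 5 * \<sigma> \<theta> + of_int (s^5 - 3)"
    unfolding b_def using \<theta>K \<sigma>_of_int[of "s^5 - 3"] by (simp only: \<sigma>_add \<sigma>_mult mult_K numeral_K of_int_K \<sigma>_numeral)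
  then have ne: "\<sigma> b \<noteq> b" using \<sigma>_\<theta>_ne by (simp add: b_def)
  define k3 where "k3 = - (lecacheux_E1 s * lecacheux_E2 s * (15 + 15 * s + 10 * s^2))"
  define k2 where "k2 = lecacheux_E1 s * lecacheux_E2 s ^ 2 * (10 - 10 * s - 5 * s^2 + 20 * s^3)"
  define k1 where "k1 = lecacheux_E1 s * lecacheux_E2 s ^ 2 *
    (60 - 60 * s + 20 * s^2 + 20 * s^3 - 45 * s^5 + 45 * s^6 - 15 * s^7 - 15 * s^8)"
  define k0 where "k0 = lecacheux_E1 s * lecacheux_E2 s ^ 2 * lecacheux_C s"
  have eq: "b^5 + of_int k3 * b^3 + of_int k2 * b^2 + of_int k1 * b + of_int k0 = 0"
    using lecacheux_shift_identity[where s = S and t = \<theta>] val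
    by (simp add: k3_def k2_def k1_def k0_def b_def lecacheux_E1_def lecacheux_E2_def lecacheux_C_def)
  define p where "p = [: k0, k1, k2, k3, 0, 1 :]"
  have "poly (map_poly of_int p) b = b^5 + of_int k3 * b^3 + of_int k2 * b^2 + of_int k1 * b + of_int k0"
    by (simp add: p_def map_poly_pCons algebra_simps eval_nat_numeral)
  then have "poly (map_poly of_int p) b = 0" using eq by simp
  from N_monic_int_poly[OF bO ne _ _ this] have Nb: "N b = - k0"
    by (simp add: p_def numeral_eq_Suc)
  have dv: "q dvd k3" "q dvd k2" "q dvd k1" "q dvd k0"
    using q(3) unfolding k3_def k2_def k1_def k0_def power2_eq_square
    by (auto simp: mult.assoc[symmetric] intro: dvd_mult2)
  have od: "idvd q (of_int k)" if "q dvd k" for k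
    using that q(1) by (subst odvd_of_int_iff) auto
  have b5: "b ^ 5 = - (of_int k3 * b^3 + of_int k2 * b^2 + of_int k1 * b + of_int k0)"
    using eq by (subst eq_neg_iff_add_eq_0) (simp add: add.assoc)
  have "idvd q (b ^ 5)" unfolding b5
    by (intro odvd_uminus odvd_add odvd_mult(1) od dv O_intros bO)
  then have "nilp q b" unfolding nilp_def ..
  then have "idvd q b" by (rule monogenic_unramified_outside_11[OF mono q(1,2) bO])
  then have "N (of_int q) dvd N b" by (rule N_dvd[OF O_of_int])
  then have "q ^ 5 dvd k0" using Nb by simp
  then show False using q(4) by (simp add: k0_def)
qed

lemma lecacheux_int_coeffs:
  obtains a0 a1 a2 a3 a4 where "lecacheux_int s = [: a0, a1, a2, a3, a4, 1 :]"
    "a0 = s^5" "a1 = - (s^9) - 2 * s^8 - 3 * s^7 - 5 * s^6 - 5 * s^5 - 2 * s^4 + s^3 - s^2"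
    "a2 = s^10 + 2 * s^9 + 4 * s^8 + 6 * s^7 + 10 * s^6 + 9 * s^5 + 4 * s^4 - 2 * s^3 + 2 * s^2 - 1"
    "a3 = - (s^9) - 2 * s^8 - 3 * s^7 - 5 * s^6 - 6 * s^5 - 2 * s^4 + s^3 - s^2 + 3" "a4 = s^5 - 3"
    "of_int a0 + of_int a1 * \<theta> + of_int a2 * \<theta>^2 + of_int a3 * \<theta>^3 + of_int a4 * \<theta>^4 + \<theta>^5 = 0"
    "D \<theta> = of_int a1 + 2 * of_int a2 * \<theta> + 3 * of_int a3 * \<theta>^2 + 4 * of_int a4 * \<theta>^3 + 5 * \<theta>^4"
proof -
  define a1 where "a1 = - (s^9) - 2 * s^8 - 3 * s^7 - 5 * s^6 - 5 * s^5 - 2 * s^4 + s^3 - s^2"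
  define a2 where "a2 = s^10 + 2 * s^9 + 4 * s^8 + 6 * s^7 + 10 * s^6 + 9 * s^5 + 4 * s^4 - 2 * s^3 + 2 * s^2 - 1"
  define a3 where "a3 = - (s^9) - 2 * s^8 - 3 * s^7 - 5 * s^6 - 6 * s^5 - 2 * s^4 + s^3 - s^2 + 3"
  have F: "lecacheux_int s = [: s^5, a1, a2, a3, s^5 - 3, 1 :]"
    by (simp add: lecacheux_int_def a1_def a2_def a3_def algebra_simps eval_nat_numeral)
  have "of_int (s^5) + of_int a1 * \<theta> + of_int a2 * \<theta>^2 + of_int a3 * \<theta>^3 + of_int (s^5 - 3) * \<theta>^4 + \<theta>^5
    = poly (map_poly of_int (lecacheux_int s)) \<theta>"
    unfolding F by (simp add: map_poly_pCons algebra_simps eval_nat_numeral)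
  moreover have "D \<theta> = poly (pderiv (map_poly of_int (lecacheux_int s))) \<theta>"
    by (rule D_monic_int_poly[OF O_K[OF \<theta>_O] \<sigma>_\<theta>_ne _ _ int_root]) (simp_all add: F numeral_eq_Suc)
  moreover have "\<dots> = of_int a1 + 2 * of_int a2 * \<theta> + 3 * of_int a3 * \<theta>^2 + 4 * of_int (s^5 - 3) * \<theta>^3 + 5 * \<theta>^4"
    unfolding F by (simp add: map_poly_pCons pderiv_pCons algebra_simps eval_nat_numeral)
  ultimately show ?thesis using that[OF F refl a1_def a2_def a3_def refl] int_root by simp
qed

lemma N_\<theta>: "N \<theta> = - (s ^ 5)"
proof -
  obtain a0 a1 a2 a3 a4 where a: "lecacheux_int s = [: a0, a1, a2, a3, a4, 1 :]" "a0 = s^5"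
    using lecacheux_int_coeffs by metis
  show ?thesis
    using N_monic_int_poly[OF \<theta>_O \<sigma>_\<theta>_ne _ _ int_root] a by (simp add: numeral_eq_Suc)
qed

text \<open>Modulo 2 the different of \<open>\<theta>\<close> is \<open>\<theta>\<^sup>4\<close>, and \<open>\<theta>\<close> has the odd norm \<open>-s\<^sup>5\<close>.\<close>

lemma not_2_dvd_N_D: "\<not> 2 dvd N (D \<theta>)"
proof -
  obtain a0 a1 a2 a3 a4 where a:
    "a1 = - (s^9) - 2 * s^8 - 3 * s^7 - 5 * s^6 - 5 * s^5 - 2 * s^4 + s^3 - s^2"
    "a3 = - (s^9) - 2 * s^8 - 3 * s^7 - 5 * s^6 - 6 * s^5 - 2 * s^4 + s^3 - s^2 + 3"
    and D: "D \<theta> = of_int a1 + 2 * of_int a2 * \<theta> + 3 * of_int a3 * \<theta>^2 + 4 * of_int a4 * \<theta>^3 + 5 * \<theta>^4"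
    using lecacheux_int_coeffs by metis
  have "even a1" "even a3" using s_odd unfolding a by simp_all
  then obtain m1 m3 where m: "a1 = 2 * m1" "a3 = 2 * m3" by (elim evenE)
  have "D \<theta> - \<theta>^4 = of_int 2 * (of_int m1 + of_int a2 * \<theta> + 3 * of_int m3 * \<theta>^2 + 2 * of_int a4 * \<theta>^3 + 2 * \<theta>^4)"
    unfolding D m by (simp add: algebra_simps)
  then have "odvd (of_int 2) (D \<theta> - \<theta>^4)" by (rule odvdI[rotated]) (intro O_intros \<theta>_O)
  then have "2 dvd N (D \<theta>) - N (\<theta> ^ 4)" by (intro N_cong D_O O_intros \<theta>_O) auto
  moreover have "odd (N (\<theta> ^ 4))" using s_odd by (simp add: N_power[OF \<theta>_O] N_\<theta>)
  ultimately show ?thesis by presburger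
qed

text \<open>For \<open>s \<equiv> 1\<close> modulo 3 the inverse of the different of \<open>\<theta>\<close> modulo 3 is \<open>\<theta>\<^sup>4\<close>, and for \<open>s \<equiv> -1\<close> it is
  \<open>1 - \<theta> + \<theta>\<^sup>2 + \<theta>\<^sup>3 + \<theta>\<^sup>4\<close>.\<close>

lemma not_3_dvd_N_D:
  assumes "\<not> 3 dvd s"
  shows "\<not> 3 dvd N (D \<theta>)"
proof -
  obtain a0 a1 a2 a3 a4 where a: "a0 = s^5"
    "a1 = - (s^9) - 2 * s^8 - 3 * s^7 - 5 * s^6 - 5 * s^5 - 2 * s^4 + s^3 - s^2"
    "a2 = s^10 + 2 * s^9 + 4 * s^8 + 6 * s^7 + 10 * s^6 + 9 * s^5 + 4 * s^4 - 2 * s^3 + 2 * s^2 - 1"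
    "a3 = - (s^9) - 2 * s^8 - 3 * s^7 - 5 * s^6 - 6 * s^5 - 2 * s^4 + s^3 - s^2 + 3" "a4 = s^5 - 3"
    and e: "of_int a0 + of_int a1 * \<theta> + of_int a2 * \<theta>^2 + of_int a3 * \<theta>^3 + of_int a4 * \<theta>^4 + \<theta>^5 = 0"
    and D: "D \<theta> = of_int a1 + 2 * of_int a2 * \<theta> + 3 * of_int a3 * \<theta>^2 + 4 * of_int a4 * \<theta>^3 + 5 * \<theta>^4"
    using lecacheux_int_coeffs by metis
  have pw: "\<exists>m. s ^ j = r ^ j + 3 * m" if "3 dvd s - r" for j :: nat and r
  proof -
    have "s - r dvd s ^ j - r ^ j" by (metis power_diff_sumr2 dvd_triv_left)
    then have "3 dvd s ^ j - r ^ j" using that dvd_trans by blast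
    then obtain m where "s ^ j - r ^ j = 3 * m" ..
    then show ?thesis by (intro exI[of _ m]) simp
  qed
  have "3 dvd s - 1 \<or> 3 dvd s - (-1)" using assms by presburger
  then show ?thesis
  proof
    assume "3 dvd s - 1"
    then have "\<forall>j. \<exists>m. s ^ j = 1 + 3 * m" using pw[of 1] by simp
    then obtain m where m: "\<And>j. s ^ j = 1 + 3 * m j" by metis
    have "\<exists>k. a0 = 1 + 3 * k" "\<exists>k. a1 = 0 + 3 * k" "\<exists>k. a2 = 2 + 3 * k" "\<exists>k. a3 = 2 + 3 * k" "\<exists>k. a4 = 1 + 3 * k"
      unfolding a m by presburger+
    then obtain k0 k1 k2 k3 k4 where k: "a0 = 1 + 3 * k0" "a1 = 0 + 3 * k1" "a2 = 2 + 3 * k2" "a3 = 2 + 3 * k3" "a4 = 1 + 3 * k4"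
      by metis
    define U where "U = \<theta>^4 + \<theta>^3 + 4 * of_int k4 * \<theta>^3 + of_int a3 * \<theta>^2 + \<theta> + 2 * of_int k2 * \<theta> + of_int k1"
    define Y where "Y = of_int k4 * \<theta>^4 + of_int k3 * \<theta>^3 + of_int k2 * \<theta>^2 + of_int k1 * \<theta> + of_int k0"
    have UY: "U \<in> \<O>" "Y \<in> \<O>" unfolding U_def Y_def by (intro O_intros \<theta>_O)+
    have DU: "D \<theta> = \<theta> + \<theta>^3 + 2 * \<theta>^4 + 3 * U" unfolding D U_def by (simp add: k algebra_simps)
    have eY: "\<theta>^5 + \<theta>^4 + 2 * \<theta>^3 + 2 * \<theta>^2 + 1 + 3 * Y = 0"
      using e unfolding Y_def by (simp add: k algebra_simps)
    have "D \<theta> * \<theta>^4 - of_int 1 = of_int 3 * (U * \<theta>^4 - (2 - 3 * \<theta> - \<theta>^2 + 2 * \<theta>^3) * Y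
        + (- 1 + \<theta> - \<theta>^2 + 2 * \<theta>^4))
      + (2 - 3 * \<theta> - \<theta>^2 + 2 * \<theta>^3) * (\<theta>^5 + \<theta>^4 + 2 * \<theta>^3 + 2 * \<theta>^2 + 1 + 3 * Y)"
      unfolding DU by (simp add: algebra_simps eval_nat_numeral)
    from odvdI[OF _ this[unfolded eY mult_zero_right add_0_right]]
    have "odvd (of_int 3) (D \<theta> * \<theta>^4 - of_int 1)"
      using UY by (auto intro!: O_intros \<theta>_O)
    then show ?thesis by (intro not_dvd_N[of 3 _ "\<theta>^4" 1] D_O O_intros \<theta>_O) auto
  next
    assume h: "3 dvd s - (-1)"
    have "\<forall>j. \<exists>m. s ^ j = (-1) ^ j + 3 * m" using pw[OF h] by simp
    then obtain m where m: "\<And>j. s ^ j = (-1) ^ j + 3 * m j" by metis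
    have "\<exists>k. a0 = 2 + 3 * k" "\<exists>k. a1 = 1 + 3 * k" "\<exists>k. a2 = 2 + 3 * k" "\<exists>k. a3 = 2 + 3 * k" "\<exists>k. a4 = 2 + 3 * k"
      unfolding a m by (simp_all, presburger+)
    then obtain k0 k1 k2 k3 k4 where k: "a0 = 2 + 3 * k0" "a1 = 1 + 3 * k1" "a2 = 2 + 3 * k2" "a3 = 2 + 3 * k3" "a4 = 2 + 3 * k4"
      by metis
    define U where "U = \<theta>^4 + 2 * \<theta>^3 + 4 * of_int k4 * \<theta>^3 + of_int a3 * \<theta>^2 + \<theta> + 2 * of_int k2 * \<theta> + of_int k1"
    define Y where "Y = of_int k4 * \<theta>^4 + of_int k3 * \<theta>^3 + of_int k2 * \<theta>^2 + of_int k1 * \<theta> + of_int k0"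
    define w where "w = 1 - \<theta> + \<theta>^2 + \<theta>^3 + \<theta>^4"
    have wO: "w \<in> \<O>" unfolding w_def by (intro O_intros \<theta>_O)
    have UY: "U \<in> \<O>" "Y \<in> \<O>" unfolding U_def Y_def by (intro O_intros \<theta>_O)+
    have DU: "D \<theta> = 1 + \<theta> + 2 * \<theta>^3 + 2 * \<theta>^4 + 3 * U" unfolding D U_def by (simp add: k algebra_simps)
    have eY: "\<theta>^5 + 2 * \<theta>^4 + 2 * \<theta>^3 + 2 * \<theta>^2 + \<theta> + 2 + 3 * Y = 0"
      using e unfolding Y_def by (simp add: k algebra_simps)
    have "D \<theta> * w - of_int 1 = of_int 3 * (U * w - (2 * \<theta>^3 - 3) * Y
        + (2 + \<theta> + 2 * \<theta>^2 + 2 * \<theta>^3 + 2 * \<theta>^4))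
      + (2 * \<theta>^3 - 3) * (\<theta>^5 + 2 * \<theta>^4 + 2 * \<theta>^3 + 2 * \<theta>^2 + \<theta> + 2 + 3 * Y)"
      unfolding DU w_def by (simp add: algebra_simps eval_nat_numeral)
    from odvdI[OF _ this[unfolded eY mult_zero_right add_0_right]]
    have "odvd (of_int 3) (D \<theta> * w - of_int 1)"
      using UY by (auto intro!: O_intros \<theta>_O wO)
    then show ?thesis by (intro not_dvd_N[of 3 _ w 1] D_O wO \<theta>_O) auto
  qed
qed

theorem field_index_eq_1:
  assumes s3: "\<not> 3 dvd s"
  shows "field_index K = 1"
proof (rule ccontr)
  assume "field_index K \<noteq> 1"
  then obtain p where p: "prime p" "p dvd field_index K" using prime_factor_nat by blast
  have "\<exists>a\<in>\<O>. \<sigma> a \<noteq> a \<and> \<not> p dvd element_index K a"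
  proof (cases "p \<ge> 5")
    case True
    then show ?thesis using exists_index_not_dvd p by blast
  next
    case False
    have "p \<noteq> 4" using p(1) by auto
    then have "p = 2 \<or> p = 3" using False prime_ge_2_nat[OF p(1)] by linarith
    then have "\<not> int p dvd N (D \<theta>)" using not_2_dvd_N_D not_3_dvd_N_D[OF s3] by auto
    then show ?thesis using index_not_dvd_N[OF \<theta>_O p(1)] \<theta>_O by blast
  qed
  then obtain a where a: "a \<in> \<O>" "\<sigma> a \<noteq> a" "\<not> p dvd element_index K a" by blast
  have "K = rat_adjoin a" using rat_adjoin_eq[OF O_K[OF a(1)] a(2)] by simp
  then have "field_index K dvd element_index K a"
    unfolding field_index_def using a(1) by (intro Gcd_dvd) blast
  then show False using p(2) a(3) dvd_trans by blast
qed

end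

theorem theorem1p3:
  fixes s :: int and \<theta> :: complex
  assumes "odd s" and "s \<noteq> 1" and "s \<noteq> -1"
    and "poly (map_poly of_rat (lecacheux_poly (of_int s))) \<theta> = 0"
  shows "(cube_free (lecacheux_E1 s) \<and> cube_free (lecacheux_E2 s)
            \<longrightarrow> \<not> monogenic (rat_adjoin \<theta>))
       \<and> (\<not> 3 dvd s \<longrightarrow> field_index (rat_adjoin \<theta>) = 1)"
proof -
  interpret lecacheux s \<theta> by unfold_locales (use assms in auto)
  show ?thesis using not_monogenic field_index_eq_1 by blast
qed

end
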